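(* Let $A$ be a commutative noetherian ring and $\mathfrak a$ an ideal of $A$. Then $D_{\rm cof}(A,\mathfrak a)$ is a thick subcategory of $D(A)$ if and only if $\mathcal{M}(A,\mathfrak a)_{\rm cof}$ is an abelian subcategory of $\operatorname{Mod} A$.
   Context: $\mathcal{M}(A,\mathfrak a)_{\rm cof}$ is the full subcategory of $\operatorname{Mod}A$ of $\mathfrak a$-cofinite modules, i.e. modules $M$ with $\operatorname{Supp}_A M\subseteq V(\mathfrak a)$ and $\operatorname{Ext}^i_A(A/\mathfrak a,M)$ finitely generated for all $i\ge 0$. It is an abelian subcategory if it is closed under kernels and cokernels of its morphisms. $D(A)$ is the derived category of $A$-modules; $D_{\rm cof}(A,\mathfrak a)$ is the full subcategory of $D(A)$ of complexes $X^{\bullet}$ with $H^i(X^{\bullet})\in\mathcal{M}(A,\mathfrak a)_{\rm cof}$ for all integers $i$. A (full) subcategory $\mathcal T$ of $D(A)$ is thick if it is closed under direct summands and, for any exact triangle $X\to Y\to Z\to\Sigma X$ in $D(A)$, if two of $X,Y,Z$ are in $\mathcal T$ then so is the third. *)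

theory Defs
  imports "HOL-Algebra.Module" "HOL-Algebra.Ring_Divisibility"
begin

section \<open>Modules\<close>

text \<open>
  Homomorphisms are extensional, so that two of them are equal as soon as they agree on the
  carrier of the source.
\<close>

definition module_hom ::
    "('a, 'r) ring_scheme \<Rightarrow> ('a, 'b) module \<Rightarrow> ('a, 'c) module \<Rightarrow> ('b \<Rightarrow> 'c) set" where
  "module_hom R M N = {f \<in> carrier M \<rightarrow>\<^sub>E carrier N.
     (\<forall>x\<in>carrier M. \<forall>y\<in>carrier M. f (x \<oplus>\<^bsub>M\<^esub> y) = f x \<oplus>\<^bsub>N\<^esub> f y) \<and>
     (\<forall>r\<in>carrier R. \<forall>x\<in>carrier M. f (r \<odot>\<^bsub>M\<^esub> x) = r \<odot>\<^bsub>N\<^esub> f x)}"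

text \<open>
  A module record inherits the ring fields \<^const>\<open>monoid.mult\<close> and \<^const>\<open>monoid.one\<close>, which
  play no role for modules and are left undefined below.
\<close>

definition ring_as_module :: "('a, 'r) ring_scheme \<Rightarrow> ('a, 'a) module" where
  "ring_as_module R = \<lparr>carrier = carrier R, monoid.mult = undefined, monoid.one = undefined,
     ring.zero = \<zero>\<^bsub>R\<^esub>, ring.add = ring.add R, module.smult = monoid.mult R\<rparr>"

definition quotient_module :: "('a, 'b) module \<Rightarrow> 'b set \<Rightarrow> ('a, 'b set) module" where
  "quotient_module M N = \<lparr>carrier = a_rcosets\<^bsub>M\<^esub> N,
     monoid.mult = undefined, monoid.one = undefined, ring.zero = N, ring.add = set_add M,
     module.smult = (\<lambda>r X. \<Union>x\<in>X. N +>\<^bsub>M\<^esub> (r \<odot>\<^bsub>M\<^esub> x))\<rparr>"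

definition hom_module ::
    "('a, 'r) ring_scheme \<Rightarrow> ('a, 'b) module \<Rightarrow> ('a, 'c) module \<Rightarrow> ('a, 'b \<Rightarrow> 'c) module" where
  "hom_module R M N = \<lparr>carrier = module_hom R M N,
     monoid.mult = undefined, monoid.one = undefined,
     ring.zero = (\<lambda>x\<in>carrier M. \<zero>\<^bsub>N\<^esub>),
     ring.add = (\<lambda>f g. \<lambda>x\<in>carrier M. f x \<oplus>\<^bsub>N\<^esub> g x),
     module.smult = (\<lambda>r f. \<lambda>x\<in>carrier M. r \<odot>\<^bsub>N\<^esub> f x)\<rparr>"

definition finitely_generated :: "('a, 'r) ring_scheme \<Rightarrow> ('a, 'b) module \<Rightarrow> bool" where
  "finitely_generated R M \<longleftrightarrow> (\<exists>S\<subseteq>carrier M. finite S \<and>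
     (\<forall>x\<in>carrier M. \<exists>c\<in>S \<rightarrow> carrier R. x = (\<Oplus>\<^bsub>M\<^esub>s\<in>S. c s \<odot>\<^bsub>M\<^esub> s)))"

definition free_module :: "('a, 'r) ring_scheme \<Rightarrow> ('a, 'b) module \<Rightarrow> bool" where
  "free_module R M \<longleftrightarrow> module R M \<and> (\<exists>B\<subseteq>carrier M. \<forall>x\<in>carrier M.
     \<exists>!c. c \<in> B \<rightarrow>\<^sub>E carrier R \<and> finite {b \<in> B. c b \<noteq> \<zero>\<^bsub>R\<^esub>} \<and>
       x = (\<Oplus>\<^bsub>M\<^esub>b\<in>{b \<in> B. c b \<noteq> \<zero>\<^bsub>R\<^esub>}. c b \<odot>\<^bsub>M\<^esub> b))"


section \<open>Support\<close>

definition fraction_rel ::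
    "('a, 'b) module \<Rightarrow> 'a set \<Rightarrow> (('b \<times> 'a) \<times> ('b \<times> 'a)) set" where
  "fraction_rel M S = {((m, s), (n, t)) | m s n t.
     m \<in> carrier M \<and> s \<in> S \<and> n \<in> carrier M \<and> t \<in> S \<and>
     (\<exists>u\<in>S. u \<odot>\<^bsub>M\<^esub> (t \<odot>\<^bsub>M\<^esub> m \<ominus>\<^bsub>M\<^esub> s \<odot>\<^bsub>M\<^esub> n) = \<zero>\<^bsub>M\<^esub>)}"

text \<open>
  The localization of \<open>M\<close> at a multiplicative set \<open>S\<close>, as a module over the base ring.
\<close>

definition localized_module ::
    "('a, 'r) ring_scheme \<Rightarrow> ('a, 'b) module \<Rightarrow> 'a set \<Rightarrow> ('a, ('b \<times> 'a) set) module" where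
  "localized_module R M S = \<lparr>carrier = (carrier M \<times> S) // fraction_rel M S,
     monoid.mult = undefined, monoid.one = undefined,
     ring.zero = fraction_rel M S `` {(\<zero>\<^bsub>M\<^esub>, \<one>\<^bsub>R\<^esub>)},
     ring.add = (\<lambda>X Y. \<Union>(m, s)\<in>X. \<Union>(n, t)\<in>Y.
       fraction_rel M S `` {(t \<odot>\<^bsub>M\<^esub> m \<oplus>\<^bsub>M\<^esub> s \<odot>\<^bsub>M\<^esub> n, s \<otimes>\<^bsub>R\<^esub> t)}),
     module.smult = (\<lambda>r X. \<Union>(m, s)\<in>X. fraction_rel M S `` {(r \<odot>\<^bsub>M\<^esub> m, s)})\<rparr>"

definition Supp :: "('a, 'r) ring_scheme \<Rightarrow> ('a, 'b) module \<Rightarrow> 'a set set" where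
  "Supp R M = {\<pp>. primeideal \<pp> R \<and>
     carrier (localized_module R M (carrier R - \<pp>)) \<noteq>
       {\<zero>\<^bsub>localized_module R M (carrier R - \<pp>)\<^esub>}}"

definition V :: "('a, 'r) ring_scheme \<Rightarrow> 'a set \<Rightarrow> 'a set set" where
  "V R \<aa> = {\<pp>. primeideal \<pp> R \<and> \<aa> \<subseteq> \<pp>}"


section \<open>Complexes\<close>

record ('a, 'b) cochain =
  obj :: "int \<Rightarrow> ('a, 'b) module"
  diff :: "int \<Rightarrow> 'b \<Rightarrow> 'b"

definition complexes :: "('a, 'r) ring_scheme \<Rightarrow> ('a, 'b) cochain set" where
  "complexes R = {X. \<forall>n. module R (obj X n) \<and>
     diff X n \<in> module_hom R (obj X n) (obj X (n + 1)) \<and>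
     (\<forall>x\<in>carrier (obj X n). diff X (n + 1) (diff X n x) = \<zero>\<^bsub>obj X (n + 1 + 1)\<^esub>)}"

definition cocycles :: "('a, 'b) cochain \<Rightarrow> int \<Rightarrow> 'b set" where
  "cocycles X n = a_kernel (obj X n) (obj X (n + 1)) (diff X n)"

definition coboundaries :: "('a, 'b) cochain \<Rightarrow> int \<Rightarrow> 'b set" where
  "coboundaries X n = diff X (n - 1) ` carrier (obj X (n - 1))"

definition cohomology :: "('a, 'b) cochain \<Rightarrow> int \<Rightarrow> ('a, 'b set) module" where
  "cohomology X n = quotient_module ((obj X n)\<lparr>carrier := cocycles X n\<rparr>) (coboundaries X n)"

definition chain_maps ::
    "('a, 'r) ring_scheme \<Rightarrow> ('a, 'b) cochain \<Rightarrow> ('a, 'b) cochain \<Rightarrow> (int \<Rightarrow> 'b \<Rightarrow> 'b) set" where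
  "chain_maps R X Y = {f. \<forall>n. f n \<in> module_hom R (obj X n) (obj Y n) \<and>
     (\<forall>x\<in>carrier (obj X n). f (n + 1) (diff X n x) = diff Y n (f n x))}"

definition chain_id :: "('a, 'b) cochain \<Rightarrow> int \<Rightarrow> 'b \<Rightarrow> 'b" where
  "chain_id X n = (\<lambda>x\<in>carrier (obj X n). x)"

definition chain_comp ::
    "('a, 'b) cochain \<Rightarrow> (int \<Rightarrow> 'b \<Rightarrow> 'b) \<Rightarrow> (int \<Rightarrow> 'b \<Rightarrow> 'b) \<Rightarrow> int \<Rightarrow> 'b \<Rightarrow> 'b" where
  "chain_comp X g f n = compose (carrier (obj X n)) (g n) (f n)"

definition cohomology_map ::
    "('a, 'b) cochain \<Rightarrow> ('a, 'b) cochain \<Rightarrow> (int \<Rightarrow> 'b \<Rightarrow> 'b) \<Rightarrow> int \<Rightarrow> 'b set \<Rightarrow> 'b set" where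
  "cohomology_map X Y f n = (\<lambda>\<xi>\<in>carrier (cohomology X n).
     \<Union>x\<in>\<xi>. coboundaries Y n +>\<^bsub>obj Y n\<^esub> f n x)"

definition quasi_isos ::
    "('a, 'r) ring_scheme \<Rightarrow> ('a, 'b) cochain \<Rightarrow> ('a, 'b) cochain \<Rightarrow> (int \<Rightarrow> 'b \<Rightarrow> 'b) set" where
  "quasi_isos R X Y = {f \<in> chain_maps R X Y. \<forall>n.
     bij_betw (cohomology_map X Y f n) (carrier (cohomology X n)) (carrier (cohomology Y n))}"

definition shift :: "('a, 'b) cochain \<Rightarrow> ('a, 'b) cochain" where
  "shift X = \<lparr>obj = (\<lambda>n. obj X (n + 1)),
     diff = (\<lambda>n. \<lambda>x\<in>carrier (obj X (n + 1)). \<ominus>\<^bsub>obj X (n + 1 + 1)\<^esub> diff X (n + 1) x)\<rparr>"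


section \<open>A type of module elements\<close>

text \<open>
  The modules and complexes that make up \<open>Mod A\<close> and \<open>D(A)\<close> need their elements in one fixed type.
  The type below is infinite, contains \<open>'a\<close> and is closed under pairs, so the modules living on it
  are closed, up to isomorphism, under submodules, quotients, countable direct sums and free covers.
  The type variable \<open>'i\<close> is arbitrary: every module over the ring with elements in \<open>'i\<close> is
  isomorphic to one on \<open>('a, 'i) univ\<close>.
\<close>

datatype ('a, 'i) univ =
    Scalar 'a
  | Atom 'i
  | UPair (ufst: "('a, 'i) univ") (usnd: "('a, 'i) univ")

definition sum_module ::
    "('a, ('a, 'i) univ) module \<Rightarrow> ('a, ('a, 'i) univ) module \<Rightarrow> ('a, ('a, 'i) univ) module" where
  "sum_module M N = \<lparr>carrier = {UPair x y | x y. x \<in> carrier M \<and> y \<in> carrier N},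
     monoid.mult = undefined, monoid.one = undefined,
     ring.zero = UPair \<zero>\<^bsub>M\<^esub> \<zero>\<^bsub>N\<^esub>,
     ring.add = (\<lambda>p q. UPair (ufst p \<oplus>\<^bsub>M\<^esub> ufst q) (usnd p \<oplus>\<^bsub>N\<^esub> usnd q)),
     module.smult = (\<lambda>r p. UPair (r \<odot>\<^bsub>M\<^esub> ufst p) (r \<odot>\<^bsub>N\<^esub> usnd p))\<rparr>"

definition sum_complex ::
    "('a, ('a, 'i) univ) cochain \<Rightarrow> ('a, ('a, 'i) univ) cochain \<Rightarrow> ('a, ('a, 'i) univ) cochain" where
  "sum_complex X Y = \<lparr>obj = (\<lambda>n. sum_module (obj X n) (obj Y n)),
     diff = (\<lambda>n. \<lambda>p\<in>carrier (sum_module (obj X n) (obj Y n)).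
       UPair (diff X n (ufst p)) (diff Y n (usnd p)))\<rparr>"

definition cone ::
    "('a, ('a, 'i) univ) cochain \<Rightarrow> ('a, ('a, 'i) univ) cochain \<Rightarrow>
     (int \<Rightarrow> ('a, 'i) univ \<Rightarrow> ('a, 'i) univ) \<Rightarrow> ('a, ('a, 'i) univ) cochain" where
  "cone X Y f = \<lparr>obj = (\<lambda>n. sum_module (obj X (n + 1)) (obj Y n)),
     diff = (\<lambda>n. \<lambda>p\<in>carrier (sum_module (obj X (n + 1)) (obj Y n)).
       UPair (\<ominus>\<^bsub>obj X (n + 1 + 1)\<^esub> diff X (n + 1) (ufst p))
             (f (n + 1) (ufst p) \<oplus>\<^bsub>obj Y (n + 1)\<^esub> diff Y n (usnd p)))\<rparr>"

definition cone_incl ::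
    "('a, ('a, 'i) univ) cochain \<Rightarrow> ('a, ('a, 'i) univ) cochain \<Rightarrow>
     int \<Rightarrow> ('a, 'i) univ \<Rightarrow> ('a, 'i) univ" where
  "cone_incl X Y n = (\<lambda>y\<in>carrier (obj Y n). UPair \<zero>\<^bsub>obj X (n + 1)\<^esub> y)"

definition cone_proj ::
    "('a, ('a, 'i) univ) cochain \<Rightarrow> ('a, ('a, 'i) univ) cochain \<Rightarrow>
     int \<Rightarrow> ('a, 'i) univ \<Rightarrow> ('a, 'i) univ" where
  "cone_proj X Y n = (\<lambda>p\<in>carrier (sum_module (obj X (n + 1)) (obj Y n)). ufst p)"


section \<open>Ext and cofinite modules\<close>

text \<open>
  A resolution is a cochain complex in non-positive degrees, with augmentation \<open>\<epsilon>\<close>.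
\<close>

definition free_resolution ::
    "('a, 'r) ring_scheme \<Rightarrow> ('a, 'n) module \<Rightarrow> ('a, 'b) cochain \<Rightarrow> ('b \<Rightarrow> 'n) \<Rightarrow> bool" where
  "free_resolution R N F \<epsilon> \<longleftrightarrow> F \<in> complexes R \<and>
     (\<forall>n>0. carrier (obj F n) = {\<zero>\<^bsub>obj F n\<^esub>}) \<and>
     (\<forall>n\<le>0. free_module R (obj F n)) \<and>
     (\<forall>n<0. cocycles F n = coboundaries F n) \<and>
     \<epsilon> \<in> module_hom R (obj F 0) N \<and> \<epsilon> ` carrier (obj F 0) = carrier N \<and>
     a_kernel (obj F 0) N \<epsilon> = coboundaries F 0"

definition Hom_complex ::
    "('a, 'r) ring_scheme \<Rightarrow> ('a, 'b) cochain \<Rightarrow> ('a, 'c) module \<Rightarrow> ('a, 'b \<Rightarrow> 'c) cochain" where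
  "Hom_complex R F M = \<lparr>obj = (\<lambda>n. hom_module R (obj F (- n)) M),
     diff = (\<lambda>n. \<lambda>\<phi>\<in>module_hom R (obj F (- n)) M.
       compose (carrier (obj F (- (n + 1)))) \<phi> (diff F (- (n + 1))))\<rparr>"

text \<open>
  \<open>Ext\<^sup>i(N, M)\<close> is the cohomology of \<open>Hom(F, M)\<close> for a chosen free resolution \<open>F\<close> of \<open>N\<close>. The
  type \<open>('a, 'n) univ\<close> is large enough to hold a free resolution of every module over the ring
  with elements in \<open>'n\<close>.
\<close>

definition resolution :: "('a, 'r) ring_scheme \<Rightarrow> ('a, 'n) module \<Rightarrow> ('a, ('a, 'n) univ) cochain" where
  "resolution R N = (SOME F. \<exists>\<epsilon>. free_resolution R N F \<epsilon>)"

definition Ext ::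
    "('a, 'r) ring_scheme \<Rightarrow> nat \<Rightarrow> ('a, 'n) module \<Rightarrow> ('a, 'b) module \<Rightarrow>
     ('a, (('a, 'n) univ \<Rightarrow> 'b) set) module" where
  "Ext R i N M = cohomology (Hom_complex R (resolution R N) M) (int i)"

definition M_cof :: "('a, 'r) ring_scheme \<Rightarrow> 'a set \<Rightarrow> ('a, 'b) module set" where
  "M_cof R \<aa> = {M. module R M \<and> Supp R M \<subseteq> V R \<aa> \<and>
     (\<forall>i. finitely_generated R (Ext R i (quotient_module (ring_as_module R) \<aa>) M))}"

definition is_kernel ::
    "('a, 'r) ring_scheme \<Rightarrow> ('a, 'b) module \<Rightarrow> ('a, 'b) module \<Rightarrow> ('b \<Rightarrow> 'b) \<Rightarrow>
     ('a, 'b) module \<Rightarrow> ('b \<Rightarrow> 'b) \<Rightarrow> bool" where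
  "is_kernel R M N f K k \<longleftrightarrow> module R K \<and> k \<in> module_hom R K M \<and>
     inj_on k (carrier K) \<and> k ` carrier K = a_kernel M N f"

definition is_cokernel ::
    "('a, 'r) ring_scheme \<Rightarrow> ('a, 'b) module \<Rightarrow> ('a, 'b) module \<Rightarrow> ('b \<Rightarrow> 'b) \<Rightarrow>
     ('a, 'b) module \<Rightarrow> ('b \<Rightarrow> 'b) \<Rightarrow> bool" where
  "is_cokernel R M N f C c \<longleftrightarrow> module R C \<and> c \<in> module_hom R N C \<and>
     c ` carrier N = carrier C \<and> a_kernel N C c = f ` carrier M"

definition abelian_subcategory :: "('a, 'r) ring_scheme \<Rightarrow> ('a, 'b) module set \<Rightarrow> bool" where
  "abelian_subcategory R \<M> \<longleftrightarrow> \<M> \<subseteq> {M. module R M} \<and>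
     (\<forall>M\<in>\<M>. \<forall>N\<in>\<M>. \<forall>f\<in>module_hom R M N.
       (\<forall>K k. is_kernel R M N f K k \<longrightarrow> K \<in> \<M>) \<and>
       (\<forall>C c. is_cokernel R M N f C c \<longrightarrow> C \<in> \<M>))"


section \<open>The derived category\<close>

text \<open>
  \<open>D(A)\<close> is the localization of the category of complexes at the quasi-isomorphisms, in the form
  given by Gabriel and Zisman: a morphism is a zigzag of chain maps and formal inverses of
  quasi-isomorphisms, modulo the congruence generated by the relations of a localization. The
  letter \<open>Bwd X Y s\<close> stands for the inverse of \<open>s : X \<rightarrow> Y\<close>, so it leads from \<open>Y\<close> to \<open>X\<close>. Zigzags
  are written in the order in which they are traversed.
\<close>

datatype ('a, 'b) letter =
    Fwd "('a, 'b) cochain" "('a, 'b) cochain" "int \<Rightarrow> 'b \<Rightarrow> 'b"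
  | Bwd "('a, 'b) cochain" "('a, 'b) cochain" "int \<Rightarrow> 'b \<Rightarrow> 'b"

inductive zigzag ::
    "('a, 'r) ring_scheme \<Rightarrow> ('a, 'b) cochain \<Rightarrow> ('a, 'b) cochain \<Rightarrow> ('a, 'b) letter list \<Rightarrow> bool"
  for R where
    empty: "X \<in> complexes R \<Longrightarrow> zigzag R X X []"
  | fwd: "X \<in> complexes R \<Longrightarrow> f \<in> chain_maps R X Y \<Longrightarrow> zigzag R Y Z w \<Longrightarrow>
      zigzag R X Z (Fwd X Y f # w)"
  | bwd: "Y \<in> complexes R \<Longrightarrow> s \<in> quasi_isos R X Y \<Longrightarrow> zigzag R X Z w \<Longrightarrow>
      zigzag R Y Z (Bwd X Y s # w)"

inductive zigzag_eq ::
    "('a, 'r) ring_scheme \<Rightarrow> ('a, 'b) cochain \<Rightarrow> ('a, 'b) cochain \<Rightarrow>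
     ('a, 'b) letter list \<Rightarrow> ('a, 'b) letter list \<Rightarrow> bool"
  for R where
    refl: "zigzag R X Y w \<Longrightarrow> zigzag_eq R X Y w w"
  | sym: "zigzag_eq R X Y v w \<Longrightarrow> zigzag_eq R X Y w v"
  | trans: "zigzag_eq R X Y u v \<Longrightarrow> zigzag_eq R X Y v w \<Longrightarrow> zigzag_eq R X Y u w"
  | whisker: "zigzag R W X u \<Longrightarrow> zigzag_eq R X Y v v' \<Longrightarrow> zigzag R Y Z w \<Longrightarrow>
      zigzag_eq R W Z (u @ v @ w) (u @ v' @ w)"
  | ident: "X \<in> complexes R \<Longrightarrow> zigzag_eq R X X [Fwd X X (chain_id X)] []"
  | comp: "X \<in> complexes R \<Longrightarrow> Y \<in> complexes R \<Longrightarrow> Z \<in> complexes R \<Longrightarrow>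
      f \<in> chain_maps R X Y \<Longrightarrow> g \<in> chain_maps R Y Z \<Longrightarrow>
      zigzag_eq R X Z [Fwd X Y f, Fwd Y Z g] [Fwd X Z (chain_comp X g f)]"
  | inv_right: "X \<in> complexes R \<Longrightarrow> Y \<in> complexes R \<Longrightarrow> s \<in> quasi_isos R X Y \<Longrightarrow>
      zigzag_eq R X X [Fwd X Y s, Bwd X Y s] []"
  | inv_left: "X \<in> complexes R \<Longrightarrow> Y \<in> complexes R \<Longrightarrow> s \<in> quasi_isos R X Y \<Longrightarrow>
      zigzag_eq R Y Y [Bwd X Y s, Fwd X Y s] []"

definition zigzag_class ::
    "('a, 'r) ring_scheme \<Rightarrow> ('a, 'b) cochain \<Rightarrow> ('a, 'b) cochain \<Rightarrow>
     ('a, 'b) letter list \<Rightarrow> ('a, 'b) letter list set" where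
  "zigzag_class R X Y w = {v. zigzag_eq R X Y w v}"

definition D_hom ::
    "('a, 'r) ring_scheme \<Rightarrow> ('a, 'b) cochain \<Rightarrow> ('a, 'b) cochain \<Rightarrow>
     ('a, 'b) letter list set set" where
  "D_hom R X Y = {zigzag_class R X Y w | w. zigzag R X Y w}"

definition D_id :: "('a, 'r) ring_scheme \<Rightarrow> ('a, 'b) cochain \<Rightarrow> ('a, 'b) letter list set" where
  "D_id R X = zigzag_class R X X []"

text \<open>
  The complexes \<open>X\<close> and \<open>Z\<close> in \<open>D_comp R X Z \<beta> \<alpha>\<close> are the source of \<open>\<alpha>\<close> and the target of \<open>\<beta>\<close>.
\<close>

definition D_comp ::
    "('a, 'r) ring_scheme \<Rightarrow> ('a, 'b) cochain \<Rightarrow> ('a, 'b) cochain \<Rightarrow>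
     ('a, 'b) letter list set \<Rightarrow> ('a, 'b) letter list set \<Rightarrow> ('a, 'b) letter list set" where
  "D_comp R X Z \<beta> \<alpha> = (\<Union>u\<in>\<alpha>. \<Union>v\<in>\<beta>. zigzag_class R X Z (u @ v))"

definition D_of ::
    "('a, 'r) ring_scheme \<Rightarrow> ('a, 'b) cochain \<Rightarrow> ('a, 'b) cochain \<Rightarrow>
     (int \<Rightarrow> 'b \<Rightarrow> 'b) \<Rightarrow> ('a, 'b) letter list set" where
  "D_of R X Y f = zigzag_class R X Y [Fwd X Y f]"

fun shift_letter :: "('a, 'b) letter \<Rightarrow> ('a, 'b) letter" where
  "shift_letter (Fwd X Y f) = Fwd (shift X) (shift Y) (\<lambda>n. f (n + 1))"
| "shift_letter (Bwd X Y s) = Bwd (shift X) (shift Y) (\<lambda>n. s (n + 1))"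

definition D_shift ::
    "('a, 'r) ring_scheme \<Rightarrow> ('a, 'b) cochain \<Rightarrow> ('a, 'b) cochain \<Rightarrow>
     ('a, 'b) letter list set \<Rightarrow> ('a, 'b) letter list set" where
  "D_shift R X Y \<alpha> = (\<Union>w\<in>\<alpha>. zigzag_class R (shift X) (shift Y) (map shift_letter w))"

definition D_isos ::
    "('a, 'r) ring_scheme \<Rightarrow> ('a, 'b) cochain \<Rightarrow> ('a, 'b) cochain \<Rightarrow>
     ('a, 'b) letter list set set" where
  "D_isos R X Y = {\<alpha> \<in> D_hom R X Y. \<exists>\<beta>\<in>D_hom R Y X.
     D_comp R X X \<beta> \<alpha> = D_id R X \<and> D_comp R Y Y \<alpha> \<beta> = D_id R Y}"

definition exact_triangle ::
    "('a, 'r) ring_scheme \<Rightarrow> ('a, ('a, 'i) univ) cochain \<Rightarrow> ('a, ('a, 'i) univ) cochain \<Rightarrow>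
     ('a, ('a, 'i) univ) cochain \<Rightarrow> ('a, ('a, 'i) univ) letter list set \<Rightarrow>
     ('a, ('a, 'i) univ) letter list set \<Rightarrow> ('a, ('a, 'i) univ) letter list set \<Rightarrow> bool" where
  "exact_triangle R X Y Z u v w \<longleftrightarrow>
     u \<in> D_hom R X Y \<and> v \<in> D_hom R Y Z \<and> w \<in> D_hom R Z (shift X) \<and>
     (\<exists>X'\<in>complexes R. \<exists>Y'\<in>complexes R. \<exists>f\<in>chain_maps R X' Y'.
       \<exists>\<alpha>\<in>D_isos R X X'. \<exists>\<beta>\<in>D_isos R Y Y'. \<exists>\<gamma>\<in>D_isos R Z (cone X' Y' f).
         D_comp R X Y' \<beta> u = D_comp R X Y' (D_of R X' Y' f) \<alpha> \<and>
         D_comp R Y (cone X' Y' f) \<gamma> v =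
           D_comp R Y (cone X' Y' f) (D_of R Y' (cone X' Y' f) (cone_incl X' Y')) \<beta> \<and>
         D_comp R Z (shift X') (D_shift R X X' \<alpha>) w =
           D_comp R Z (shift X') (D_of R (cone X' Y' f) (shift X') (cone_proj X' Y')) \<gamma>)"

definition direct_summand ::
    "('a, 'r) ring_scheme \<Rightarrow> ('a, ('a, 'i) univ) cochain \<Rightarrow> ('a, ('a, 'i) univ) cochain \<Rightarrow> bool"
  where
  "direct_summand R X Y \<longleftrightarrow> X \<in> complexes R \<and>
     (\<exists>X'\<in>complexes R. D_isos R Y (sum_complex X X') \<noteq> {})"

definition thick_subcategory ::
    "('a, 'r) ring_scheme \<Rightarrow> ('a, ('a, 'i) univ) cochain set \<Rightarrow> bool" where
  "thick_subcategory R \<T> \<longleftrightarrow> \<T> \<subseteq> complexes R \<and>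
     (\<forall>Y\<in>\<T>. \<forall>X. direct_summand R X Y \<longrightarrow> X \<in> \<T>) \<and>
     (\<forall>X Y Z u v w. exact_triangle R X Y Z u v w \<longrightarrow>
       (X \<in> \<T> \<and> Y \<in> \<T> \<longrightarrow> Z \<in> \<T>) \<and>
       (Y \<in> \<T> \<and> Z \<in> \<T> \<longrightarrow> X \<in> \<T>) \<and>
       (X \<in> \<T> \<and> Z \<in> \<T> \<longrightarrow> Y \<in> \<T>))"

definition D_cof :: "('a, 'r) ring_scheme \<Rightarrow> 'a set \<Rightarrow> ('a, 'b) cochain set" where
  "D_cof R \<aa> = {X \<in> complexes R. \<forall>i. cohomology X i \<in> M_cof R \<aa>}"

end

theory Submission
  imports Defs
begin

text \<open>
  Cofinite modules are closed under extensions, since the middle term of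
  \<open>Ext(L) \<rightarrow> Ext(M) \<rightarrow> Ext(N)\<close> is finitely generated as soon as the outer ones are (the base
  ring is noetherian). In an exact sequence \<open>P \<rightarrow> Q \<rightarrow> M \<rightarrow> S \<rightarrow> T\<close> the module \<open>M\<close> is an extension of
  a kernel by a cokernel; hence, if kernels and cokernels of maps of cofinite modules are cofinite,
  so is \<open>M\<close>, and the long exact cohomology sequence of a cone gives thickness. Conversely, the cone
  of a map of modules placed in degree zero has the kernel and the cokernel as its cohomology.
\<close>

section \<open>Linear maps and submodules\<close>

text \<open>Membership in \<open>D_cof\<close> depends on cohomology alone, so the localization
  enters thickness through one fact: cohomology is well defined on classes of zigzags and turns
  isomorphisms of D(A) into isomorphisms of modules. A triangle can then be replaced by the cone
  that presents it, and a summand by an actual direct sum. Summands are cokernels too: H(X) is the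
  cokernel of the idempotent of H(X + X') that kills the first component.

  The obstacle is one of types. The abelian hypothesis speaks of modules with elements in
  \<open>univ\<close>, while cohomology modules consist of cosets, and a free resolution must be
  built inside a prescribed type. Choosing representatives injects cohomology back into
  \<open>univ\<close>, and coding finite families of scalars by nested pairs places finitely
  generated free modules there; structure is then transported along injections. Over a noetherian
  ring all syzygies of A/a are finitely generated, so this coding carries the whole resolution. One
  chosen resolution serves all coefficient modules, and exactness of Ext in the middle reduces to
  lifting maps out of free modules along a surjection.\<close>

definition linear_map ::
    "('a, 'r) ring_scheme \<Rightarrow> ('a, 'b) module \<Rightarrow> ('a, 'c) module \<Rightarrow> ('b \<Rightarrow> 'c) \<Rightarrow> bool" where
  "linear_map R M N f \<longleftrightarrow> f \<in> carrier M \<rightarrow> carrier N \<and>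
     (\<forall>x\<in>carrier M. \<forall>y\<in>carrier M. f (x \<oplus>\<^bsub>M\<^esub> y) = f x \<oplus>\<^bsub>N\<^esub> f y) \<and>
     (\<forall>r\<in>carrier R. \<forall>x\<in>carrier M. f (r \<odot>\<^bsub>M\<^esub> x) = r \<odot>\<^bsub>N\<^esub> f x)"

lemma linear_mapI:
  assumes "\<And>x. x \<in> carrier M \<Longrightarrow> f x \<in> carrier N"
    and "\<And>x y. x \<in> carrier M \<Longrightarrow> y \<in> carrier M \<Longrightarrow> f (x \<oplus>\<^bsub>M\<^esub> y) = f x \<oplus>\<^bsub>N\<^esub> f y"
    and "\<And>r x. r \<in> carrier R \<Longrightarrow> x \<in> carrier M \<Longrightarrow> f (r \<odot>\<^bsub>M\<^esub> x) = r \<odot>\<^bsub>N\<^esub> f x"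
  shows "linear_map R M N f"
  using assms by (auto simp: linear_map_def)

lemma linear_map_closed: "linear_map R M N f \<Longrightarrow> x \<in> carrier M \<Longrightarrow> f x \<in> carrier N"
  and linear_map_add: "linear_map R M N f \<Longrightarrow> x \<in> carrier M \<Longrightarrow> y \<in> carrier M \<Longrightarrow>
    f (x \<oplus>\<^bsub>M\<^esub> y) = f x \<oplus>\<^bsub>N\<^esub> f y"
  and linear_map_smult: "linear_map R M N f \<Longrightarrow> r \<in> carrier R \<Longrightarrow> x \<in> carrier M \<Longrightarrow>
    f (r \<odot>\<^bsub>M\<^esub> x) = r \<odot>\<^bsub>N\<^esub> f x"
  by (auto simp: linear_map_def)

lemma linear_map_zero:
  assumes "module R M" "module R N" "linear_map R M N f"
  shows "f \<zero>\<^bsub>M\<^esub> = \<zero>\<^bsub>N\<^esub>"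
proof -
  interpret M: module R M by fact
  interpret N: module R N by fact
  have "f \<zero>\<^bsub>M\<^esub> = f (\<zero>\<^bsub>R\<^esub> \<odot>\<^bsub>M\<^esub> \<zero>\<^bsub>M\<^esub>)" by simp
  also have "\<dots> = \<zero>\<^bsub>R\<^esub> \<odot>\<^bsub>N\<^esub> f \<zero>\<^bsub>M\<^esub>"
    using linear_map_smult[OF assms(3)] by (metis M.R.zero_closed M.M.zero_closed)
  also have "\<dots> = \<zero>\<^bsub>N\<^esub>" using linear_map_closed[OF assms(3)] by simp
  finally show ?thesis .
qed

lemma (in abelian_group) minus_zero_right [simp]: "x \<in> carrier G \<Longrightarrow> x \<ominus> \<zero> = x"
  by (simp add: a_minus_def)

lemma (in abelian_group) minus_eq_zero_iff [simp]:
  "x \<in> carrier G \<Longrightarrow> y \<in> carrier G \<Longrightarrow> x \<ominus> y = \<zero> \<longleftrightarrow> x = y"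
  by (metis a_minus_def add.inv_closed add.inv_equality local.minus_minus r_neg)

text \<open>Since negation is multiplication by a scalar, compatibility with negation follows from
  compatibility with scalars, for maps, submodules and sums alike.\<close>

lemma (in module) neg_eq_smult: "x \<in> carrier M \<Longrightarrow> \<ominus>\<^bsub>M\<^esub> x = (\<ominus> \<one>) \<odot>\<^bsub>M\<^esub> x"
  by (simp add: smult_l_minus)

lemma linear_map_neg:
  assumes "module R M" "module R N" "linear_map R M N f" "x \<in> carrier M"
  shows "f (\<ominus>\<^bsub>M\<^esub> x) = \<ominus>\<^bsub>N\<^esub> f x"
proof -
  interpret M: module R M by fact
  interpret N: module R N by fact
  show ?thesis using assms(3,4)
    by (simp add: M.neg_eq_smult N.neg_eq_smult linear_map_closed linear_map_smult)
qed

lemma linear_map_diff: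
  assumes "module R M" "module R N" "linear_map R M N f" "x \<in> carrier M" "y \<in> carrier M"
  shows "f (x \<ominus>\<^bsub>M\<^esub> y) = f x \<ominus>\<^bsub>N\<^esub> f y"
proof -
  interpret M: module R M by fact
  interpret N: module R N by fact
  show ?thesis using assms
    by (simp add: a_minus_def linear_map_add linear_map_neg)
qed

lemmas linear_map_simps = linear_map_closed linear_map_add linear_map_smult

lemma linear_map_comp:
  "linear_map R M N f \<Longrightarrow> linear_map R N P g \<Longrightarrow> linear_map R M P (\<lambda>x. g (f x))"
  unfolding linear_map_def by (auto simp: Pi_iff)

lemma linear_map_cong:
  assumes "linear_map R M N f" "module R M" "\<And>x. x \<in> carrier M \<Longrightarrow> f x = g x"
  shows "linear_map R M N g"
proof -
  interpret M: module R M by fact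
  show ?thesis using assms(1,3) unfolding linear_map_def by (auto simp: Pi_iff)
qed

lemma module_hom_iff:
  "f \<in> module_hom R M N \<longleftrightarrow> linear_map R M N f \<and> f \<in> extensional (carrier M)"
  unfolding module_hom_def linear_map_def by (auto simp: PiE_def)

lemma module_hom_linear: "f \<in> module_hom R M N \<Longrightarrow> linear_map R M N f"
  by (simp add: module_hom_iff)

text \<open>\<open>linear_map\<close> drops extensionality so that composites and changes of target
  need no \<open>restrict\<close>; here it is put back for statements that demand a
  \<open>module_hom\<close>.\<close>

lemma restrict_in_module_hom:
  assumes "module R M" "linear_map R M N f"
  shows "restrict f (carrier M) \<in> module_hom R M N"
  using linear_map_cong[OF assms(2,1), of "restrict f (carrier M)"]
  by (simp add: module_hom_iff)

lemma a_kernel_iff: "x \<in> a_kernel M N f \<longleftrightarrow> x \<in> carrier M \<and> f x = \<zero>\<^bsub>N\<^esub>"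
  by (simp add: a_kernel_def kernel_def)

lemma (in module) submodule_iff:
  "submodule H R M \<longleftrightarrow> H \<subseteq> carrier M \<and> \<zero>\<^bsub>M\<^esub> \<in> H \<and> (\<forall>x\<in>H. \<forall>y\<in>H. x \<oplus>\<^bsub>M\<^esub> y \<in> H) \<and>
     (\<forall>r\<in>carrier R. \<forall>x\<in>H. r \<odot>\<^bsub>M\<^esub> x \<in> H)" (is "?L \<longleftrightarrow> ?R")
proof
  assume L: ?L
  interpret submodule H R M by fact
  show ?R using submoduleE[OF L] one_closed by auto
next
  assume ?R
  then show ?L
    by (intro submoduleI) (auto simp: neg_eq_smult subset_iff)
qed

lemma submoduleD:
  assumes "module R M" "submodule H R M"
  shows "x \<in> H \<Longrightarrow> x \<in> carrier M" "\<zero>\<^bsub>M\<^esub> \<in> H" "x \<in> H \<Longrightarrow> y \<in> H \<Longrightarrow> x \<oplus>\<^bsub>M\<^esub> y \<in> H"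
    "r \<in> carrier R \<Longrightarrow> x \<in> H \<Longrightarrow> r \<odot>\<^bsub>M\<^esub> x \<in> H" "x \<in> H \<Longrightarrow> \<ominus>\<^bsub>M\<^esub> x \<in> H"
    "x \<in> H \<Longrightarrow> y \<in> H \<Longrightarrow> x \<ominus>\<^bsub>M\<^esub> y \<in> H"
  using module.submodule_iff[OF assms(1)] module.submoduleE[OF assms] assms(2)
  by (auto simp: a_minus_def)

lemma submodule_vimage:
  assumes "module R M" "module R N" "linear_map R M N f" "submodule H R N"
  shows "submodule {x \<in> carrier M. f x \<in> H} R M"
proof -
  interpret M: module R M by fact
  interpret N: module R N by fact
  show ?thesis using submoduleD[OF assms(2,4)]
    by (auto simp: M.submodule_iff linear_map_simps[OF assms(3)] linear_map_zero[OF assms(1-3)])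
qed

lemma submodule_image:
  assumes "module R M" "module R N" "linear_map R M N f" "submodule H R M"
  shows "submodule (f ` H) R N"
proof -
  interpret M: module R M by fact
  interpret N: module R N by fact
  note H = submoduleD[OF assms(1,4)]
  have "f x \<oplus>\<^bsub>N\<^esub> f y \<in> f ` H" if "x \<in> H" "y \<in> H" for x y
    using that H by (metis image_eqI linear_map_add[OF assms(3)])
  moreover have "r \<odot>\<^bsub>N\<^esub> f x \<in> f ` H" if "r \<in> carrier R" "x \<in> H" for x r
    using that H by (metis image_eqI linear_map_smult[OF assms(3)])
  moreover have "\<zero>\<^bsub>N\<^esub> \<in> f ` H"
    using H(2) linear_map_zero[OF assms(1-3)] by (metis image_eqI)
  ultimately show ?thesis
    using H by (auto simp: N.submodule_iff linear_map_closed[OF assms(3)])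
qed

lemma submodule_kernel:
  assumes "module R M" "module R N" "linear_map R M N f"
  shows "submodule (a_kernel M N f) R M"
proof -
  interpret M: module R M by fact
  interpret N: module R N by fact
  show ?thesis
    by (auto simp: M.submodule_iff a_kernel_iff linear_map_simps[OF assms(3)] linear_map_zero[OF assms])
qed

lemma submodule_range:
  assumes "module R M" "module R N" "linear_map R M N f"
  shows "submodule (f ` carrier M) R N"
  using submodule_image[OF assms] module.carrier_is_submodule[OF assms(1)] by blast

lemma submodule_module: "module R M \<Longrightarrow> submodule H R M \<Longrightarrow> module R (M\<lparr>carrier := H\<rparr>)"
  by (rule submodule.submodule_is_module)

text \<open>A submodule is the ambient record with a smaller carrier and unchanged operations, hence
  its own submodules are the ambient ones contained in it.\<close>

lemma submodule_of_submodule: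
  assumes "module R M" "submodule H R M"
  shows "submodule K R (M\<lparr>carrier := H\<rparr>) \<longleftrightarrow> submodule K R M \<and> K \<subseteq> H"
  using submoduleD(1)[OF assms]
  by (auto simp: module.submodule_iff[OF assms(1)] module.submodule_iff[OF submodule_module[OF assms]])

lemma submodule_Int:
  assumes "module R M" "submodule H R M" "submodule K R M"
  shows "submodule (H \<inter> K) R M"
  using assms(2,3) by (auto simp: module.submodule_iff[OF assms(1)])

lemma submodule_zero: "module R M \<Longrightarrow> submodule {\<zero>\<^bsub>M\<^esub>} R M"
  using module.smult_r_null[of R M] 
  by (simp add: module.submodule_iff module_def abelian_group.axioms abelian_monoid.l_zero
      abelian_monoid.zero_closed)

lemma linear_map_inj_iff:
  assumes "module R M" "module R N" "linear_map R M N f"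
  shows "inj_on f (carrier M) \<longleftrightarrow> (\<forall>x\<in>carrier M. f x = \<zero>\<^bsub>N\<^esub> \<longrightarrow> x = \<zero>\<^bsub>M\<^esub>)"
proof -
  interpret M: module R M by fact
  interpret N: module R N by fact
  show ?thesis
  proof
    assume "inj_on f (carrier M)"
    then show "\<forall>x\<in>carrier M. f x = \<zero>\<^bsub>N\<^esub> \<longrightarrow> x = \<zero>\<^bsub>M\<^esub>"
      using linear_map_zero[OF assms] by (auto simp: inj_on_def)
  next
    assume *: "\<forall>x\<in>carrier M. f x = \<zero>\<^bsub>N\<^esub> \<longrightarrow> x = \<zero>\<^bsub>M\<^esub>"
    show "inj_on f (carrier M)"
    proof (rule inj_onI)
      fix x y assume xy: "x \<in> carrier M" "y \<in> carrier M" "f x = f y"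
      then have "f (x \<ominus>\<^bsub>M\<^esub> y) = \<zero>\<^bsub>N\<^esub>"
        using linear_map_closed[OF assms(3)] by (simp add: linear_map_diff[OF assms])
      then show "x = y" using * xy by (metis M.M.minus_closed M.M.minus_eq_zero_iff)
    qed
  qed
qed

lemma linear_map_inv_into:
  assumes "module R M" "linear_map R M N f" "bij_betw f (carrier M) (carrier N)"
  shows "linear_map R N M (inv_into (carrier M) f)"
proof (rule linear_mapI)
  interpret M: module R M by fact
  let ?g = "inv_into (carrier M) f"
  have inj: "inj_on f (carrier M)" and im: "f ` carrier M = carrier N"
    using assms(3) by (auto simp: bij_betw_def)
  show cl: "?g x \<in> carrier M" if "x \<in> carrier N" for x
    using that im by (metis inv_into_into)
  have fg: "f (?g x) = x" if "x \<in> carrier N" for x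
    using that im by (metis f_inv_into_f)
  have gf: "?g (f x) = x" if "x \<in> carrier M" for x
    using that inj by simp
  show "?g (x \<oplus>\<^bsub>N\<^esub> y) = ?g x \<oplus>\<^bsub>M\<^esub> ?g y" if "x \<in> carrier N" "y \<in> carrier N" for x y
  proof -
    have "f (?g x \<oplus>\<^bsub>M\<^esub> ?g y) = x \<oplus>\<^bsub>N\<^esub> y"
      using that by (simp add: linear_map_add[OF assms(2)] cl fg)
    then show ?thesis using gf[of "?g x \<oplus>\<^bsub>M\<^esub> ?g y"] that cl by simp
  qed
  show "?g (r \<odot>\<^bsub>N\<^esub> x) = r \<odot>\<^bsub>M\<^esub> ?g x" if "r \<in> carrier R" "x \<in> carrier N" for r x
  proof -
    have "f (r \<odot>\<^bsub>M\<^esub> ?g x) = r \<odot>\<^bsub>N\<^esub> x"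
      using that by (simp add: linear_map_smult[OF assms(2)] cl fg)
    then show ?thesis using gf[of "r \<odot>\<^bsub>M\<^esub> ?g x"] that cl by simp
  qed
qed

section \<open>Quotient modules\<close>

context
  fixes R :: "('a, 'r) ring_scheme" and M :: "('a, 'b) module" and H :: "'b set"
  assumes M: "module R M" and H: "submodule H R M"
begin

interpretation M: module R M by (rule M)

interpretation H: abelian_subgroup H M
  by (rule abelian_subgroupI3)
    (use H M in \<open>auto simp: additive_subgroup_def submodule_def module_def\<close>)

lemma quotient_carrier: "carrier (quotient_module M H) = (\<lambda>x. H +>\<^bsub>M\<^esub> x) ` carrier M"
  by (auto simp: quotient_module_def A_RCOSETS_def')

lemma coset_self: "x \<in> carrier M \<Longrightarrow> x \<in> H +>\<^bsub>M\<^esub> x"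
  by (rule H.a_rcos_self)

lemma coset_eq_iff:
  assumes "x \<in> carrier M" "y \<in> carrier M"
  shows "H +>\<^bsub>M\<^esub> x = H +>\<^bsub>M\<^esub> y \<longleftrightarrow> x \<ominus>\<^bsub>M\<^esub> y \<in> H"
proof
  assume "H +>\<^bsub>M\<^esub> x = H +>\<^bsub>M\<^esub> y"
  then show "x \<ominus>\<^bsub>M\<^esub> y \<in> H"
    using assms coset_self H.a_rcos_module_imp unfolding a_minus_def by metis
next
  assume "x \<ominus>\<^bsub>M\<^esub> y \<in> H"
  then have "x \<in> H +>\<^bsub>M\<^esub> y" using assms H.a_rcos_module_rev unfolding a_minus_def by metis
  then show "H +>\<^bsub>M\<^esub> x = H +>\<^bsub>M\<^esub> y"
    using M.M.a_repr_independence[OF _ assms(2) H.a_subgroup] by blast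
qed

lemma coset_memD:
  assumes "x \<in> carrier M" "y \<in> H +>\<^bsub>M\<^esub> x"
  shows "y \<in> carrier M" "H +>\<^bsub>M\<^esub> y = H +>\<^bsub>M\<^esub> x"
  using M.M.a_repr_independence[OF assms(2,1) H.a_subgroup] assms
    M.M.a_r_coset_subset_G[OF H.a_subset] by auto

lemma coset_add:
  "x \<in> carrier M \<Longrightarrow> y \<in> carrier M \<Longrightarrow>
   (H +>\<^bsub>M\<^esub> x) \<oplus>\<^bsub>quotient_module M H\<^esub> (H +>\<^bsub>M\<^esub> y) = H +>\<^bsub>M\<^esub> (x \<oplus>\<^bsub>M\<^esub> y)"
  by (simp add: quotient_module_def H.a_rcos_sum)

lemma quotient_zero: "\<zero>\<^bsub>quotient_module M H\<^esub> = H +>\<^bsub>M\<^esub> \<zero>\<^bsub>M\<^esub>"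
  using H.a_subset by (simp add: quotient_module_def)

text \<open>The scalar action on \<open>quotient_module\<close> and the map
  \<open>cohomology_map\<close> are written as unions over a coset. Such a union collapses to a
  single value once the function is constant on the coset; this is where well-definedness on classes
  is checked.\<close>

lemma coset_UN:
  assumes x: "x \<in> carrier M" and g: "\<And>y. y \<in> carrier M \<Longrightarrow> H +>\<^bsub>M\<^esub> y = H +>\<^bsub>M\<^esub> x \<Longrightarrow> g y = g x"
  shows "(\<Union>y\<in>H +>\<^bsub>M\<^esub> x. g y) = g x"
proof -
  have "g y = g x" if "y \<in> H +>\<^bsub>M\<^esub> x" for y
    using g coset_memD[OF x that] by blast
  then show ?thesis using coset_self[OF x] by blast
qed

lemma coset_smult:
  assumes "r \<in> carrier R" "x \<in> carrier M"
  shows "r \<odot>\<^bsub>quotient_module M H\<^esub> (H +>\<^bsub>M\<^esub> x) = H +>\<^bsub>M\<^esub> (r \<odot>\<^bsub>M\<^esub> x)"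
proof -
  have "H +>\<^bsub>M\<^esub> (r \<odot>\<^bsub>M\<^esub> y) = H +>\<^bsub>M\<^esub> (r \<odot>\<^bsub>M\<^esub> x)" 
    if y: "y \<in> carrier M" "H +>\<^bsub>M\<^esub> y = H +>\<^bsub>M\<^esub> x" for y
  proof -
    have "y \<ominus>\<^bsub>M\<^esub> x \<in> H" using y assms(2) coset_eq_iff by blast
    then have "r \<odot>\<^bsub>M\<^esub> (y \<ominus>\<^bsub>M\<^esub> x) \<in> H" using submoduleD(4)[OF M H assms(1)] by simp
    moreover have "r \<odot>\<^bsub>M\<^esub> (y \<ominus>\<^bsub>M\<^esub> x) = r \<odot>\<^bsub>M\<^esub> y \<ominus>\<^bsub>M\<^esub> r \<odot>\<^bsub>M\<^esub> x"
      using assms y(1) by (simp add: a_minus_def M.smult_r_distr M.smult_r_minus)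
    ultimately show ?thesis using assms y(1) by (simp add: coset_eq_iff)
  qed
  then show ?thesis 
    using coset_UN[OF assms(2), of "\<lambda>y. H +>\<^bsub>M\<^esub> (r \<odot>\<^bsub>M\<^esub> y)"] by (simp add: quotient_module_def)
qed

lemma coset_closed: "x \<in> carrier M \<Longrightarrow> H +>\<^bsub>M\<^esub> x \<in> carrier (quotient_module M H)"
  by (auto simp: quotient_carrier)

lemma quotient_cases:
  assumes "\<xi> \<in> carrier (quotient_module M H)"
  obtains x where "x \<in> carrier M" "\<xi> = H +>\<^bsub>M\<^esub> x"
  using assms by (auto simp: quotient_carrier)

lemma coset_zero_iff: "x \<in> carrier M \<Longrightarrow> H +>\<^bsub>M\<^esub> x = \<zero>\<^bsub>quotient_module M H\<^esub> \<longleftrightarrow> x \<in> H"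
  by (simp add: quotient_zero coset_eq_iff)

lemma quotient_is_module: "module R (quotient_module M H)"
proof (rule moduleI)
  let ?Q = "quotient_module M H"
  note simps = coset_add coset_smult quotient_zero coset_closed
  show "cring R" by (rule M.R.is_cring)
  show "abelian_group ?Q"
  proof (rule abelian_groupI)
    show "\<exists>y\<in>carrier ?Q. y \<oplus>\<^bsub>?Q\<^esub> x = \<zero>\<^bsub>?Q\<^esub>" if "x \<in> carrier ?Q" for x
      using that
    proof (rule quotient_cases)
      fix a assume a: "a \<in> carrier M" "x = H +>\<^bsub>M\<^esub> a"
      then have "(H +>\<^bsub>M\<^esub> (\<ominus>\<^bsub>M\<^esub> a)) \<oplus>\<^bsub>?Q\<^esub> x = \<zero>\<^bsub>?Q\<^esub>" by (simp add: simps M.M.l_neg)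
      then show ?thesis using a coset_closed M.M.a_inv_closed by blast
    qed
  qed (auto elim!: quotient_cases simp: simps M.M.a_ac)
qed (auto elim!: quotient_cases simp: coset_add coset_smult quotient_zero coset_closed
    M.smult_l_distr M.smult_r_distr M.smult_assoc1)

end

section \<open>Maps between quotients and the first isomorphism theorem\<close>

definition quotient_map ::
    "('a, 'b) module \<Rightarrow> 'b set \<Rightarrow> ('a, 'c) module \<Rightarrow> 'c set \<Rightarrow> ('b \<Rightarrow> 'c) \<Rightarrow> 'b set \<Rightarrow> 'c set" where
  "quotient_map M H N K f = (\<lambda>\<xi>\<in>carrier (quotient_module M H). \<Union>x\<in>\<xi>. K +>\<^bsub>N\<^esub> f x)"

context
  fixes R :: "('a, 'r) ring_scheme" and M :: "('a, 'b) module" and H :: "'b set"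
    and N :: "('a, 'c) module" and K :: "'c set" and f :: "'b \<Rightarrow> 'c"
  assumes M: "module R M" and H: "submodule H R M"
    and N: "module R N" and K: "submodule K R N"
    and f: "linear_map R M N f" and fH: "f ` H \<subseteq> K"
begin

lemma quotient_map_coset:
  assumes "x \<in> carrier M"
  shows "quotient_map M H N K f (H +>\<^bsub>M\<^esub> x) = K +>\<^bsub>N\<^esub> f x"
proof -
  have "K +>\<^bsub>N\<^esub> f y = K +>\<^bsub>N\<^esub> f x" if y: "y \<in> carrier M" "H +>\<^bsub>M\<^esub> y = H +>\<^bsub>M\<^esub> x" for y
  proof -
    have "y \<ominus>\<^bsub>M\<^esub> x \<in> H" using y assms coset_eq_iff[OF M H] by blast
    then have "f y \<ominus>\<^bsub>N\<^esub> f x \<in> K" using fH linear_map_diff[OF M N f] y assms by (metis image_subset_iff)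
    then show ?thesis using coset_eq_iff[OF N K] linear_map_closed[OF f] y assms by blast
  qed
  then show ?thesis
    using coset_UN[OF M H assms, of "\<lambda>y. K +>\<^bsub>N\<^esub> f y"] coset_closed[OF M H assms]
    by (simp add: quotient_map_def)
qed

lemma quotient_map_linear:
  "linear_map R (quotient_module M H) (quotient_module N K) (quotient_map M H N K f)"
proof -
  interpret M: module R M by (rule M)
  show ?thesis
    by (rule linear_mapI)
      (auto elim!: quotient_cases[OF M H] simp: coset_add[OF M H] coset_smult[OF M H]
        quotient_map_coset linear_map_simps[OF f] coset_add[OF N K] coset_smult[OF N K]
        coset_closed[OF N K])
qed

end

lemma first_iso:
  assumes M: "module R M" and N: "module R N" and f: "linear_map R M N f"
    and sur: "f ` carrier M = carrier N" and ker: "a_kernel M N f = H"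
  shows "\<exists>g. linear_map R (quotient_module M H) N g \<and>
    bij_betw g (carrier (quotient_module M H)) (carrier N)"
proof -
  interpret M: module R M by (rule M)
  interpret N: module R N by (rule N)
  have H: "submodule H R M" using submodule_kernel[OF M N f] ker by simp
  let ?Q = "quotient_module M H"
  \<comment> \<open>The choice of representative is harmless: \<open>f\<close> is constant on the
    cosets of its kernel.\<close>
  define g where "g \<xi> = f (SOME x. x \<in> \<xi>)" for \<xi>
  have g: "g (H +>\<^bsub>M\<^esub> x) = f x" if x: "x \<in> carrier M" for x
  proof -
    define y where "y = (SOME x'. x' \<in> H +>\<^bsub>M\<^esub> x)"
    have "y \<in> H +>\<^bsub>M\<^esub> x" unfolding y_def using coset_self[OF M H x] by (rule someI)
    from coset_memD[OF M H x this] have y: "y \<in> carrier M" "y \<ominus>\<^bsub>M\<^esub> x \<in> H"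
      using coset_eq_iff[OF M H] x by auto
    then have "f y \<ominus>\<^bsub>N\<^esub> f x = \<zero>\<^bsub>N\<^esub>"
      using ker linear_map_diff[OF M N f] x by (auto simp: a_kernel_iff)
    then have "f y = f x" using linear_map_closed[OF f x] linear_map_closed[OF f y(1)] by simp
    then show ?thesis by (simp add: g_def y_def)
  qed
  have lin: "linear_map R ?Q N g"
    by (rule linear_mapI)
      (auto elim!: quotient_cases[OF M H] simp: coset_add[OF M H] coset_smult[OF M H] g
        linear_map_simps[OF f])
  have "inj_on g (carrier ?Q)"
  proof (rule inj_onI)
    fix \<xi> \<eta> assume as: "\<xi> \<in> carrier ?Q" "\<eta> \<in> carrier ?Q" "g \<xi> = g \<eta>"
    then obtain x y where x: "x \<in> carrier M" "\<xi> = H +>\<^bsub>M\<^esub> x" and y: "y \<in> carrier M" "\<eta> = H +>\<^bsub>M\<^esub> y"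
      by (metis quotient_cases[OF M H])
    have "f (x \<ominus>\<^bsub>M\<^esub> y) = \<zero>\<^bsub>N\<^esub>"
      using as(3) x y g linear_map_closed[OF f] by (simp add: linear_map_diff[OF M N f])
    then have "x \<ominus>\<^bsub>M\<^esub> y \<in> H" using x y ker by (auto simp: a_kernel_iff)
    then show "\<xi> = \<eta>" using x y coset_eq_iff[OF M H] by blast
  qed
  moreover have "g ` carrier ?Q = carrier N"
    using sur g by (force simp: quotient_carrier[OF M H] image_image)
  ultimately show ?thesis using lin by (auto simp: bij_betw_def)
qed

section \<open>Finitely generated modules\<close>

lemma submodule_finsum:
  assumes "module R M" "submodule H R M" "finite S" "f \<in> S \<rightarrow> H"
  shows "(\<Oplus>\<^bsub>M\<^esub>s\<in>S. f s) \<in> H"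
proof -
  interpret M: module R M by fact
  note H = submoduleD[OF assms(1,2)]
  show ?thesis using assms(3,4)
  proof (induction S rule: finite_induct)
    case empty
    then show ?case by (simp add: H)
  next
    case (insert s S)
    then have "f \<in> S \<rightarrow> carrier M" "f s \<in> carrier M" using H(1) by (auto simp: Pi_iff)
    then show ?case using insert H by simp
  qed
qed

lemma linear_map_finsum:
  assumes "module R M" "module R N" "linear_map R M N f" "finite S" "g \<in> S \<rightarrow> carrier M"
  shows "f (\<Oplus>\<^bsub>M\<^esub>s\<in>S. g s) = (\<Oplus>\<^bsub>N\<^esub>s\<in>S. f (g s))"
proof -
  interpret M: module R M by fact
  interpret N: module R N by fact
  show ?thesis using assms(4,5)
  proof (induction S rule: finite_induct)
    case empty
    then show ?case by (simp add: linear_map_zero[OF assms(1-3)])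
  next
    case (insert s S)
    then have "g \<in> S \<rightarrow> carrier M" "g s \<in> carrier M" by auto
    moreover from this have "(\<lambda>s. f (g s)) \<in> S \<rightarrow> carrier N" "f (g s) \<in> carrier N"
      using linear_map_closed[OF assms(3)] by auto
    ultimately show ?case using insert by (simp add: linear_map_add[OF assms(3)])
  qed
qed

lemma submodule_combinations:
  assumes "module R M" "S \<subseteq> carrier M" "finite S"
  shows "submodule {x. \<exists>c\<in>S \<rightarrow> carrier R. x = (\<Oplus>\<^bsub>M\<^esub>s\<in>S. c s \<odot>\<^bsub>M\<^esub> s)} R M" (is "submodule ?L R M")
    and "S \<subseteq> {x. \<exists>c\<in>S \<rightarrow> carrier R. x = (\<Oplus>\<^bsub>M\<^esub>s\<in>S. c s \<odot>\<^bsub>M\<^esub> s)}"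
proof -
  interpret M: module R M by fact
  have cl: "(\<lambda>s. c s \<odot>\<^bsub>M\<^esub> s) \<in> S \<rightarrow> carrier M" if "c \<in> S \<rightarrow> carrier R" for c
    using that assms(2) by auto
  have "\<exists>e\<in>S \<rightarrow> carrier R. (\<Oplus>\<^bsub>M\<^esub>s\<in>S. c s \<odot>\<^bsub>M\<^esub> s) \<oplus>\<^bsub>M\<^esub> (\<Oplus>\<^bsub>M\<^esub>s\<in>S. d s \<odot>\<^bsub>M\<^esub> s) = (\<Oplus>\<^bsub>M\<^esub>s\<in>S. e s \<odot>\<^bsub>M\<^esub> s)"
    if "c \<in> S \<rightarrow> carrier R" "d \<in> S \<rightarrow> carrier R" for c d
  proof (rule bexI)
    show "(\<lambda>s. c s \<oplus>\<^bsub>R\<^esub> d s) \<in> S \<rightarrow> carrier R" using that by auto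
    have "(\<Oplus>\<^bsub>M\<^esub>s\<in>S. c s \<odot>\<^bsub>M\<^esub> s) \<oplus>\<^bsub>M\<^esub> (\<Oplus>\<^bsub>M\<^esub>s\<in>S. d s \<odot>\<^bsub>M\<^esub> s) = (\<Oplus>\<^bsub>M\<^esub>s\<in>S. c s \<odot>\<^bsub>M\<^esub> s \<oplus>\<^bsub>M\<^esub> d s \<odot>\<^bsub>M\<^esub> s)"
      using that by (simp add: M.M.finsum_addf cl)
    also have "\<dots> = (\<Oplus>\<^bsub>M\<^esub>s\<in>S. (c s \<oplus>\<^bsub>R\<^esub> d s) \<odot>\<^bsub>M\<^esub> s)"
      using that assms(2) by (intro M.M.finsum_cong') (auto simp: M.smult_l_distr subset_iff Pi_iff)
    finally show "(\<Oplus>\<^bsub>M\<^esub>s\<in>S. c s \<odot>\<^bsub>M\<^esub> s) \<oplus>\<^bsub>M\<^esub> (\<Oplus>\<^bsub>M\<^esub>s\<in>S. d s \<odot>\<^bsub>M\<^esub> s) = \<dots>" .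
  qed
  moreover have "\<exists>e\<in>S \<rightarrow> carrier R. r \<odot>\<^bsub>M\<^esub> (\<Oplus>\<^bsub>M\<^esub>s\<in>S. c s \<odot>\<^bsub>M\<^esub> s) = (\<Oplus>\<^bsub>M\<^esub>s\<in>S. e s \<odot>\<^bsub>M\<^esub> s)"
    if "c \<in> S \<rightarrow> carrier R" "r \<in> carrier R" for c r
  proof (rule bexI)
    show "(\<lambda>s. r \<otimes>\<^bsub>R\<^esub> c s) \<in> S \<rightarrow> carrier R" using that by auto
    have "r \<odot>\<^bsub>M\<^esub> (\<Oplus>\<^bsub>M\<^esub>s\<in>S. c s \<odot>\<^bsub>M\<^esub> s) = (\<Oplus>\<^bsub>M\<^esub>s\<in>S. r \<odot>\<^bsub>M\<^esub> (c s \<odot>\<^bsub>M\<^esub> s))"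
      using that assms(3) by (simp add: M.finsum_smult_ldistr cl)
    also have "\<dots> = (\<Oplus>\<^bsub>M\<^esub>s\<in>S. (r \<otimes>\<^bsub>R\<^esub> c s) \<odot>\<^bsub>M\<^esub> s)"
      using that assms(2) by (intro M.M.finsum_cong') (auto simp: M.smult_assoc1 subset_iff Pi_iff)
    finally show "r \<odot>\<^bsub>M\<^esub> (\<Oplus>\<^bsub>M\<^esub>s\<in>S. c s \<odot>\<^bsub>M\<^esub> s) = \<dots>" .
  qed
  moreover have "\<exists>e\<in>S \<rightarrow> carrier R. \<zero>\<^bsub>M\<^esub> = (\<Oplus>\<^bsub>M\<^esub>s\<in>S. e s \<odot>\<^bsub>M\<^esub> s)"
  proof (rule bexI)
    have "(\<Oplus>\<^bsub>M\<^esub>s\<in>S. \<zero>\<^bsub>R\<^esub> \<odot>\<^bsub>M\<^esub> s) = (\<Oplus>\<^bsub>M\<^esub>s\<in>S. \<zero>\<^bsub>M\<^esub>)"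
      using assms(2) by (intro M.M.finsum_cong') auto
    then show "\<zero>\<^bsub>M\<^esub> = (\<Oplus>\<^bsub>M\<^esub>s\<in>S. \<zero>\<^bsub>R\<^esub> \<odot>\<^bsub>M\<^esub> s)" by simp
  qed simp
  moreover have "?L \<subseteq> carrier M" using cl by auto
  ultimately show "submodule ?L R M" unfolding M.submodule_iff by auto
  show "S \<subseteq> ?L"
  proof
    fix t assume t: "t \<in> S"
    let ?e = "\<lambda>s. if s = t then \<one>\<^bsub>R\<^esub> else \<zero>\<^bsub>R\<^esub>"
    have "(\<Oplus>\<^bsub>M\<^esub>s\<in>S. ?e s \<odot>\<^bsub>M\<^esub> s) = (\<Oplus>\<^bsub>M\<^esub>s\<in>S. if t = s then s else \<zero>\<^bsub>M\<^esub>)"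
      using assms(2) by (intro M.M.finsum_cong') auto
    also have "\<dots> = t"
      using M.M.finsum_singleton[OF t assms(3), of "\<lambda>s. s"] assms(2) by auto
    finally have "t = (\<Oplus>\<^bsub>M\<^esub>s\<in>S. ?e s \<odot>\<^bsub>M\<^esub> s)" by simp
    moreover have "?e \<in> S \<rightarrow> carrier R" by auto
    ultimately show "t \<in> ?L" unfolding mem_Collect_eq by (rule bexI)
  qed
qed

text \<open>The linear combinations of a finite set form the least submodule that contains it.
  Testing generation on submodules frees the later arguments from coefficients.\<close>

lemma finitely_generated_iff:
  assumes "module R M"
  shows "finitely_generated R M \<longleftrightarrow> (\<exists>S\<subseteq>carrier M. finite S \<and>
    (\<forall>H. submodule H R M \<longrightarrow> S \<subseteq> H \<longrightarrow> carrier M \<subseteq> H))"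
proof -
  interpret M: module R M by fact
  have "(\<forall>x\<in>carrier M. \<exists>c\<in>S \<rightarrow> carrier R. x = (\<Oplus>\<^bsub>M\<^esub>s\<in>S. c s \<odot>\<^bsub>M\<^esub> s)) \<longleftrightarrow>
    (\<forall>H. submodule H R M \<longrightarrow> S \<subseteq> H \<longrightarrow> carrier M \<subseteq> H)" (is "?L \<longleftrightarrow> ?R")
    if S: "S \<subseteq> carrier M" "finite S" for S
  proof
    assume L: ?L
    show ?R
    proof (intro allI impI subsetI)
      fix H x assume H: "submodule H R M" "S \<subseteq> H" and x: "x \<in> carrier M"
      then obtain c where c: "c \<in> S \<rightarrow> carrier R" "x = (\<Oplus>\<^bsub>M\<^esub>s\<in>S. c s \<odot>\<^bsub>M\<^esub> s)" using L by blast
      then have "(\<lambda>s. c s \<odot>\<^bsub>M\<^esub> s) \<in> S \<rightarrow> H" using H submoduleD(4)[OF assms H(1)] by auto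
      then show "x \<in> H" using submodule_finsum[OF assms H(1) S(2)] c(2) by blast
    qed
  next
    assume ?R
    then have "carrier M \<subseteq> {x. \<exists>c\<in>S \<rightarrow> carrier R. x = (\<Oplus>\<^bsub>M\<^esub>s\<in>S. c s \<odot>\<^bsub>M\<^esub> s)}"
      using submodule_combinations[OF assms S] by blast
    then show ?L by blast
  qed
  then show ?thesis unfolding finitely_generated_def by (auto cong: conj_cong)
qed

text \<open>Generators of \<open>M\<close> are the images of generators of \<open>L\<close> together
  with lifts of generators of the image of \<open>p\<close>. The image stands in place of
  \<open>N\<close> because the maps that arise on Ext are in general not surjective.\<close>

lemma finitely_generated_middle:
  assumes L: "module R L" and M: "module R M" and N: "module R N"
    and i: "linear_map R L M i" and p: "linear_map R M N p"
    and ker: "a_kernel M N p \<subseteq> i ` carrier L"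
    and fgL: "finitely_generated R L" and fgN: "finitely_generated R (N\<lparr>carrier := p ` carrier M\<rparr>)"
  shows "finitely_generated R M"
proof -
  interpret M: module R M by fact
  interpret N: module R N by fact
  note P = submodule_range[OF M N p]
  obtain S where S: "S \<subseteq> carrier L" "finite S" "\<And>H. submodule H R L \<Longrightarrow> S \<subseteq> H \<Longrightarrow> carrier L \<subseteq> H"
    using fgL unfolding finitely_generated_iff[OF L] by blast
  obtain T' where T': "T' \<subseteq> p ` carrier M" "finite T'"
    "\<And>H. submodule H R N \<Longrightarrow> H \<subseteq> p ` carrier M \<Longrightarrow> T' \<subseteq> H \<Longrightarrow> p ` carrier M \<subseteq> H"
    using fgN unfolding finitely_generated_iff[OF submodule_module[OF N P]]
      submodule_of_submodule[OF N P] by auto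
  obtain T where T: "T \<subseteq> carrier M" "finite T" "T' = p ` T"
    using T'(1,2) by (meson finite_subset_image)
  show ?thesis unfolding finitely_generated_iff[OF M]
  proof (intro exI conjI allI impI)
    show "i ` S \<union> T \<subseteq> carrier M" "finite (i ` S \<union> T)"
      using S T linear_map_closed[OF i] by auto
    fix H assume H: "submodule H R M" "i ` S \<union> T \<subseteq> H"
    have "carrier L \<subseteq> {x \<in> carrier L. i x \<in> H}"
      using S(1) H(2) by (intro S(3) submodule_vimage[OF L M i H(1)]) auto
    then have iL: "i ` carrier L \<subseteq> H" by auto
    have "p ` carrier M \<subseteq> p ` H"
      using submoduleD(1)[OF M H(1)] T H(2)
      by (intro T'(3) submodule_image[OF M N p H(1)]) auto
    \<comment> \<open>Two elements with the same image differ by an element of the kernel of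
      \<open>p\<close>, which comes from \<open>L\<close> and so lies in \<open>H\<close>.\<close>
    moreover have "x \<in> H" if x: "x \<in> carrier M" and y: "y \<in> H" "p x = p y" for x y
    proof -
      have y': "y \<in> carrier M" using submoduleD(1)[OF M H(1)] y(1) .
      then have "p (x \<ominus>\<^bsub>M\<^esub> y) = \<zero>\<^bsub>N\<^esub>"
        using x y linear_map_closed[OF p] by (simp add: linear_map_diff[OF M N p])
      then have "x \<ominus>\<^bsub>M\<^esub> y \<in> H" using ker iL x y' by (auto simp: subset_iff a_kernel_iff)
      then have "(x \<ominus>\<^bsub>M\<^esub> y) \<oplus>\<^bsub>M\<^esub> y \<in> H" using submoduleD(3)[OF M H(1)] y(1) by blast
      then show "x \<in> H" using x y' by (simp add: a_minus_def M.M.a_assoc M.M.l_neg)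
    qed
    ultimately show "carrier M \<subseteq> H" by blast
  qed
qed

section \<open>Submodules of finitely generated modules over a noetherian ring\<close>

definition module_span :: "('a, 'r) ring_scheme \<Rightarrow> ('a, 'b) module \<Rightarrow> 'b set \<Rightarrow> 'b set" where
  "module_span R M S = \<Inter>{H. submodule H R M \<and> S \<subseteq> H}"

lemma module_span_least: "submodule H R M \<Longrightarrow> S \<subseteq> H \<Longrightarrow> module_span R M S \<subseteq> H"
  and module_span_incl: "S \<subseteq> module_span R M S"
  by (auto simp: module_span_def)

lemma submodule_module_span:
  assumes "module R M" "S \<subseteq> carrier M"
  shows "submodule (module_span R M S) R M"
  unfolding module.submodule_iff[OF assms(1)] module_span_def
  using module.carrier_is_submodule[OF assms(1)] assms(2) submoduleD[OF assms(1)] by auto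

text \<open>The elements of the asserted form make up a submodule that contains all generators,
  hence it contains the span.\<close>

lemma module_span_insert:
  assumes M: "module R M" and s: "s \<in> carrier M" and S: "S \<subseteq> carrier M"
    and x: "x \<in> module_span R M (insert s S)"
  shows "\<exists>r\<in>carrier R. \<exists>t\<in>module_span R M S. x = r \<odot>\<^bsub>M\<^esub> s \<oplus>\<^bsub>M\<^esub> t"
proof -
  interpret M: module R M by fact
  let ?H = "{x. \<exists>r\<in>carrier R. \<exists>t\<in>module_span R M S. x = r \<odot>\<^bsub>M\<^esub> s \<oplus>\<^bsub>M\<^esub> t}"
  note T = submoduleD[OF M submodule_module_span[OF M S]]
  have "submodule ?H R M" unfolding M.submodule_iff
  proof (intro conjI ballI)
    show "?H \<subseteq> carrier M" using s T(1) by auto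
    show "\<zero>\<^bsub>M\<^esub> \<in> ?H" using s T(2) by (auto intro!: bexI[of _ "\<zero>\<^bsub>R\<^esub>"] bexI[of _ "\<zero>\<^bsub>M\<^esub>"])
  next
    fix x y assume "x \<in> ?H" "y \<in> ?H"
    then obtain a t b u where x: "a \<in> carrier R" "t \<in> module_span R M S" "x = a \<odot>\<^bsub>M\<^esub> s \<oplus>\<^bsub>M\<^esub> t"
      and y: "b \<in> carrier R" "u \<in> module_span R M S" "y = b \<odot>\<^bsub>M\<^esub> s \<oplus>\<^bsub>M\<^esub> u" by blast
    have "x \<oplus>\<^bsub>M\<^esub> y = (a \<oplus>\<^bsub>R\<^esub> b) \<odot>\<^bsub>M\<^esub> s \<oplus>\<^bsub>M\<^esub> (t \<oplus>\<^bsub>M\<^esub> u)"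
      using x y T(1) s by (simp add: M.smult_l_distr M.M.a_ac)
    then show "x \<oplus>\<^bsub>M\<^esub> y \<in> ?H" using x y T(3) by blast
  next
    fix r x assume r: "r \<in> carrier R" and "x \<in> ?H"
    then obtain a t where x: "a \<in> carrier R" "t \<in> module_span R M S" "x = a \<odot>\<^bsub>M\<^esub> s \<oplus>\<^bsub>M\<^esub> t" by blast
    then have "r \<odot>\<^bsub>M\<^esub> x = (r \<otimes>\<^bsub>R\<^esub> a) \<odot>\<^bsub>M\<^esub> s \<oplus>\<^bsub>M\<^esub> (r \<odot>\<^bsub>M\<^esub> t)"
      using T(1) r s by (simp add: M.smult_r_distr M.smult_assoc1)
    then show "r \<odot>\<^bsub>M\<^esub> x \<in> ?H" using x r T(4) M.R.m_closed by blast
  qed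
  moreover have "insert s S \<subseteq> ?H"
  proof -
    have "s = \<one>\<^bsub>R\<^esub> \<odot>\<^bsub>M\<^esub> s \<oplus>\<^bsub>M\<^esub> \<zero>\<^bsub>M\<^esub>" using s by simp
    then have "s \<in> ?H" using T(2) M.R.one_closed by blast
    moreover have "t \<in> ?H" if t: "t \<in> S" for t
    proof -
      have "t = \<zero>\<^bsub>R\<^esub> \<odot>\<^bsub>M\<^esub> s \<oplus>\<^bsub>M\<^esub> t" using s t S by auto
      then show ?thesis using t module_span_incl[of S R M] M.R.zero_closed by blast
    qed
    ultimately show ?thesis by blast
  qed
  ultimately show ?thesis using module_span_least x by blast
qed

text \<open>The classical induction on the number of generators: the coefficients that the new generator
  has in elements of the submodule form an ideal.\<close>

lemma noetherian_span_submodule: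
  assumes R: "noetherian_ring R" and M: "module R M" and "finite S" "S \<subseteq> carrier M"
    and "submodule H R M" "H \<subseteq> module_span R M S"
  shows "finitely_generated R (M\<lparr>carrier := H\<rparr>)"
  using assms(3-6)
proof (induction S arbitrary: H rule: finite_induct)
  case empty
  have "module_span R M {} \<subseteq> {\<zero>\<^bsub>M\<^esub>}" using module_span_least[OF submodule_zero[OF M]] by blast
  then have "H \<subseteq> {\<zero>\<^bsub>M\<^esub>}" using empty by blast
  then show ?case
    unfolding finitely_generated_iff[OF submodule_module[OF M empty(2)]]
      submodule_of_submodule[OF M empty(2)] using submoduleD(2)[OF M]
    by (intro exI[of _ "{}"]) auto
next
  case (insert s S)
  interpret M: module R M by fact
  interpret R: noetherian_ring R by fact
  have s: "s \<in> carrier M" and S: "S \<subseteq> carrier M" using insert by auto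
  let ?T = "module_span R M S"
  note Tsub = submodule_module_span[OF M S]
  note T = submoduleD[OF M Tsub]
  define I where "I K = {r \<in> carrier R. \<exists>t\<in>?T. r \<odot>\<^bsub>M\<^esub> s \<oplus>\<^bsub>M\<^esub> t \<in> K}" for K
  have ideal: "ideal (I K) R" if K: "submodule K R M" for K
  proof (rule idealI)
    note KD = submoduleD[OF M K]
    have add: "a \<oplus>\<^bsub>R\<^esub> b \<in> I K" if ab: "a \<in> I K" "b \<in> I K" for a b
    proof -
      obtain t u where tu: "t \<in> ?T" "u \<in> ?T" "a \<odot>\<^bsub>M\<^esub> s \<oplus>\<^bsub>M\<^esub> t \<in> K" "b \<odot>\<^bsub>M\<^esub> s \<oplus>\<^bsub>M\<^esub> u \<in> K"
        and c: "a \<in> carrier R" "b \<in> carrier R" using ab by (auto simp: I_def)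
      have "(a \<oplus>\<^bsub>R\<^esub> b) \<odot>\<^bsub>M\<^esub> s \<oplus>\<^bsub>M\<^esub> (t \<oplus>\<^bsub>M\<^esub> u) = (a \<odot>\<^bsub>M\<^esub> s \<oplus>\<^bsub>M\<^esub> t) \<oplus>\<^bsub>M\<^esub> (b \<odot>\<^bsub>M\<^esub> s \<oplus>\<^bsub>M\<^esub> u)"
        using tu c T(1) s by (simp add: M.smult_l_distr M.M.a_ac)
      also have "\<dots> \<in> K" using KD(3) tu by blast
      finally show ?thesis unfolding I_def using c T(3) tu by blast
    qed
    have mul: "r \<otimes>\<^bsub>R\<^esub> a \<in> I K" if ab: "a \<in> I K" "r \<in> carrier R" for a r
    proof -
      obtain t where tu: "t \<in> ?T" "a \<odot>\<^bsub>M\<^esub> s \<oplus>\<^bsub>M\<^esub> t \<in> K"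
        and c: "a \<in> carrier R" using ab by (auto simp: I_def)
      have "(r \<otimes>\<^bsub>R\<^esub> a) \<odot>\<^bsub>M\<^esub> s \<oplus>\<^bsub>M\<^esub> (r \<odot>\<^bsub>M\<^esub> t) = r \<odot>\<^bsub>M\<^esub> (a \<odot>\<^bsub>M\<^esub> s \<oplus>\<^bsub>M\<^esub> t)"
        using tu c T(1) s ab by (simp add: M.smult_r_distr M.smult_assoc1)
      also have "\<dots> \<in> K" using KD(4) tu ab by blast
      finally show ?thesis unfolding I_def using c T(4) tu ab M.R.m_closed by blast
    qed
    have zero: "\<zero>\<^bsub>R\<^esub> \<in> I K" using s T(2) KD(2) by (auto simp: I_def intro!: bexI[of _ "\<zero>\<^bsub>M\<^esub>"])
    have sub: "I K \<subseteq> carrier R" by (auto simp: I_def)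
    show "ring R" by (rule cring.axioms(1)[OF M.R.is_cring])
    show "subgroup (I K) (add_monoid R)"
    proof (rule M.R.add.subgroupI)
      fix a assume a: "a \<in> I K"
      then have "\<ominus>\<^bsub>R\<^esub> a = (\<ominus>\<^bsub>R\<^esub> \<one>\<^bsub>R\<^esub>) \<otimes>\<^bsub>R\<^esub> a" using sub by (auto simp: M.R.l_minus)
      then show "\<ominus>\<^bsub>R\<^esub> a \<in> I K" using mul[OF a, of "\<ominus>\<^bsub>R\<^esub> \<one>\<^bsub>R\<^esub>"] by simp
    qed (use sub zero add in auto)
    fix a r assume ar: "a \<in> I K" "r \<in> carrier R"
    show "r \<otimes>\<^bsub>R\<^esub> a \<in> I K" using mul ar .
    then show "a \<otimes>\<^bsub>R\<^esub> r \<in> I K" using M.R.m_comm ar sub by (metis subsetD)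
  qed
  note HD = submoduleD[OF M insert.prems(2)]
  obtain B where B: "B \<subseteq> carrier R" "finite B" "I H = Idl\<^bsub>R\<^esub> B"
    using R.finetely_gen[OF ideal[OF insert.prems(2)]] by blast
  then have "B \<subseteq> I H" using M.R.genideal_self by metis
  then have "\<forall>r\<in>B. \<exists>t\<in>?T. r \<odot>\<^bsub>M\<^esub> s \<oplus>\<^bsub>M\<^esub> t \<in> H" by (auto simp: I_def)
  then obtain \<tau> where \<tau>: "\<And>r. r \<in> B \<Longrightarrow> \<tau> r \<in> ?T" "\<And>r. r \<in> B \<Longrightarrow> r \<odot>\<^bsub>M\<^esub> s \<oplus>\<^bsub>M\<^esub> \<tau> r \<in> H"
    by metis
  have HT: "submodule (H \<inter> ?T) R M" using submodule_Int[OF M insert.prems(2) Tsub] .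
  have "finitely_generated R (M\<lparr>carrier := H \<inter> ?T\<rparr>)"
    using insert.IH[OF S HT] by blast
  then obtain G where G: "G \<subseteq> H \<inter> ?T" "finite G"
    "\<And>K. submodule K R M \<Longrightarrow> K \<subseteq> H \<inter> ?T \<Longrightarrow> G \<subseteq> K \<Longrightarrow> H \<inter> ?T \<subseteq> K"
    unfolding finitely_generated_iff[OF submodule_module[OF M HT]] submodule_of_submodule[OF M HT]
    by auto
  show ?case
    unfolding finitely_generated_iff[OF submodule_module[OF M insert.prems(2)]]
      submodule_of_submodule[OF M insert.prems(2)]
  proof (intro exI conjI allI impI)
    \<comment> \<open>Generators of the part of \<open>H\<close> below the old span, plus one
      element of \<open>H\<close> for each generator of the ideal of coefficients.\<close>
    let ?F = "G \<union> (\<lambda>r. r \<odot>\<^bsub>M\<^esub> s \<oplus>\<^bsub>M\<^esub> \<tau> r) ` B"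
    show "?F \<subseteq> carrier (M\<lparr>carrier := H\<rparr>)" "finite ?F" using G B \<tau> by auto
    fix K assume K: "submodule K R M \<and> K \<subseteq> H" "?F \<subseteq> K"
    note KD = submoduleD[OF M conjunct1[OF K(1)]]
    have TK: "H \<inter> ?T \<subseteq> K"
      using G(3)[of "K \<inter> ?T"] submodule_Int[OF M _ Tsub] K G(1) by blast
    have "r \<in> I K" if r: "r \<in> B" for r
    proof -
      have "r \<odot>\<^bsub>M\<^esub> s \<oplus>\<^bsub>M\<^esub> \<tau> r \<in> K" using K(2) r by blast
      then show ?thesis using \<tau>(1)[OF r] B(1) r unfolding I_def by blast
    qed
    then have "B \<subseteq> I K" by blast
    then have IK: "I H \<subseteq> I K" using M.R.genideal_minimal[OF ideal[OF conjunct1[OF K(1)]]] B(3) by blast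
    show "carrier (M\<lparr>carrier := H\<rparr>) \<subseteq> K"
    proof
      fix x assume "x \<in> carrier (M\<lparr>carrier := H\<rparr>)"
      then have x: "x \<in> H" by simp
      then obtain r t where rt: "r \<in> carrier R" "t \<in> ?T" "x = r \<odot>\<^bsub>M\<^esub> s \<oplus>\<^bsub>M\<^esub> t"
        using module_span_insert[OF M s S] insert.prems(3) by blast
      then have "r \<in> I H" using x by (auto simp: I_def)
      then obtain u where u: "u \<in> ?T" "r \<odot>\<^bsub>M\<^esub> s \<oplus>\<^bsub>M\<^esub> u \<in> K" using IK by (auto simp: I_def)
      have c: "t \<in> carrier M" "u \<in> carrier M" using T(1) rt(2) u(1) by auto
      \<comment> \<open>Both elements have the same coefficient \<open>r\<close> at
        \<open>s\<close>, so their difference lies in the old span and in \<open>H\<close>, a part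
        already known to be contained in \<open>K\<close>.\<close>
      have "x \<ominus>\<^bsub>M\<^esub> (r \<odot>\<^bsub>M\<^esub> s \<oplus>\<^bsub>M\<^esub> u) = (r \<odot>\<^bsub>M\<^esub> s \<ominus>\<^bsub>M\<^esub> r \<odot>\<^bsub>M\<^esub> s) \<oplus>\<^bsub>M\<^esub> (t \<ominus>\<^bsub>M\<^esub> u)"
        using rt c s by (simp add: a_minus_def M.M.minus_add M.M.a_ac del: M.M.r_neg)
      also have "\<dots> = t \<ominus>\<^bsub>M\<^esub> u" using rt s c by simp
      finally have eq: "x \<ominus>\<^bsub>M\<^esub> (r \<odot>\<^bsub>M\<^esub> s \<oplus>\<^bsub>M\<^esub> u) = t \<ominus>\<^bsub>M\<^esub> u" .
      have "t \<ominus>\<^bsub>M\<^esub> u \<in> ?T" using T(6) rt(2) u(1) by blast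
      moreover have "x \<ominus>\<^bsub>M\<^esub> (r \<odot>\<^bsub>M\<^esub> s \<oplus>\<^bsub>M\<^esub> u) \<in> H" using HD(6) x u(2) K(1) by blast
      ultimately have "x \<ominus>\<^bsub>M\<^esub> (r \<odot>\<^bsub>M\<^esub> s \<oplus>\<^bsub>M\<^esub> u) \<in> K" using TK eq by auto
      then have "(x \<ominus>\<^bsub>M\<^esub> (r \<odot>\<^bsub>M\<^esub> s \<oplus>\<^bsub>M\<^esub> u)) \<oplus>\<^bsub>M\<^esub> (r \<odot>\<^bsub>M\<^esub> s \<oplus>\<^bsub>M\<^esub> u) \<in> K" using KD(3) u(2) by blast
      moreover have "x \<in> carrier M" "r \<odot>\<^bsub>M\<^esub> s \<oplus>\<^bsub>M\<^esub> u \<in> carrier M" using HD(1) x KD(1) u(2) by auto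
      ultimately show "x \<in> K" by (simp add: a_minus_def M.M.a_assoc M.M.l_neg)
    qed
  qed
qed

lemma noetherian_submodule:
  assumes R: "noetherian_ring R" and M: "module R M" and "finitely_generated R M" "submodule H R M"
  shows "finitely_generated R (M\<lparr>carrier := H\<rparr>)"
proof -
  obtain S where S: "S \<subseteq> carrier M" "finite S" "\<And>H. submodule H R M \<Longrightarrow> S \<subseteq> H \<Longrightarrow> carrier M \<subseteq> H"
    using assms(3) unfolding finitely_generated_iff[OF M] by blast
  have "carrier M \<subseteq> module_span R M S"
    using S(3)[OF submodule_module_span[OF M S(1)] module_span_incl] .
  then show ?thesis
    using noetherian_span_submodule[OF R M S(2,1) assms(4)] submoduleD(1)[OF M assms(4)] by blast
qed

section \<open>Support\<close>

text \<open>A localization vanishes exactly when every fraction m/1 equals 0/1, that is, when every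
  m is killed by some element outside the prime. This form lets support be handled without
  fractions.\<close>

lemma Supp_iff:
  assumes "module R M"
  shows "\<pp> \<in> Supp R M \<longleftrightarrow>
    primeideal \<pp> R \<and> (\<exists>m\<in>carrier M. \<forall>u\<in>carrier R - \<pp>. u \<odot>\<^bsub>M\<^esub> m \<noteq> \<zero>\<^bsub>M\<^esub>)"
proof (cases "primeideal \<pp> R")
  case True
  interpret M: module R M by fact
  interpret p: primeideal \<pp> R by fact
  let ?S = "carrier R - \<pp>" and ?L = "localized_module R M (carrier R - \<pp>)"
  let ?rel = "fraction_rel M ?S"
  have one: "\<one>\<^bsub>R\<^esub> \<in> ?S" using p.I_notcarr p.one_imp_carrier by blast
  have mult: "u \<otimes>\<^bsub>R\<^esub> v \<in> ?S" if "u \<in> ?S" "v \<in> ?S" for u v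
    using that p.I_prime by blast
  have "carrier ?L = {\<zero>\<^bsub>?L\<^esub>} \<longleftrightarrow> (\<forall>m\<in>carrier M. \<exists>u\<in>?S. u \<odot>\<^bsub>M\<^esub> m = \<zero>\<^bsub>M\<^esub>)"
  proof
    assume triv: "carrier ?L = {\<zero>\<^bsub>?L\<^esub>}"
    show "\<forall>m\<in>carrier M. \<exists>u\<in>?S. u \<odot>\<^bsub>M\<^esub> m = \<zero>\<^bsub>M\<^esub>"
    proof
      fix m assume m: "m \<in> carrier M"
      have "?rel `` {(m, \<one>\<^bsub>R\<^esub>)} \<in> carrier ?L"
        using m one by (auto simp: localized_module_def intro: quotientI)
      then have "?rel `` {(m, \<one>\<^bsub>R\<^esub>)} = ?rel `` {(\<zero>\<^bsub>M\<^esub>, \<one>\<^bsub>R\<^esub>)}"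
        using triv by (simp add: localized_module_def)
      moreover have "((m, \<one>\<^bsub>R\<^esub>), (m, \<one>\<^bsub>R\<^esub>)) \<in> ?rel"
        using m one by (auto simp: fraction_rel_def intro!: bexI[of _ "\<one>\<^bsub>R\<^esub>"])
      ultimately have "((\<zero>\<^bsub>M\<^esub>, \<one>\<^bsub>R\<^esub>), (m, \<one>\<^bsub>R\<^esub>)) \<in> ?rel" by blast
      then obtain u where u: "u \<in> ?S" "u \<odot>\<^bsub>M\<^esub> (\<ominus>\<^bsub>M\<^esub> m) = \<zero>\<^bsub>M\<^esub>"
        using m by (auto simp: fraction_rel_def a_minus_def)
      then have "\<ominus>\<^bsub>M\<^esub> (u \<odot>\<^bsub>M\<^esub> m) = \<zero>\<^bsub>M\<^esub>" using m by (simp add: M.smult_r_minus)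
      moreover have "u \<odot>\<^bsub>M\<^esub> m \<in> carrier M" using u m by simp
      ultimately have "u \<odot>\<^bsub>M\<^esub> m = \<zero>\<^bsub>M\<^esub>" by simp
      then show "\<exists>u\<in>?S. u \<odot>\<^bsub>M\<^esub> m = \<zero>\<^bsub>M\<^esub>" using u by blast
    qed
  next
    assume kill: "\<forall>m\<in>carrier M. \<exists>u\<in>?S. u \<odot>\<^bsub>M\<^esub> m = \<zero>\<^bsub>M\<^esub>"
    \<comment> \<open>If every element is killed by an admissible denominator, any two fractions are
      related and there is only one class.\<close>
    have all: "((m, s), (n, t)) \<in> ?rel" if "m \<in> carrier M" "n \<in> carrier M" "s \<in> ?S" "t \<in> ?S" for m s n t
    proof -
      have "t \<odot>\<^bsub>M\<^esub> m \<ominus>\<^bsub>M\<^esub> s \<odot>\<^bsub>M\<^esub> n \<in> carrier M" using that by simp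
      then show ?thesis using kill that by (auto simp: fraction_rel_def)
    qed
    have "?rel `` {x} = carrier M \<times> ?S" if "x \<in> carrier M \<times> ?S" for x
      using that all by (auto simp: fraction_rel_def)
    moreover have "(\<zero>\<^bsub>M\<^esub>, \<one>\<^bsub>R\<^esub>) \<in> carrier M \<times> ?S" using one by simp
    ultimately show "carrier ?L = {\<zero>\<^bsub>?L\<^esub>}"
      unfolding localized_module_def quotient_def by auto
  qed
  then show ?thesis using True by (auto simp: Supp_def)
qed (simp add: Supp_def)

lemma Supp_subset_V_iff:
  assumes "module R M"
  shows "Supp R M \<subseteq> V R \<aa> \<longleftrightarrow> (\<forall>\<pp>. primeideal \<pp> R \<longrightarrow> \<not> \<aa> \<subseteq> \<pp> \<longrightarrow>
    (\<forall>m\<in>carrier M. \<exists>u\<in>carrier R - \<pp>. u \<odot>\<^bsub>M\<^esub> m = \<zero>\<^bsub>M\<^esub>))"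
  unfolding subset_iff Supp_iff[OF assms] by (auto simp: V_def)

text \<open>Exactness of localization, done on elements: if u kills the image of m in
  \<open>N\<close>, then u m comes from some l in \<open>L\<close>; if v kills l, then v u kills m.
  The product v u stays outside the prime.\<close>

lemma Supp_middle:
  assumes L: "module R L" and M: "module R M" and N: "module R N"
    and i: "linear_map R L M i" and p: "linear_map R M N p"
    and ker: "a_kernel M N p \<subseteq> i ` carrier L"
    and suppL: "Supp R L \<subseteq> V R \<aa>" and suppN: "Supp R N \<subseteq> V R \<aa>"
  shows "Supp R M \<subseteq> V R \<aa>"
  unfolding Supp_subset_V_iff[OF M]
proof (intro allI impI ballI)
  fix \<pp> m assume \<pp>: "primeideal \<pp> R" "\<not> \<aa> \<subseteq> \<pp>" and m: "m \<in> carrier M"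
  interpret L: module R L by fact
  interpret M: module R M by fact
  interpret p: primeideal \<pp> R by fact
  have "p m \<in> carrier N" using m linear_map_closed[OF p] by simp
  then obtain u where u: "u \<in> carrier R - \<pp>" "u \<odot>\<^bsub>N\<^esub> p m = \<zero>\<^bsub>N\<^esub>"
    using suppN \<pp> unfolding Supp_subset_V_iff[OF N] by blast
  then have "u \<odot>\<^bsub>M\<^esub> m \<in> a_kernel M N p"
    using m by (simp add: a_kernel_iff linear_map_smult[OF p])
  then obtain l where l: "l \<in> carrier L" "u \<odot>\<^bsub>M\<^esub> m = i l" using ker by blast
  then obtain v where v: "v \<in> carrier R - \<pp>" "v \<odot>\<^bsub>L\<^esub> l = \<zero>\<^bsub>L\<^esub>"
    using suppL \<pp> unfolding Supp_subset_V_iff[OF L] by blast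
  have "(v \<otimes>\<^bsub>R\<^esub> u) \<odot>\<^bsub>M\<^esub> m = i (v \<odot>\<^bsub>L\<^esub> l)"
    using u(1) v(1) m l by (simp add: M.smult_assoc1 linear_map_smult[OF i])
  also have "\<dots> = \<zero>\<^bsub>M\<^esub>" using v linear_map_zero[OF L M i] by simp
  finally have "(v \<otimes>\<^bsub>R\<^esub> u) \<odot>\<^bsub>M\<^esub> m = \<zero>\<^bsub>M\<^esub>" .
  moreover have "v \<otimes>\<^bsub>R\<^esub> u \<in> carrier R - \<pp>" using u(1) v(1) p.I_prime by blast
  ultimately show "\<exists>u\<in>carrier R - \<pp>. u \<odot>\<^bsub>M\<^esub> m = \<zero>\<^bsub>M\<^esub>" by blast
qed

section \<open>Lifting along surjections\<close>

text \<open>Free modules are projective: basis elements are lifted by choice and the lift is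
  extended through the coordinates, which are linear because they are unique.\<close>

lemma free_module_lift:
  assumes F: "free_module R F" and M: "module R M" and N: "module R N"
    and p: "linear_map R M N p" and sur: "carrier N \<subseteq> p ` carrier M"
    and \<psi>: "linear_map R F N \<psi>"
  shows "\<exists>\<phi>. linear_map R F M \<phi> \<and> (\<forall>x\<in>carrier F. p (\<phi> x) = \<psi> x)"
proof -
  have modF: "module R F" using F by (simp add: free_module_def)
  interpret F: module R F by fact
  interpret M: module R M by fact
  interpret N: module R N by fact
  define supp where "supp B c = {b \<in> B. c b \<noteq> \<zero>\<^bsub>R\<^esub>}" for B and c :: "'c \<Rightarrow> 'a"
  have "\<exists>B\<subseteq>carrier F. \<forall>x\<in>carrier F.
     \<exists>!c. c \<in> B \<rightarrow>\<^sub>E carrier R \<and> finite (supp B c) \<and> x = (\<Oplus>\<^bsub>F\<^esub>b\<in>supp B c. c b \<odot>\<^bsub>F\<^esub> b)"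
    using F unfolding free_module_def supp_def by (rule conjunct2)
  then obtain B where B: "B \<subseteq> carrier F" and ex1': "\<forall>x\<in>carrier F.
     \<exists>!c. c \<in> B \<rightarrow>\<^sub>E carrier R \<and> finite (supp B c) \<and> x = (\<Oplus>\<^bsub>F\<^esub>b\<in>supp B c. c b \<odot>\<^bsub>F\<^esub> b)"
    by (elim exE conjE) (rule that)
  note ex1 = bspec[OF ex1']
  define c where "c x = (THE c. c \<in> B \<rightarrow>\<^sub>E carrier R \<and> finite (supp B c) \<and>
    x = (\<Oplus>\<^bsub>F\<^esub>b\<in>supp B c. c b \<odot>\<^bsub>F\<^esub> b))" for x
  have c: "c x \<in> B \<rightarrow>\<^sub>E carrier R" "finite (supp B (c x))" "(\<Oplus>\<^bsub>F\<^esub>b\<in>supp B (c x). c x b \<odot>\<^bsub>F\<^esub> b) = x"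
    if "x \<in> carrier F" for x
    using theI'[OF ex1[OF that], folded c_def] by simp_all
  have cR: "c x b \<in> carrier R" if "x \<in> carrier F" "b \<in> B" for x b
    using c(1)[OF that(1)] that(2) by auto
  have uniq: "c x = d" if "x \<in> carrier F" "d \<in> B \<rightarrow>\<^sub>E carrier R" "finite (supp B d)"
      "x = (\<Oplus>\<^bsub>F\<^esub>b\<in>supp B d. d b \<odot>\<^bsub>F\<^esub> b)" for x d
    unfolding c_def using the1_equality[OF ex1[OF that(1)]] that by blast
  \<comment> \<open>The support of a sum of coordinate functions can be smaller than the union of
    the supports. Sums are therefore first enlarged to a common finite index set, where they can be
    added term by term.\<close>
  have ext: "(\<Oplus>\<^bsub>P\<^esub>b\<in>supp B d. d b \<odot>\<^bsub>P\<^esub> g b) = (\<Oplus>\<^bsub>P\<^esub>b\<in>T. d b \<odot>\<^bsub>P\<^esub> g b)"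
    if P: "module R P" and T: "finite T" "supp B d \<subseteq> T" "T \<subseteq> B" "\<And>b. b \<in> B \<Longrightarrow> d b \<in> carrier R"
      "\<And>b. b \<in> B \<Longrightarrow> g b \<in> carrier P"
    for P :: "('a, 'p) module" and g d T
  proof -
    interpret P: module R P by fact
    show ?thesis using T
      by (intro P.M.add.finprod_mono_neutral_cong_left) (auto simp: supp_def)
  qed
  have add: "(\<Oplus>\<^bsub>P\<^esub>b\<in>T. d b \<odot>\<^bsub>P\<^esub> g b) \<oplus>\<^bsub>P\<^esub> (\<Oplus>\<^bsub>P\<^esub>b\<in>T. e b \<odot>\<^bsub>P\<^esub> g b) = (\<Oplus>\<^bsub>P\<^esub>b\<in>T. (d b \<oplus>\<^bsub>R\<^esub> e b) \<odot>\<^bsub>P\<^esub> g b)"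
    if P: "module R P" and T: "T \<subseteq> B" "\<And>b. b \<in> B \<Longrightarrow> d b \<in> carrier R"
      "\<And>b. b \<in> B \<Longrightarrow> e b \<in> carrier R" "\<And>b. b \<in> B \<Longrightarrow> g b \<in> carrier P"
    for P :: "('a, 'p) module" and g d e T
  proof -
    interpret P: module R P by fact
    have "(\<Oplus>\<^bsub>P\<^esub>b\<in>T. d b \<odot>\<^bsub>P\<^esub> g b) \<oplus>\<^bsub>P\<^esub> (\<Oplus>\<^bsub>P\<^esub>b\<in>T. e b \<odot>\<^bsub>P\<^esub> g b)
      = (\<Oplus>\<^bsub>P\<^esub>b\<in>T. d b \<odot>\<^bsub>P\<^esub> g b \<oplus>\<^bsub>P\<^esub> e b \<odot>\<^bsub>P\<^esub> g b)"
      using T by (subst P.M.finsum_addf) (auto simp: subset_iff)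
    also have "\<dots> = (\<Oplus>\<^bsub>P\<^esub>b\<in>T. (d b \<oplus>\<^bsub>R\<^esub> e b) \<odot>\<^bsub>P\<^esub> g b)"
      using T by (intro P.M.finsum_cong') (auto simp: P.smult_l_distr subset_iff)
    finally show ?thesis .
  qed
  have smult: "r \<odot>\<^bsub>P\<^esub> (\<Oplus>\<^bsub>P\<^esub>b\<in>T. d b \<odot>\<^bsub>P\<^esub> g b) = (\<Oplus>\<^bsub>P\<^esub>b\<in>T. (r \<otimes>\<^bsub>R\<^esub> d b) \<odot>\<^bsub>P\<^esub> g b)"
    if P: "module R P" and T: "finite T" "T \<subseteq> B" "\<And>b. b \<in> B \<Longrightarrow> d b \<in> carrier R"
      "\<And>b. b \<in> B \<Longrightarrow> g b \<in> carrier P" "r \<in> carrier R"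
    for P :: "('a, 'p) module" and g d r T
  proof -
    interpret P: module R P by fact
    have "r \<odot>\<^bsub>P\<^esub> (\<Oplus>\<^bsub>P\<^esub>b\<in>T. d b \<odot>\<^bsub>P\<^esub> g b) = (\<Oplus>\<^bsub>P\<^esub>b\<in>T. r \<odot>\<^bsub>P\<^esub> (d b \<odot>\<^bsub>P\<^esub> g b))"
      using T by (intro P.finsum_smult_ldistr) (auto simp: subset_iff)
    also have "\<dots> = (\<Oplus>\<^bsub>P\<^esub>b\<in>T. (r \<otimes>\<^bsub>R\<^esub> d b) \<odot>\<^bsub>P\<^esub> g b)"
      using T by (intro P.M.finsum_cong') (auto simp: P.smult_assoc1 subset_iff)
    finally show ?thesis .
  qed
  have BF: "b \<in> carrier F" if "b \<in> B" for b using B that by blast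
  \<comment> \<open>The pointwise sum of the coordinates of x and y also represents the sum of x and
    y, so uniqueness identifies it with the coordinates of that sum.\<close>
  have c_add: "c (x \<oplus>\<^bsub>F\<^esub> y) = (\<lambda>b\<in>B. c x b \<oplus>\<^bsub>R\<^esub> c y b)" (is "_ = ?e")
    if x: "x \<in> carrier F" and y: "y \<in> carrier F" for x y
  proof (rule uniq)
    let ?T = "supp B (c x) \<union> supp B (c y)"
    have T: "finite ?T" "?T \<subseteq> B" using c(2) x y by (auto simp: supp_def)
    show "?e \<in> B \<rightarrow>\<^sub>E carrier R" using cR x y by auto
    have sub: "supp B ?e \<subseteq> ?T" using cR x y by (auto simp: supp_def)
    then show "finite (supp B ?e)" using T(1) finite_subset by blast
    have "x \<oplus>\<^bsub>F\<^esub> y = (\<Oplus>\<^bsub>F\<^esub>b\<in>?T. c x b \<odot>\<^bsub>F\<^esub> b) \<oplus>\<^bsub>F\<^esub> (\<Oplus>\<^bsub>F\<^esub>b\<in>?T. c y b \<odot>\<^bsub>F\<^esub> b)"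
      using ext[OF modF T(1) _ T(2), of "c x" "\<lambda>b. b"] ext[OF modF T(1) _ T(2), of "c y" "\<lambda>b. b"]
        c(3) x y cR BF by auto
    also have "\<dots> = (\<Oplus>\<^bsub>F\<^esub>b\<in>?T. (c x b \<oplus>\<^bsub>R\<^esub> c y b) \<odot>\<^bsub>F\<^esub> b)"
      using add[OF modF T(2), of "c x" "c y" "\<lambda>b. b"] cR x y BF by auto
    also have "\<dots> = (\<Oplus>\<^bsub>F\<^esub>b\<in>?T. ?e b \<odot>\<^bsub>F\<^esub> b)"
      using T(2) cR x y BF by (intro F.M.finsum_cong') (auto simp: subset_iff)
    also have "\<dots> = (\<Oplus>\<^bsub>F\<^esub>b\<in>supp B ?e. ?e b \<odot>\<^bsub>F\<^esub> b)"
      using cR x y BF by (intro ext[OF modF T(1) sub T(2), of "\<lambda>b. b", symmetric]) auto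
    finally show "x \<oplus>\<^bsub>F\<^esub> y = \<dots>" .
  qed (use x y in simp)
  have c_smult: "c (r \<odot>\<^bsub>F\<^esub> x) = (\<lambda>b\<in>B. r \<otimes>\<^bsub>R\<^esub> c x b)" (is "_ = ?e")
    if x: "x \<in> carrier F" and r: "r \<in> carrier R" for x r
  proof (rule uniq)
    let ?T = "supp B (c x)"
    have T: "finite ?T" "?T \<subseteq> B" using c(2) x by (auto simp: supp_def)
    show "?e \<in> B \<rightarrow>\<^sub>E carrier R" using cR x r by auto
    have sub: "supp B ?e \<subseteq> ?T" using cR x r by (auto simp: supp_def)
    then show "finite (supp B ?e)" using T(1) finite_subset by blast
    have "r \<odot>\<^bsub>F\<^esub> x = r \<odot>\<^bsub>F\<^esub> (\<Oplus>\<^bsub>F\<^esub>b\<in>?T. c x b \<odot>\<^bsub>F\<^esub> b)"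
      using c(3) x by auto
    also have "\<dots> = (\<Oplus>\<^bsub>F\<^esub>b\<in>?T. (r \<otimes>\<^bsub>R\<^esub> c x b) \<odot>\<^bsub>F\<^esub> b)"
      using smult[OF modF T(1,2), of "c x" "\<lambda>b. b" r] cR x r BF by auto
    also have "\<dots> = (\<Oplus>\<^bsub>F\<^esub>b\<in>?T. ?e b \<odot>\<^bsub>F\<^esub> b)"
      using T(2) cR x r BF by (intro F.M.finsum_cong') (auto simp: subset_iff)
    also have "\<dots> = (\<Oplus>\<^bsub>F\<^esub>b\<in>supp B ?e. ?e b \<odot>\<^bsub>F\<^esub> b)"
      using cR x r BF by (intro ext[OF modF T(1) sub T(2), of "\<lambda>b. b", symmetric]) auto
    finally show "r \<odot>\<^bsub>F\<^esub> x = \<dots>" .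
  qed (use x r in simp)
  have "\<exists>m\<in>carrier M. p m = \<psi> b" if "b \<in> B" for b
    using subsetD[OF sur linear_map_closed[OF \<psi> BF[OF that]]] by auto
  then obtain g where g: "\<And>b. b \<in> B \<Longrightarrow> g b \<in> carrier M" "\<And>b. b \<in> B \<Longrightarrow> p (g b) = \<psi> b" by metis
  define \<phi> where "\<phi> x = (\<Oplus>\<^bsub>M\<^esub>b\<in>supp B (c x). c x b \<odot>\<^bsub>M\<^esub> g b)" for x
  have "linear_map R F M \<phi>"
  proof (rule linear_mapI)
    fix x assume x: "x \<in> carrier F"
    show "\<phi> x \<in> carrier M" unfolding \<phi>_def
      using cR[OF x] g by (intro M.M.finsum_closed) (auto simp: supp_def)
    fix y assume y: "y \<in> carrier F"
    let ?T = "supp B (c x) \<union> supp B (c y)" and ?e = "c (x \<oplus>\<^bsub>F\<^esub> y)"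
    have T: "finite ?T" "?T \<subseteq> B" using c(2) x y by (auto simp: supp_def)
    have sub: "supp B ?e \<subseteq> ?T" using cR x y by (auto simp: supp_def c_add)
    have "\<phi> (x \<oplus>\<^bsub>F\<^esub> y) = (\<Oplus>\<^bsub>M\<^esub>b\<in>?T. ?e b \<odot>\<^bsub>M\<^esub> g b)"
      unfolding \<phi>_def using x y g cR by (intro ext[OF M T(1) sub T(2)]) auto
    also have "\<dots> = (\<Oplus>\<^bsub>M\<^esub>b\<in>?T. (c x b \<oplus>\<^bsub>R\<^esub> c y b) \<odot>\<^bsub>M\<^esub> g b)"
      unfolding c_add[OF x y] using T(2) cR x y g by (intro M.M.finsum_cong') (auto simp: subset_iff)
    also have "\<dots> = (\<Oplus>\<^bsub>M\<^esub>b\<in>?T. c x b \<odot>\<^bsub>M\<^esub> g b) \<oplus>\<^bsub>M\<^esub> (\<Oplus>\<^bsub>M\<^esub>b\<in>?T. c y b \<odot>\<^bsub>M\<^esub> g b)"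
      using add[OF M T(2), of "c x" "c y" g] cR x y g by auto
    also have "\<dots> = \<phi> x \<oplus>\<^bsub>M\<^esub> \<phi> y"
      unfolding \<phi>_def
      using ext[OF M T(1) _ T(2), of "c x" g] ext[OF M T(1) _ T(2), of "c y" g] x y cR g by auto
    finally show "\<phi> (x \<oplus>\<^bsub>F\<^esub> y) = \<phi> x \<oplus>\<^bsub>M\<^esub> \<phi> y" .
  next
    fix r x assume r: "r \<in> carrier R" and x: "x \<in> carrier F"
    let ?T = "supp B (c x)" and ?e = "c (r \<odot>\<^bsub>F\<^esub> x)"
    have T: "finite ?T" "?T \<subseteq> B" using c(2) x by (auto simp: supp_def)
    have sub: "supp B ?e \<subseteq> ?T" using cR x r by (auto simp: supp_def c_smult)
    have "\<phi> (r \<odot>\<^bsub>F\<^esub> x) = (\<Oplus>\<^bsub>M\<^esub>b\<in>?T. ?e b \<odot>\<^bsub>M\<^esub> g b)"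
      unfolding \<phi>_def using x r g cR by (intro ext[OF M T(1) sub T(2)]) auto
    also have "\<dots> = (\<Oplus>\<^bsub>M\<^esub>b\<in>?T. (r \<otimes>\<^bsub>R\<^esub> c x b) \<odot>\<^bsub>M\<^esub> g b)"
      unfolding c_smult[OF x r] using T(2) cR x r g by (intro M.M.finsum_cong') (auto simp: subset_iff)
    also have "\<dots> = r \<odot>\<^bsub>M\<^esub> \<phi> x"
      unfolding \<phi>_def using smult[OF M T(1,2), of "c x" g r] cR x r g by auto
    finally show "\<phi> (r \<odot>\<^bsub>F\<^esub> x) = r \<odot>\<^bsub>M\<^esub> \<phi> x" .
  qed
  moreover have "p (\<phi> x) = \<psi> x" if x: "x \<in> carrier F" for x
  proof -
    let ?T = "supp B (c x)"
    have T: "finite ?T" "?T \<subseteq> B" using c(2) x by (auto simp: supp_def)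
    have "p (\<phi> x) = (\<Oplus>\<^bsub>N\<^esub>b\<in>?T. p (c x b \<odot>\<^bsub>M\<^esub> g b))"
      unfolding \<phi>_def using T cR[OF x] g by (intro linear_map_finsum[OF M N p]) auto
    also have "\<dots> = (\<Oplus>\<^bsub>N\<^esub>b\<in>?T. \<psi> (c x b \<odot>\<^bsub>F\<^esub> b))"
      using T(2) cR[OF x] g BF linear_map_closed[OF \<psi>]
      by (intro N.M.finsum_cong') (auto simp: subset_iff linear_map_smult[OF p] linear_map_smult[OF \<psi>])
    also have "\<dots> = \<psi> (\<Oplus>\<^bsub>F\<^esub>b\<in>?T. c x b \<odot>\<^bsub>F\<^esub> b)"
      using T cR[OF x] BF by (intro linear_map_finsum[OF modF N \<psi>, symmetric]) auto
    finally show ?thesis using c(3)[OF x] by simp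
  qed
  ultimately show ?thesis by blast
qed

section \<open>Cohomology\<close>

text \<open>The additive inverse of a record is chosen inside its carrier, so a record with a
  smaller carrier has a subtraction of its own. Writing the inverse as multiplication by -1 shows
  that both agree.\<close>

lemma (in module) submodule_minus:
  assumes "submodule H R M" "x \<in> H" "y \<in> H"
  shows "x \<ominus>\<^bsub>M\<lparr>carrier := H\<rparr>\<^esub> y = x \<ominus>\<^bsub>M\<^esub> y"
proof -
  interpret H: module R "M\<lparr>carrier := H\<rparr>" using submodule_module[OF module_axioms assms(1)] .
  have "y \<in> carrier M" using submoduleD(1)[OF module_axioms assms(1,3)] .
  then show ?thesis using assms by (simp add: a_minus_def neg_eq_smult H.neg_eq_smult)
qed

lemma complexesD:
  assumes "X \<in> complexes R"
  shows "module R (obj X n)" "linear_map R (obj X n) (obj X (n + 1)) (diff X n)"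
    "diff X n \<in> extensional (carrier (obj X n))"
    "x \<in> carrier (obj X n) \<Longrightarrow> diff X (n + 1) (diff X n x) = \<zero>\<^bsub>obj X (n + 1 + 1)\<^esub>"
    "diff X n \<in> module_hom R (obj X n) (obj X (n + 1))"
  using assms by (auto simp: complexes_def module_hom_iff)

text \<open>The coset is formed in the whole term of the complex, as in
  \<open>cohomology_map\<close>; shrinking the carrier to the cocycles does not change it.\<close>

definition cohomology_class :: "('a, 'b) cochain \<Rightarrow> int \<Rightarrow> 'b \<Rightarrow> 'b set" where
  "cohomology_class X n x = coboundaries X n +>\<^bsub>obj X n\<^esub> x"

lemma coset_carrier_update [simp]: "H +>\<^bsub>M\<lparr>carrier := K\<rparr>\<^esub> x = H +>\<^bsub>M\<^esub> x"
  by (simp add: a_r_coset_def')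

lemma cocycles_iff: "x \<in> cocycles X n \<longleftrightarrow> x \<in> carrier (obj X n) \<and> diff X n x = \<zero>\<^bsub>obj X (n + 1)\<^esub>"
  by (simp add: cocycles_def a_kernel_iff)

text \<open>In degree \<open>n + 1\<close> the incoming differential is \<open>diff X n\<close>,
  with no subtraction in the index. The exactness statements for cones are phrased in degree
  \<open>n + 1\<close> for this reason.\<close>

lemma coboundaries_Suc: "coboundaries X (n + 1) = diff X n ` carrier (obj X n)"
  by (simp add: coboundaries_def)

context
  fixes R :: "('a, 'r) ring_scheme" and X :: "('a, 'b) cochain" and n :: int
  assumes X: "X \<in> complexes R"
begin

lemma submodule_cocycles: "submodule (cocycles X n) R (obj X n)"
  unfolding cocycles_def
  by (rule submodule_kernel[OF complexesD(1)[OF X] complexesD(1)[OF X] complexesD(2)[OF X]])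

lemma submodule_coboundaries: "submodule (coboundaries X n) R (obj X n)"
  using submodule_range[OF complexesD(1)[OF X] complexesD(1)[OF X] complexesD(2)[OF X], of "n - 1"]
  by (simp add: coboundaries_def)

lemma coboundaries_subset: "coboundaries X n \<subseteq> cocycles X n"
  using complexesD(4)[OF X, of _ "n - 1"] submoduleD(1)[OF complexesD(1)[OF X] submodule_coboundaries]
  by (auto simp: coboundaries_def cocycles_iff)

lemma module_cocycles: "module R ((obj X n)\<lparr>carrier := cocycles X n\<rparr>)"
  by (rule submodule_module[OF complexesD(1)[OF X] submodule_cocycles])

lemma coboundaries_in_cocycles: "submodule (coboundaries X n) R ((obj X n)\<lparr>carrier := cocycles X n\<rparr>)"
  unfolding submodule_of_submodule[OF complexesD(1)[OF X] submodule_cocycles]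
  by (intro conjI submodule_coboundaries coboundaries_subset)

lemma module_cohomology: "module R (cohomology X n)"
  unfolding cohomology_def by (rule quotient_is_module[OF module_cocycles coboundaries_in_cocycles])

lemma cohomology_cases:
  assumes "\<xi> \<in> carrier (cohomology X n)"
  obtains x where "x \<in> cocycles X n" "\<xi> = cohomology_class X n x"
proof (rule quotient_cases[OF module_cocycles coboundaries_in_cocycles])
  show "\<xi> \<in> carrier (quotient_module ((obj X n)\<lparr>carrier := cocycles X n\<rparr>) (coboundaries X n))"
    using assms by (simp add: cohomology_def)
qed (use that in \<open>simp add: cohomology_class_def\<close>)

lemma cohomology_class_closed:
  "x \<in> cocycles X n \<Longrightarrow> cohomology_class X n x \<in> carrier (cohomology X n)"
  using coset_closed[OF module_cocycles coboundaries_in_cocycles]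
  unfolding cohomology_def cohomology_class_def by simp

lemma cohomology_class_eq_iff:
  "x \<in> cocycles X n \<Longrightarrow> y \<in> cocycles X n \<Longrightarrow>
   cohomology_class X n x = cohomology_class X n y \<longleftrightarrow> x \<ominus>\<^bsub>obj X n\<^esub> y \<in> coboundaries X n"
  using coset_eq_iff[OF module_cocycles coboundaries_in_cocycles]
    module.submodule_minus[OF complexesD(1)[OF X] submodule_cocycles]
  unfolding cohomology_class_def by simp

lemma cohomology_class_zero_iff:
  "x \<in> cocycles X n \<Longrightarrow> cohomology_class X n x = \<zero>\<^bsub>cohomology X n\<^esub> \<longleftrightarrow> x \<in> coboundaries X n"
  using coset_zero_iff[OF module_cocycles coboundaries_in_cocycles]
  unfolding cohomology_def cohomology_class_def by simp

end

text \<open>A chain map without extensionality and between possibly different element types: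
  postcomposition on Hom complexes changes the type, and the projection of a direct sum is used
  unrestricted.\<close>

definition chain_linear ::
    "('a, 'r) ring_scheme \<Rightarrow> ('a, 'b) cochain \<Rightarrow> ('a, 'c) cochain \<Rightarrow> (int \<Rightarrow> 'b \<Rightarrow> 'c) \<Rightarrow> bool" where
  "chain_linear R X Y f \<longleftrightarrow> (\<forall>n. linear_map R (obj X n) (obj Y n) (f n) \<and>
     (\<forall>x\<in>carrier (obj X n). f (n + 1) (diff X n x) = diff Y n (f n x)))"

lemma chain_linearD:
  assumes "chain_linear R X Y f"
  shows "linear_map R (obj X n) (obj Y n) (f n)"
    "x \<in> carrier (obj X n) \<Longrightarrow> f (n + 1) (diff X n x) = diff Y n (f n x)"
  using assms by (auto simp: chain_linear_def)

definition induced_map ::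
    "('a, 'b) cochain \<Rightarrow> ('a, 'c) cochain \<Rightarrow> (int \<Rightarrow> 'b \<Rightarrow> 'c) \<Rightarrow> int \<Rightarrow> 'b set \<Rightarrow> 'c set" where
  "induced_map X Y f n =
     quotient_map ((obj X n)\<lparr>carrier := cocycles X n\<rparr>) (coboundaries X n)
       ((obj Y n)\<lparr>carrier := cocycles Y n\<rparr>) (coboundaries Y n) (f n)"

context
  fixes R :: "('a, 'r) ring_scheme" and X :: "('a, 'b) cochain" and Y :: "('a, 'c) cochain"
    and f :: "int \<Rightarrow> 'b \<Rightarrow> 'c" and n :: int
  assumes X: "X \<in> complexes R" and Y: "Y \<in> complexes R" and f: "chain_linear R X Y f"
begin

lemma chain_cocycles: "x \<in> cocycles X n \<Longrightarrow> f n x \<in> cocycles Y n"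
  using chain_linearD(2)[OF f, of x n, symmetric]
  by (simp add: cocycles_iff linear_map_closed[OF chain_linearD(1)[OF f]]
      linear_map_zero[OF complexesD(1)[OF X] complexesD(1)[OF Y] chain_linearD(1)[OF f]])

lemma chain_coboundaries: "f n ` coboundaries X n \<subseteq> coboundaries Y n"
proof -
  have "f n (diff X (n - 1) x) = diff Y (n - 1) (f (n - 1) x)" if "x \<in> carrier (obj X (n - 1))" for x
    using chain_linearD(2)[OF f that] by simp
  then show ?thesis
    using linear_map_closed[OF chain_linearD(1)[OF f]] by (auto simp: coboundaries_def)
qed

lemma chain_linear_cocycles:
  "linear_map R ((obj X n)\<lparr>carrier := cocycles X n\<rparr>) ((obj Y n)\<lparr>carrier := cocycles Y n\<rparr>) (f n)"
  using chain_linearD(1)[OF f, of n] chain_cocycles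
  by (auto simp: linear_map_def cocycles_iff)

lemma induced_map_class:
  "x \<in> cocycles X n \<Longrightarrow> induced_map X Y f n (cohomology_class X n x) = cohomology_class Y n (f n x)"
  using quotient_map_coset[OF module_cocycles[OF X] coboundaries_in_cocycles[OF X]
    module_cocycles[OF Y] coboundaries_in_cocycles[OF Y] chain_linear_cocycles chain_coboundaries]
  unfolding induced_map_def cohomology_class_def by simp

lemma induced_map_linear:
  "linear_map R (cohomology X n) (cohomology Y n) (induced_map X Y f n)"
  using quotient_map_linear[OF module_cocycles[OF X] coboundaries_in_cocycles[OF X]
    module_cocycles[OF Y] coboundaries_in_cocycles[OF Y] chain_linear_cocycles chain_coboundaries]
  unfolding induced_map_def cohomology_def by simp

end

lemma chain_maps_linear: "f \<in> chain_maps R X Y \<Longrightarrow> chain_linear R X Y f"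
  by (auto simp: chain_maps_def chain_linear_def module_hom_iff)

text \<open>\<open>quotient_map\<close> was written as the same union of cosets as
  \<open>cohomology_map\<close>, so everything proved for induced maps applies to the maps in the
  definition of quasi-isomorphisms.\<close>

lemma cohomology_map_eq: "cohomology_map X Y f n = induced_map X Y f n"
  by (simp add: cohomology_map_def induced_map_def quotient_map_def cohomology_def)

section \<open>Transport of structure\<close>

text \<open>The structure that makes the injection \<open>g\<close> an isomorphism onto its image.
  It moves modules into the element type that a definition or a hypothesis prescribes.\<close>

definition transport_module :: "('b \<Rightarrow> 'c) \<Rightarrow> ('a, 'b) module \<Rightarrow> ('a, 'c) module" where
  "transport_module g M = \<lparr>carrier = g ` carrier M,
     monoid.mult = undefined, monoid.one = undefined,
     ring.zero = g \<zero>\<^bsub>M\<^esub>,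
     ring.add = (\<lambda>x y. g (inv_into (carrier M) g x \<oplus>\<^bsub>M\<^esub> inv_into (carrier M) g y)),
     module.smult = (\<lambda>r x. g (r \<odot>\<^bsub>M\<^esub> inv_into (carrier M) g x))\<rparr>"

lemma transport_module:
  assumes M: "module R M" and g: "inj_on g (carrier M)"
  shows module_transport: "module R (transport_module g M)"
    and transport_linear: "linear_map R M (transport_module g M) g"
    and transport_bij: "bij_betw g (carrier M) (carrier (transport_module g M))"
proof -
  interpret M: module R M by fact
  let ?T = "transport_module g M"
  have simps: "carrier ?T = g ` carrier M" "\<zero>\<^bsub>?T\<^esub> = g \<zero>\<^bsub>M\<^esub>"
    "\<And>x y. x \<in> carrier M \<Longrightarrow> y \<in> carrier M \<Longrightarrow> g x \<oplus>\<^bsub>?T\<^esub> g y = g (x \<oplus>\<^bsub>M\<^esub> y)"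
    "\<And>r x. x \<in> carrier M \<Longrightarrow> r \<odot>\<^bsub>?T\<^esub> g x = g (r \<odot>\<^bsub>M\<^esub> x)"
    using g by (auto simp: transport_module_def)
  show "linear_map R M ?T g" by (rule linear_mapI) (auto simp: simps)
  show "bij_betw g (carrier M) (carrier ?T)" using g by (simp add: bij_betw_def simps)
  show "module R ?T"
  proof (rule moduleI)
    show "abelian_group ?T"
    proof (rule abelian_groupI)
      fix x assume "x \<in> carrier ?T"
      then obtain a where a: "a \<in> carrier M" "x = g a" by (auto simp: simps)
      then have "g (\<ominus>\<^bsub>M\<^esub> a) \<oplus>\<^bsub>?T\<^esub> x = \<zero>\<^bsub>?T\<^esub>" by (simp add: simps M.M.l_neg)
      then show "\<exists>y\<in>carrier ?T. y \<oplus>\<^bsub>?T\<^esub> x = \<zero>\<^bsub>?T\<^esub>" using a by (auto simp: simps(1))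
    qed (auto simp: simps M.M.a_ac)
  qed (auto simp: simps M.smult_l_distr M.smult_r_distr M.smult_assoc1 M.R.is_cring)
qed

section \<open>Free resolutions\<close>

text \<open>Over a finite basis, terms with coefficient zero can be added to a sum without changing
  it, so the finite supports in \<open>free_module\<close> can be replaced by the whole
  basis.\<close>

lemma finite_basis_free:
  assumes F: "module R F" and B: "B \<subseteq> carrier F" "finite B"
    and ex1: "\<And>x. x \<in> carrier F \<Longrightarrow> \<exists>!c. c \<in> B \<rightarrow>\<^sub>E carrier R \<and> x = (\<Oplus>\<^bsub>F\<^esub>b\<in>B. c b \<odot>\<^bsub>F\<^esub> b)"
  shows "free_module R F \<and> finitely_generated R F"
proof
  interpret F: module R F by fact
  have eq: "(\<Oplus>\<^bsub>F\<^esub>b\<in>{b \<in> B. c b \<noteq> \<zero>\<^bsub>R\<^esub>}. c b \<odot>\<^bsub>F\<^esub> b) = (\<Oplus>\<^bsub>F\<^esub>b\<in>B. c b \<odot>\<^bsub>F\<^esub> b)"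
    if "c \<in> B \<rightarrow>\<^sub>E carrier R" for c
    using that B by (intro F.M.add.finprod_mono_neutral_cong_left) auto
  show "free_module R F" unfolding free_module_def
  proof (intro conjI F exI[of _ B] ballI B)
    fix x assume "x \<in> carrier F"
    from ex1[OF this] B(2) eq
    show "\<exists>!c. c \<in> B \<rightarrow>\<^sub>E carrier R \<and> finite {b \<in> B. c b \<noteq> \<zero>\<^bsub>R\<^esub>} \<and>
      x = (\<Oplus>\<^bsub>F\<^esub>b\<in>{b \<in> B. c b \<noteq> \<zero>\<^bsub>R\<^esub>}. c b \<odot>\<^bsub>F\<^esub> b)"
      by (simp cong: conj_cong)
  qed
  show "finitely_generated R F" unfolding finitely_generated_def
  proof (intro exI[of _ B] conjI ballI B)
    fix x assume "x \<in> carrier F"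
    from ex1[OF this] show "\<exists>c\<in>B \<rightarrow> carrier R. x = (\<Oplus>\<^bsub>F\<^esub>s\<in>B. c s \<odot>\<^bsub>F\<^esub> s)"
      by (auto simp: PiE_def)
  qed
qed

text \<open>The delta functions on a finite set are pairwise distinct only when 1 differs from 0.
  This settles the zero ring, over which every module is zero and has the empty basis.\<close>

lemma trivial_ring_free:
  assumes F: "module R F" and R: "\<one>\<^bsub>R\<^esub> = \<zero>\<^bsub>R\<^esub>"
  shows "free_module R F \<and> finitely_generated R F"
proof (rule finite_basis_free[OF F, of "{}"])
  interpret F: module R F by fact
  fix x assume x: "x \<in> carrier F"
  have "x = \<zero>\<^bsub>F\<^esub>" using F.smult_one[OF x] F.smult_l_null[OF x] unfolding R by simp
  then show "\<exists>!c. c \<in> {} \<rightarrow>\<^sub>E carrier R \<and> x = (\<Oplus>\<^bsub>F\<^esub>b\<in>{}. c b \<odot>\<^bsub>F\<^esub> b)" by simp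
qed auto

section \<open>Finite free modules as modules of functions\<close>

definition function_module :: "('a, 'r) ring_scheme \<Rightarrow> 's set \<Rightarrow> ('a, 's \<Rightarrow> 'a) module" where
  "function_module R S = \<lparr>carrier = S \<rightarrow>\<^sub>E carrier R,
     monoid.mult = undefined, monoid.one = undefined,
     ring.zero = (\<lambda>s\<in>S. \<zero>\<^bsub>R\<^esub>),
     ring.add = (\<lambda>f g. \<lambda>s\<in>S. f s \<oplus>\<^bsub>R\<^esub> g s),
     module.smult = (\<lambda>r f. \<lambda>s\<in>S. r \<otimes>\<^bsub>R\<^esub> f s)\<rparr>"

lemma module_function_module:
  assumes "cring R"
  shows "module R (function_module R S)"
proof (rule moduleI)
  interpret R: cring R by fact
  let ?F = "function_module R S"
  show "abelian_group ?F"
  proof (rule abelian_groupI)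
    fix f assume f: "f \<in> carrier ?F"
    show "\<exists>g\<in>carrier ?F. g \<oplus>\<^bsub>?F\<^esub> f = \<zero>\<^bsub>?F\<^esub>"
      using f by (intro bexI[of _ "\<lambda>s\<in>S. \<ominus>\<^bsub>R\<^esub> f s"])
        (auto simp: function_module_def R.l_neg PiE_iff intro!: restrict_ext)
  next
    fix f assume f: "f \<in> carrier ?F"
    show "\<zero>\<^bsub>?F\<^esub> \<oplus>\<^bsub>?F\<^esub> f = f"
      using f by (auto simp: function_module_def PiE_iff fun_eq_iff extensional_def)
  qed (auto simp: function_module_def R.a_ac PiE_iff intro!: restrict_ext)
next
  interpret R: cring R by fact
  fix f assume f: "f \<in> carrier (function_module R S)"
  show "\<one>\<^bsub>R\<^esub> \<odot>\<^bsub>function_module R S\<^esub> f = f"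
    using f by (auto simp: function_module_def PiE_iff fun_eq_iff extensional_def)
next
  interpret R: cring R by fact
  show "cring R" by fact
qed (use cring.axioms(1)[OF assms] in \<open>auto simp: function_module_def PiE_iff ring.ring_simprules intro!: restrict_ext\<close>)

lemma module_ring_as_module:
  assumes "cring R"
  shows "module R (ring_as_module R)"
proof (rule moduleI)
  interpret R: cring R by fact
  show "abelian_group (ring_as_module R)"
  proof (rule abelian_groupI)
    fix x assume "x \<in> carrier (ring_as_module R)"
    then show "\<exists>y\<in>carrier (ring_as_module R). y \<oplus>\<^bsub>ring_as_module R\<^esub> x = \<zero>\<^bsub>ring_as_module R\<^esub>"
      by (auto simp: ring_as_module_def intro!: bexI[of _ "\<ominus>\<^bsub>R\<^esub> x"] R.l_neg)
  qed (auto simp: ring_as_module_def R.a_ac)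
qed (use assms cring.axioms(1)[OF assms] in \<open>auto simp: ring_as_module_def ring.ring_simprules\<close>)

text \<open>Finite tuples of scalars as nested pairs with a scalar as end mark. It places the
  elements of a finite free module in \<open>univ\<close>, whatever the type \<open>'i\<close> of
  atoms.\<close>

primrec list_univ :: "'a list \<Rightarrow> ('a, 'i) univ" where
  "list_univ [] = Scalar undefined"
| "list_univ (x # xs) = UPair (Scalar x) (list_univ xs)"

lemma list_univ_inject: "list_univ xs = list_univ ys \<longleftrightarrow> xs = ys"
proof (induction xs arbitrary: ys)
  case Nil
  then show ?case by (cases ys) auto
next
  case (Cons x xs)
  then show ?case by (cases ys) auto
qed

lemma finite_functions_inject_univ:
  assumes "finite S"
  shows "\<exists>g :: ('s \<Rightarrow> 'a) \<Rightarrow> ('a, 'i) univ. inj_on g (S \<rightarrow>\<^sub>E A)"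
proof -
  obtain xs where xs: "set xs = S" using finite_list[OF assms] by blast
  have "inj_on (\<lambda>f. list_univ (map f xs) :: ('a, 'i) univ) (S \<rightarrow>\<^sub>E A)"
    by (rule inj_onI) (auto simp: list_univ_inject xs intro: PiE_ext)
  then show ?thesis by blast
qed

text \<open>Evaluation at a point is linear, so the claim reduces to a sum in the ring itself with a
  single nonzero term.\<close>

lemma function_module_basis:
  assumes R: "cring R" and S: "finite S" and c: "c \<in> S \<rightarrow>\<^sub>E carrier R"
  shows "(\<Oplus>\<^bsub>function_module R S\<^esub>s\<in>S. c s \<odot>\<^bsub>function_module R S\<^esub> (\<lambda>t\<in>S. if t = s then \<one>\<^bsub>R\<^esub> else \<zero>\<^bsub>R\<^esub>)) = c"
    (is "finsum ?F ?b S = c")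
proof -
  interpret R: cring R by fact
  interpret F: module R ?F by (rule module_function_module[OF R])
  interpret A: module R "ring_as_module R" by (rule module_ring_as_module[OF R])
  have b: "?b \<in> S \<rightarrow> carrier ?F" using c by (auto simp: function_module_def PiE_iff)
  have cl: "finsum ?F ?b S \<in> carrier ?F" by (rule F.M.finsum_closed[OF b])
  show ?thesis
  proof (rule PiE_ext[of _ S "\<lambda>_. carrier R" c])
    show "finsum ?F ?b S \<in> S \<rightarrow>\<^sub>E carrier R" using cl by (simp add: function_module_def)
    show "c \<in> S \<rightarrow>\<^sub>E carrier R" by fact
    fix t assume t: "t \<in> S"
    have ev: "linear_map R ?F (ring_as_module R) (\<lambda>f. f t)"
      using t by (intro linear_mapI) (auto simp: function_module_def ring_as_module_def)
    have "finsum ?F ?b S t = (\<Oplus>\<^bsub>ring_as_module R\<^esub>s\<in>S. ?b s t)"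
      by (rule linear_map_finsum[OF F.module_axioms A.module_axioms ev S b])
    also have "\<dots> = (\<Oplus>\<^bsub>ring_as_module R\<^esub>s\<in>S. if t = s then c s else \<zero>\<^bsub>ring_as_module R\<^esub>)"
      using t c by (intro A.M.finsum_cong')
        (auto simp: function_module_def ring_as_module_def PiE_iff)
    also have "\<dots> = c t"
      using t S c by (intro A.M.finsum_singleton) (auto simp: ring_as_module_def)
    finally show "finsum ?F ?b S t = c t" .
  qed
qed

text \<open>The basis consists of the transported delta functions, and the coordinates of
  \<open>g c\<close> are the values of \<open>c\<close>.\<close>

lemma free_function_module:
  fixes g :: "('s \<Rightarrow> 'a) \<Rightarrow> 'c"
  assumes R: "cring R" and S: "finite S" and g: "inj_on g (S \<rightarrow>\<^sub>E carrier R)"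
  shows "free_module R (transport_module g (function_module R S)) \<and>
    finitely_generated R (transport_module g (function_module R S))"
proof (cases "\<one>\<^bsub>R\<^esub> = \<zero>\<^bsub>R\<^esub>")
  case True
  have "inj_on g (carrier (function_module R S))" using g by (simp add: function_module_def)
  then show ?thesis
    using trivial_ring_free[OF module_transport True] module_function_module[OF R] by blast
next
  case False
  interpret R: cring R by fact
  let ?F = "function_module R S"
  let ?T = "transport_module g ?F"
  have carF: "carrier ?F = S \<rightarrow>\<^sub>E carrier R" by (simp add: function_module_def)
  have injF: "inj_on g (carrier ?F)" using g by (simp add: carF)
  note T = transport_module[OF module_function_module[OF R] injF]
  interpret F: module R ?F by (rule module_function_module[OF R])
  interpret T: module R ?T by (rule T(1))
  define \<delta> where "\<delta> s = (\<lambda>t\<in>S. if t = s then \<one>\<^bsub>R\<^esub> else \<zero>\<^bsub>R\<^esub>)" for s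
  define e where "e s = g (\<delta> s)" for s
  have \<delta>: "\<delta> s \<in> carrier ?F" for s by (auto simp: \<delta>_def carF)
  have e: "e s \<in> carrier ?T" for s
    using linear_map_closed[OF T(2) \<delta>] by (simp add: e_def)
  have inj: "inj_on e S"
  proof (rule inj_onI)
    fix s t assume st: "s \<in> S" "t \<in> S" "e s = e t"
    then have "\<delta> s = \<delta> t" using inj_onD[OF injF] \<delta> by (simp add: e_def)
    then have "\<delta> s s = \<delta> t s" by simp
    then show "s = t" using st False by (simp add: \<delta>_def split: if_splits)
  qed
  have sum: "(\<Oplus>\<^bsub>?T\<^esub>b\<in>e ` S. d b \<odot>\<^bsub>?T\<^esub> b) = g (\<lambda>s\<in>S. d (e s))"
    if d: "d \<in> e ` S \<rightarrow>\<^sub>E carrier R" for d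
  proof -
    have dR: "d (e s) \<in> carrier R" if "s \<in> S" for s using d that by auto
    have "(\<Oplus>\<^bsub>?T\<^esub>b\<in>e ` S. d b \<odot>\<^bsub>?T\<^esub> b) = (\<Oplus>\<^bsub>?T\<^esub>s\<in>S. d (e s) \<odot>\<^bsub>?T\<^esub> e s)"
      using dR e inj by (intro T.M.finsum_reindex) auto
    also have "\<dots> = (\<Oplus>\<^bsub>?T\<^esub>s\<in>S. g (d (e s) \<odot>\<^bsub>?F\<^esub> \<delta> s))"
      using dR e linear_map_closed[OF T(2)] \<delta>
      by (intro T.M.finsum_cong') (auto simp: linear_map_smult[OF T(2)] e_def)
    also have "\<dots> = g (\<Oplus>\<^bsub>?F\<^esub>s\<in>S. d (e s) \<odot>\<^bsub>?F\<^esub> \<delta> s)"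
      using dR \<delta> by (intro linear_map_finsum[OF F.module_axioms T(1,2) S, symmetric]) auto
    also have "(\<Oplus>\<^bsub>?F\<^esub>s\<in>S. d (e s) \<odot>\<^bsub>?F\<^esub> \<delta> s) = (\<Oplus>\<^bsub>?F\<^esub>s\<in>S. (\<lambda>s\<in>S. d (e s)) s \<odot>\<^bsub>?F\<^esub> \<delta> s)"
      using dR \<delta> by (intro F.M.finsum_cong') auto
    also have "\<dots> = (\<lambda>s\<in>S. d (e s))"
      unfolding \<delta>_def using dR by (intro function_module_basis[OF R S]) auto
    finally show ?thesis .
  qed
  show ?thesis
  proof (rule finite_basis_free[OF T(1), of "e ` S"])
    show "e ` S \<subseteq> carrier ?T" "finite (e ` S)" using e S by auto
    fix x assume "x \<in> carrier ?T"
    then obtain c where c: "c \<in> S \<rightarrow>\<^sub>E carrier R" "x = g c"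
      by (auto simp: transport_module_def carF)
    show "\<exists>!d. d \<in> e ` S \<rightarrow>\<^sub>E carrier R \<and> x = (\<Oplus>\<^bsub>?T\<^esub>b\<in>e ` S. d b \<odot>\<^bsub>?T\<^esub> b)"
    proof (rule ex1I)
      let ?d = "\<lambda>b\<in>e ` S. c (inv_into S e b)"
      have d: "?d \<in> e ` S \<rightarrow>\<^sub>E carrier R" using c(1) inj by auto
      have "(\<lambda>s\<in>S. ?d (e s)) = c" using c(1) inj by (auto simp: fun_eq_iff PiE_iff extensional_def)
      then show "?d \<in> e ` S \<rightarrow>\<^sub>E carrier R \<and> x = (\<Oplus>\<^bsub>?T\<^esub>b\<in>e ` S. ?d b \<odot>\<^bsub>?T\<^esub> b)"
        using sum[OF d] c(2) d by simp
      fix d' assume d': "d' \<in> e ` S \<rightarrow>\<^sub>E carrier R \<and> x = (\<Oplus>\<^bsub>?T\<^esub>b\<in>e ` S. d' b \<odot>\<^bsub>?T\<^esub> b)"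
      then have "g (\<lambda>s\<in>S. d' (e s)) = g c" using sum c(2) by simp
      moreover have "(\<lambda>s\<in>S. d' (e s)) \<in> S \<rightarrow>\<^sub>E carrier R" using d' by auto
      ultimately have eq: "(\<lambda>s\<in>S. d' (e s)) = c" using inj_onD[OF g] c(1) by blast
      show "d' = ?d"
      proof (rule PiE_ext[of _ "e ` S" "\<lambda>_. carrier R"])
        fix b assume "b \<in> e ` S"
        then obtain s where s: "s \<in> S" "b = e s" by blast
        then show "d' b = ?d b" using fun_cong[OF eq, of s] inj by simp
      qed (use d d' in auto)
    qed
  qed
qed

text \<open>A finite generating set S gives a map from the functions on S onto \<open>K\<close>, and
  these functions are coded in \<open>univ\<close>. The type of atoms is independent of the elements
  of \<open>K\<close>, so that covers of kernels of covers stay in one type.\<close>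

lemma free_cover:
  fixes K :: "('a, 'b) module"
  assumes K: "module R K" and fg: "finitely_generated R K"
  shows "\<exists>(F :: ('a, ('a, 'i) univ) module) p. free_module R F \<and> finitely_generated R F \<and>
    linear_map R F K p \<and> p ` carrier F = carrier K"
proof -
  interpret K: module R K by fact
  obtain S where S: "S \<subseteq> carrier K" "finite S"
    "\<And>x. x \<in> carrier K \<Longrightarrow> \<exists>c\<in>S \<rightarrow> carrier R. x = (\<Oplus>\<^bsub>K\<^esub>s\<in>S. c s \<odot>\<^bsub>K\<^esub> s)"
    using fg unfolding finitely_generated_def by blast
  obtain g :: "('b \<Rightarrow> 'a) \<Rightarrow> ('a, 'i) univ" where g: "inj_on g (S \<rightarrow>\<^sub>E carrier R)"
    using finite_functions_inject_univ[OF S(2)] by blast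
  let ?F = "function_module R S"
  let ?T = "transport_module g ?F"
  have carF: "carrier ?F = S \<rightarrow>\<^sub>E carrier R" by (simp add: function_module_def)
  have injF: "inj_on g (carrier ?F)" using g by (simp add: carF)
  note F = module_function_module[OF K.R.is_cring, of S]
  note T = transport_module[OF F injF]
  let ?\<phi> = "\<lambda>c. \<Oplus>\<^bsub>K\<^esub>s\<in>S. c s \<odot>\<^bsub>K\<^esub> s"
  have \<phi>: "linear_map R ?F K ?\<phi>"
  proof (rule linear_mapI)
    fix c assume c: "c \<in> carrier ?F"
    have cl: "c s \<in> carrier R" "s \<in> carrier K" if "s \<in> S" for s using that c S(1) by (auto simp: carF)
    then show "?\<phi> c \<in> carrier K" by (intro K.M.finsum_closed) auto
    fix d assume d: "d \<in> carrier ?F"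
    have dl: "d s \<in> carrier R" if "s \<in> S" for s using that d by (auto simp: carF)
    have "?\<phi> (c \<oplus>\<^bsub>?F\<^esub> d) = (\<Oplus>\<^bsub>K\<^esub>s\<in>S. c s \<odot>\<^bsub>K\<^esub> s \<oplus>\<^bsub>K\<^esub> d s \<odot>\<^bsub>K\<^esub> s)"
      using cl dl by (intro K.M.finsum_cong') (auto simp: function_module_def K.smult_l_distr)
    also have "\<dots> = ?\<phi> c \<oplus>\<^bsub>K\<^esub> ?\<phi> d" using cl dl by (intro K.M.finsum_addf) auto
    finally show "?\<phi> (c \<oplus>\<^bsub>?F\<^esub> d) = ?\<phi> c \<oplus>\<^bsub>K\<^esub> ?\<phi> d" .
  next
    fix r c assume r: "r \<in> carrier R" and c: "c \<in> carrier ?F"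
    have cl: "c s \<in> carrier R" "s \<in> carrier K" if "s \<in> S" for s using that c S(1) by (auto simp: carF)
    have "?\<phi> (r \<odot>\<^bsub>?F\<^esub> c) = (\<Oplus>\<^bsub>K\<^esub>s\<in>S. r \<odot>\<^bsub>K\<^esub> (c s \<odot>\<^bsub>K\<^esub> s))"
      using cl r by (intro K.M.finsum_cong') (auto simp: function_module_def K.smult_assoc1)
    also have "\<dots> = r \<odot>\<^bsub>K\<^esub> ?\<phi> c" using cl r S(2) by (intro K.finsum_smult_ldistr[symmetric]) auto
    finally show "?\<phi> (r \<odot>\<^bsub>?F\<^esub> c) = r \<odot>\<^bsub>K\<^esub> ?\<phi> c" .
  qed
  have \<phi>sur: "?\<phi> ` carrier ?F = carrier K"
  proof
    show "?\<phi> ` carrier ?F \<subseteq> carrier K" using linear_map_closed[OF \<phi>] by blast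
    show "carrier K \<subseteq> ?\<phi> ` carrier ?F"
    proof
      fix x assume "x \<in> carrier K"
      then obtain c where c: "c \<in> S \<rightarrow> carrier R" "x = ?\<phi> c" using S(3) by blast
      have "?\<phi> c = ?\<phi> (restrict c S)"
        using c(1) S(1) by (intro K.M.finsum_cong') (auto simp: Pi_iff subset_iff)
      then show "x \<in> ?\<phi> ` carrier ?F" using c by (intro image_eqI[of _ _ "restrict c S"]) (auto simp: carF)
    qed
  qed
  let ?h = "inv_into (carrier ?F) g"
  have h: "linear_map R ?T ?F ?h" by (rule linear_map_inv_into[OF F T(2,3)])
  have hsur: "?h ` carrier ?T = carrier ?F"
    using bij_betw_imp_surj_on[OF bij_betw_inv_into[OF T(3)]] .
  have "linear_map R ?T K (\<lambda>x. ?\<phi> (?h x))" by (rule linear_map_comp[OF h \<phi>])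
  moreover have "(\<lambda>x. ?\<phi> (?h x)) ` carrier ?T = carrier K"
    using \<phi>sur hsur image_image[of ?\<phi> ?h "carrier ?T"] by metis
  ultimately show ?thesis using free_function_module[OF K.R.is_cring S(2) g] by blast
qed

text \<open>Each kernel is a submodule of a finitely generated module over a noetherian ring, hence
  again finitely generated, and \<open>free_cover\<close> can be applied to it without leaving the
  type.\<close>

lemma free_resolution_exists:
  fixes N :: "('a, 'n) module"
  assumes R: "noetherian_ring R" and N: "module R N" and fg: "finitely_generated R N"
  shows "\<exists>(F :: ('a, ('a, 'n) univ) cochain) \<epsilon>. free_resolution R N F \<epsilon>"
proof -
  obtain F0 :: "('a, ('a, 'n) univ) module" and p where
    F0: "free_module R F0" "finitely_generated R F0" "linear_map R F0 N p" "p ` carrier F0 = carrier N"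
    using free_cover[OF N fg] by blast
  have mod: "module R F" if "free_module R F" for F :: "('a, ('a, 'n) univ) module"
    using that by (simp add: free_module_def)
  \<comment> \<open>A state is a free module together with the submodule onto which the next
    differential must map. The clause at 0 fixes the start, since dependent choice by itself only
    provides some state that satisfies \<open>P 0\<close>.\<close>
  define P where "P n x \<longleftrightarrow> free_module R (fst x) \<and> finitely_generated R (fst x) \<and>
    submodule (snd x) R (fst x) \<and> (n = (0::nat) \<longrightarrow> x = (F0, a_kernel F0 N p))" for n x
  define Q where "Q n x y \<longleftrightarrow> (\<exists>d. linear_map R (fst y) (fst x) d \<and> d ` carrier (fst y) = snd x \<and>
    snd y = a_kernel (fst y) (fst x) d)" for n :: nat and x y :: "('a, ('a, 'n) univ) module \<times> ('a, 'n) univ set"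
  have "\<exists>f. \<forall>n. P n (f n) \<and> Q n (f n) (f (Suc n))"
  proof (rule dependent_nat_choice)
    have "P 0 (F0, a_kernel F0 N p)"
      using F0 submodule_kernel[OF mod[OF F0(1)] N F0(3)] by (simp add: P_def)
    then show "\<exists>x. P 0 x" ..
    fix x n assume "P n x"
    then obtain F K where x: "x = (F, K)" and F: "free_module R F" "finitely_generated R F" "submodule K R F"
      by (cases x) (auto simp: P_def)
    note FM = mod[OF F(1)]
    note KM = submodule_module[OF FM F(3)]
    obtain F' :: "('a, ('a, 'n) univ) module" and d where
      F': "free_module R F'" "finitely_generated R F'" "linear_map R F' (F\<lparr>carrier := K\<rparr>) d"
        "d ` carrier F' = carrier (F\<lparr>carrier := K\<rparr>)"
      using free_cover[OF KM noetherian_submodule[OF R FM F(2,3)]] by blast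
    have "linear_map R F' F d"
      using F'(3) submoduleD(1)[OF FM F(3)] by (auto simp: linear_map_def)
    then have "P (Suc n) (F', a_kernel F' F d) \<and> Q n x (F', a_kernel F' F d)"
      using F' x submodule_kernel[OF mod[OF F'(1)] FM] by (auto simp: P_def Q_def)
    then show "\<exists>y. P (Suc n) y \<and> Q n x y" ..
  qed
  then obtain f where f: "\<And>n. P n (f n)" "\<And>n. Q n (f n) (f (Suc n))" by blast
  define Fs where "Fs n = fst (f n)" for n
  define K where "K n = snd (f n)" for n
  have Fs: "free_module R (Fs n)" "submodule (K n) R (Fs n)" for n
    using f(1)[of n] by (auto simp: Fs_def K_def P_def)
  have zero: "Fs 0 = F0" "K 0 = a_kernel F0 N p"
    using f(1)[of 0] by (auto simp: Fs_def K_def P_def)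
  have "\<forall>n. \<exists>d. linear_map R (Fs (Suc n)) (Fs n) d \<and> d ` carrier (Fs (Suc n)) = K n \<and>
    K (Suc n) = a_kernel (Fs (Suc n)) (Fs n) d"
    using f(2) by (auto simp: Fs_def K_def Q_def)
  then obtain d where d: "\<And>n. linear_map R (Fs (Suc n)) (Fs n) (d n)"
    "\<And>n. d n ` carrier (Fs (Suc n)) = K n" "\<And>n. K (Suc n) = a_kernel (Fs (Suc n)) (Fs n) (d n)"
    by metis
  note FsM = mod[OF Fs(1)]
  \<comment> \<open>Positive degrees need a zero module on the same element type; the zero submodule
    of \<open>F0\<close> is one.\<close>
  define Z where "Z = F0\<lparr>carrier := {\<zero>\<^bsub>F0\<^esub>}\<rparr>"
  have Z: "module R Z" unfolding Z_def
    by (rule submodule_module[OF mod[OF F0(1)] submodule_zero[OF mod[OF F0(1)]]])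
  \<comment> \<open>Stage k sits in degree -k, so the differential that leaves degree -k - 1 is
    \<open>d k\<close>. From degree 0 on all differentials vanish.\<close>
  define F where "F = \<lparr>obj = (\<lambda>n. if n \<le> 0 then Fs (nat (- n)) else Z),
    diff = (\<lambda>n. if n < 0 then restrict (d (nat (- n - 1))) (carrier (Fs (nat (- n))))
      else (\<lambda>x\<in>carrier (if n \<le> 0 then Fs (nat (- n)) else Z). \<zero>\<^bsub>Z\<^esub>))\<rparr>"
  have neg: "obj F (- int k) = Fs k" "obj F (- int k - 1) = Fs (Suc k)" "obj F (- int k - 1 + 1) = Fs k"
    "diff F (- int k - 1) = restrict (d k) (carrier (Fs (Suc k)))" for k
    by (auto simp: F_def nat_add_distrib Suc_nat_eq_nat_zadd1)
  have pos: "obj F (n + 1) = Z" "diff F n = (\<lambda>x\<in>carrier (obj F n). \<zero>\<^bsub>Z\<^esub>)" if "n \<ge> 0" for n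
    using that by (auto simp: F_def)
  have negE: "\<exists>k. n = - int k - 1" if "n < 0" for n :: int
    using that by (intro exI[of _ "nat (- n - 1)"]) simp
  have modF: "module R (obj F n)" for n using FsM Z by (simp add: F_def)
  have homF: "diff F n \<in> module_hom R (obj F n) (obj F (n + 1))" for n
  proof (cases "n < 0")
    case True
    then obtain k where "n = - int k - 1" using negE by blast
    then show ?thesis using restrict_in_module_hom[OF FsM d(1)] by (simp add: neg)
  next
    case False
    interpret Z: module R Z by (rule Z)
    have "linear_map R (obj F n) Z (\<lambda>x. \<zero>\<^bsub>Z\<^esub>)" by (auto intro!: linear_mapI)
    then show ?thesis using restrict_in_module_hom[OF modF] False by (simp add: pos)
  qed
  have dd: "diff F (n + 1) (diff F n x) = \<zero>\<^bsub>obj F (n + 1 + 1)\<^esub>" if x: "x \<in> carrier (obj F n)" for n x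
  proof (cases "n + 1 < 0")
    case True
    then obtain k where k: "n + 1 = - int k - 1" using negE by blast
    then have n: "n = - int (Suc k) - 1" by simp
    have "d (Suc k) x \<in> a_kernel (Fs (Suc k)) (Fs k) (d k)"
      using x d(2,3) unfolding n neg by blast
    moreover have "x \<in> carrier (Fs (Suc (Suc k)))" using x unfolding n neg .
    moreover have "obj F (n + 1 + 1) = Fs k" unfolding k by (simp add: neg)
    moreover have "diff F (n + 1) = restrict (d k) (carrier (Fs (Suc k)))" unfolding k neg ..
    moreover have "diff F n = restrict (d (Suc k)) (carrier (Fs (Suc (Suc k))))" unfolding n neg ..
    ultimately show ?thesis by (simp add: a_kernel_iff)
  next
    case False
    have "diff F n x \<in> carrier (obj F (n + 1))"
      using linear_map_closed[OF module_hom_linear[OF homF] x] .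
    then show ?thesis using False pos[of "n + 1"] by simp
  qed
  have "F \<in> complexes R" using modF homF dd by (simp add: complexes_def)
  moreover have "cocycles F n = coboundaries F n" if n: "n < 0" for n
  proof -
    obtain k where k: "n = - int k - 1" using negE[OF n] by blast
    then have k': "n - 1 = - int (Suc k) - 1" by simp
    have "cocycles F n = K (Suc k)"
      unfolding cocycles_def k neg d(3) by (auto simp: a_kernel_iff)
    also have "\<dots> = coboundaries F n"
      unfolding coboundaries_def k' neg using d(2)[of "Suc k"] by auto
    finally show ?thesis .
  qed
  moreover have "restrict p (carrier F0) \<in> module_hom R (obj F 0) N"
    "restrict p (carrier F0) ` carrier (obj F 0) = carrier N"
    "a_kernel (obj F 0) N (restrict p (carrier F0)) = coboundaries F 0"
    using neg(1)[of 0] neg(2,4)[of 0] F0(4) restrict_in_module_hom[OF mod[OF F0(1)] F0(3)] zero d(2)[of 0]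
    by (auto simp: coboundaries_def a_kernel_iff)
  moreover have "carrier (obj F n) = {\<zero>\<^bsub>obj F n\<^esub>}" if "n > 0" for n
    using that by (simp add: F_def Z_def)
  moreover have "free_module R (obj F n)" if "n \<le> 0" for n
    using that Fs(1) by (simp add: F_def)
  ultimately show ?thesis unfolding free_resolution_def by blast
qed

text \<open>The class of 1 generates the quotient; this is the input that starts its
  resolution.\<close>

lemma quotient_ring_finitely_generated:
  assumes R: "cring R" and I: "ideal \<aa> R"
  shows "submodule \<aa> R (ring_as_module R)"
    and "finitely_generated R (quotient_module (ring_as_module R) \<aa>)"
proof -
  interpret R: cring R by fact
  interpret I: ideal \<aa> R by fact
  let ?A = "ring_as_module R" and ?Q = "quotient_module (ring_as_module R) \<aa>"
  interpret A: module R ?A by (rule module_ring_as_module[OF R])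
  show sub: "submodule \<aa> R ?A"
    using I.a_subset I.zero_closed I.a_closed I.I_l_closed
    unfolding A.submodule_iff by (auto simp: ring_as_module_def)
  note Q = quotient_is_module[OF A.module_axioms sub]
  have one: "\<one>\<^bsub>R\<^esub> \<in> carrier ?A" by (simp add: ring_as_module_def)
  show "finitely_generated R ?Q" unfolding finitely_generated_iff[OF Q]
  proof (intro exI[of _ "{\<aa> +>\<^bsub>?A\<^esub> \<one>\<^bsub>R\<^esub>}"] conjI allI impI subsetI)
    fix H \<xi> assume H: "submodule H R ?Q" "{\<aa> +>\<^bsub>?A\<^esub> \<one>\<^bsub>R\<^esub>} \<subseteq> H" and "\<xi> \<in> carrier ?Q"
    then obtain r where r: "r \<in> carrier ?A" "\<xi> = \<aa> +>\<^bsub>?A\<^esub> r"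
      by (metis quotient_cases[OF A.module_axioms sub])
    then have rR: "r \<in> carrier R" by (simp add: ring_as_module_def)
    have "r \<odot>\<^bsub>?Q\<^esub> (\<aa> +>\<^bsub>?A\<^esub> \<one>\<^bsub>R\<^esub>) = \<aa> +>\<^bsub>?A\<^esub> (r \<odot>\<^bsub>?A\<^esub> \<one>\<^bsub>R\<^esub>)"
      by (rule coset_smult[OF A.module_axioms sub rR one])
    also have "\<dots> = \<xi>" using r rR by (simp add: ring_as_module_def)
    finally show "\<xi> \<in> H" using submoduleD(4)[OF Q H(1) rR] H(2) by force
  qed (use coset_closed[OF A.module_axioms sub one] in auto)
qed

section \<open>Ext and extensions of cofinite modules\<close>

lemma module_hom_module:
  assumes P: "module R P" and M: "module R M"
  shows "module R (hom_module R P M)"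
proof -
  interpret P: module R P by fact
  interpret M: module R M by fact
  let ?H = "hom_module R P M"
  have cl: "f x \<in> carrier M" if "f \<in> module_hom R P M" "x \<in> carrier P" for f x
    using that by (auto simp: module_hom_iff linear_map_closed)
  have add: "(\<lambda>x\<in>carrier P. f x \<oplus>\<^bsub>M\<^esub> g x) \<in> module_hom R P M"
    if f: "f \<in> module_hom R P M" and g: "g \<in> module_hom R P M" for f g
  proof (rule restrict_in_module_hom[OF P], rule linear_mapI)
    fix x y assume "x \<in> carrier P" "y \<in> carrier P"
    then show "f (x \<oplus>\<^bsub>P\<^esub> y) \<oplus>\<^bsub>M\<^esub> g (x \<oplus>\<^bsub>P\<^esub> y) = f x \<oplus>\<^bsub>M\<^esub> g x \<oplus>\<^bsub>M\<^esub> (f y \<oplus>\<^bsub>M\<^esub> g y)"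
      using cl[OF f] cl[OF g] linear_map_add[OF module_hom_linear[OF f]]
        linear_map_add[OF module_hom_linear[OF g]] by (simp add: M.M.a_ac)
  next
    fix r x assume "r \<in> carrier R" "x \<in> carrier P"
    then show "f (r \<odot>\<^bsub>P\<^esub> x) \<oplus>\<^bsub>M\<^esub> g (r \<odot>\<^bsub>P\<^esub> x) = r \<odot>\<^bsub>M\<^esub> (f x \<oplus>\<^bsub>M\<^esub> g x)"
      using cl[OF f] cl[OF g] linear_map_smult[OF module_hom_linear[OF f]]
        linear_map_smult[OF module_hom_linear[OF g]] by (simp add: M.smult_r_distr)
  qed (use cl[OF f] cl[OF g] in auto)
  have smult: "(\<lambda>x\<in>carrier P. s \<odot>\<^bsub>M\<^esub> f x) \<in> module_hom R P M"
    if s: "s \<in> carrier R" and f: "f \<in> module_hom R P M" for s f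
  proof (rule restrict_in_module_hom[OF P], rule linear_mapI)
    fix x y assume "x \<in> carrier P" "y \<in> carrier P"
    then show "s \<odot>\<^bsub>M\<^esub> f (x \<oplus>\<^bsub>P\<^esub> y) = s \<odot>\<^bsub>M\<^esub> f x \<oplus>\<^bsub>M\<^esub> s \<odot>\<^bsub>M\<^esub> f y"
      using s cl[OF f] linear_map_add[OF module_hom_linear[OF f]] by (simp add: M.smult_r_distr)
  next
    fix r x assume r: "r \<in> carrier R" "x \<in> carrier P"
    then have "s \<odot>\<^bsub>M\<^esub> f (r \<odot>\<^bsub>P\<^esub> x) = (s \<otimes>\<^bsub>R\<^esub> r) \<odot>\<^bsub>M\<^esub> f x"
      using s cl[OF f] linear_map_smult[OF module_hom_linear[OF f]] by (simp add: M.smult_assoc1)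
    \<comment> \<open>Commutativity of the ring is what makes a scalar multiple of a linear map
      linear.\<close>
    also have "\<dots> = r \<odot>\<^bsub>M\<^esub> (s \<odot>\<^bsub>M\<^esub> f x)"
      using r s cl[OF f] by (simp add: M.smult_assoc1[symmetric] P.R.m_comm)
    finally show "s \<odot>\<^bsub>M\<^esub> f (r \<odot>\<^bsub>P\<^esub> x) = r \<odot>\<^bsub>M\<^esub> (s \<odot>\<^bsub>M\<^esub> f x)" .
  qed (use s cl[OF f] in auto)
  have zero: "(\<lambda>x\<in>carrier P. \<zero>\<^bsub>M\<^esub>) \<in> module_hom R P M"
    by (rule restrict_in_module_hom[OF P], rule linear_mapI) auto
  have ext: "restrict f (carrier P) = f" if "f \<in> module_hom R P M" for f
    using that by (simp add: module_hom_iff extensional_restrict)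
  have simps: "carrier ?H = module_hom R P M" "\<zero>\<^bsub>?H\<^esub> = (\<lambda>x\<in>carrier P. \<zero>\<^bsub>M\<^esub>)"
    "f \<oplus>\<^bsub>?H\<^esub> g = (\<lambda>x\<in>carrier P. f x \<oplus>\<^bsub>M\<^esub> g x)" "r \<odot>\<^bsub>?H\<^esub> f = (\<lambda>x\<in>carrier P. r \<odot>\<^bsub>M\<^esub> f x)" for f g r
    by (simp_all add: hom_module_def)
  show ?thesis
  proof (rule moduleI)
    show "abelian_group ?H"
    proof (rule abelian_groupI)
      fix f assume f: "f \<in> carrier ?H"
      show "\<exists>g\<in>carrier ?H. g \<oplus>\<^bsub>?H\<^esub> f = \<zero>\<^bsub>?H\<^esub>"
      proof (rule bexI)
        show "(\<ominus>\<^bsub>R\<^esub> \<one>\<^bsub>R\<^esub>) \<odot>\<^bsub>?H\<^esub> f \<in> carrier ?H" using f smult by (simp add: simps)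
        show "((\<ominus>\<^bsub>R\<^esub> \<one>\<^bsub>R\<^esub>) \<odot>\<^bsub>?H\<^esub> f) \<oplus>\<^bsub>?H\<^esub> f = \<zero>\<^bsub>?H\<^esub>"
          using f cl by (auto simp: simps M.neg_eq_smult[symmetric] M.M.l_neg intro!: restrict_ext)
      qed
      have "\<zero>\<^bsub>?H\<^esub> \<oplus>\<^bsub>?H\<^esub> f = restrict f (carrier P)"
        using f cl by (auto simp: simps intro!: restrict_ext)
      then show "\<zero>\<^bsub>?H\<^esub> \<oplus>\<^bsub>?H\<^esub> f = f" using f ext by (simp add: simps)
    qed (use cl add zero in \<open>auto simp: simps M.M.a_ac intro!: restrict_ext\<close>)
    fix f assume f: "f \<in> carrier ?H"
    have "\<one>\<^bsub>R\<^esub> \<odot>\<^bsub>?H\<^esub> f = restrict f (carrier P)"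
      using f cl by (auto simp: simps intro!: restrict_ext)
    then show "\<one>\<^bsub>R\<^esub> \<odot>\<^bsub>?H\<^esub> f = f" using f ext by (simp add: simps)
  qed (use cl smult in \<open>auto simp: simps P.R.is_cring M.smult_l_distr M.smult_r_distr M.smult_assoc1
      intro!: restrict_ext\<close>)
qed

section \<open>The complex of homomorphisms and exactness of Ext in the middle\<close>

lemma Hom_complex_obj: "obj (Hom_complex R F M) n = hom_module R (obj F (- n)) M"
  by (simp add: Hom_complex_def)

lemma hom_module_carrier: "carrier (hom_module R P M) = module_hom R P M"
  by (simp add: hom_module_def)

lemma Hom_complex_diff:
  "\<phi> \<in> module_hom R (obj F (- n)) M \<Longrightarrow>
   diff (Hom_complex R F M) n \<phi> = (\<lambda>x\<in>carrier (obj F (- (n + 1))). \<phi> (diff F (- (n + 1)) x))"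
  by (simp add: Hom_complex_def compose_def)

text \<open>\<open>Hom_complex\<close> reads the resolution backwards: its differential in degree n
  is precomposition with the one that leaves degree -(n + 1). The target index -(n + 1) + 1 is
  brought to the form -n here, once and for all.\<close>

lemma complexes_diff_neg:
  assumes "F \<in> complexes R"
  shows "linear_map R (obj F (- (n + 1))) (obj F (- n)) (diff F (- (n + 1)))"
proof -
  have "- (n + 1) + 1 = - n" by simp
  then show ?thesis using complexesD(2)[OF assms, of "- (n + 1)"] by metis
qed

lemma complexes_diff_diff_neg:
  assumes "F \<in> complexes R" "x \<in> carrier (obj F (- (n + 1 + 1)))"
  shows "diff F (- (n + 1)) (diff F (- (n + 1 + 1)) x) = \<zero>\<^bsub>obj F (- n)\<^esub>"
proof -
  have "- (n + 1 + 1) + 1 = - (n + 1)" "- (n + 1) + 1 = - n" by simp_all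
  then show ?thesis using complexesD(4)[OF assms] by metis
qed

lemma Hom_complex_in_complexes:
  assumes F: "F \<in> complexes R" and M: "module R M"
  shows "Hom_complex R F M \<in> complexes R"
proof -
  let ?H = "Hom_complex R F M"
  interpret M: module R M by fact
  have mod: "module R (obj ?H n)" for n
    unfolding Hom_complex_obj by (rule module_hom_module[OF complexesD(1)[OF F] M])
  have car: "carrier (obj ?H n) = module_hom R (obj F (- n)) M" for n
    by (simp add: Hom_complex_obj hom_module_carrier)
  note d = complexes_diff_neg[OF F]
  have cl: "diff ?H n \<phi> \<in> module_hom R (obj F (- (n + 1))) M" if "\<phi> \<in> module_hom R (obj F (- n)) M" for n \<phi>
    unfolding Hom_complex_diff[OF that]
    by (rule restrict_in_module_hom[OF complexesD(1)[OF F]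
          linear_map_comp[OF d module_hom_linear[OF that]]])
  have lin: "linear_map R (obj ?H n) (obj ?H (n + 1)) (diff ?H n)" for n
  proof (rule linear_mapI)
    interpret H: module R "obj ?H n" by (rule mod)
    fix \<phi> assume \<phi>: "\<phi> \<in> carrier (obj ?H n)"
    then show "diff ?H n \<phi> \<in> carrier (obj ?H (n + 1))" using cl by (simp add: car)
    fix \<psi> assume \<psi>: "\<psi> \<in> carrier (obj ?H n)"
    have *: "\<phi> \<oplus>\<^bsub>obj ?H n\<^esub> \<psi> \<in> module_hom R (obj F (- n)) M"
      using H.M.a_closed[OF \<phi> \<psi>] by (simp add: car)
    show "diff ?H n (\<phi> \<oplus>\<^bsub>obj ?H n\<^esub> \<psi>) = diff ?H n \<phi> \<oplus>\<^bsub>obj ?H (n + 1)\<^esub> diff ?H n \<psi>"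
      using \<phi> \<psi> linear_map_closed[OF d[of n]]
      unfolding car Hom_complex_diff[OF *]
      by (auto simp: Hom_complex_diff Hom_complex_obj hom_module_def intro!: restrict_ext)
  next
    interpret H: module R "obj ?H n" by (rule mod)
    fix r \<phi> assume r: "r \<in> carrier R" and \<phi>: "\<phi> \<in> carrier (obj ?H n)"
    have *: "r \<odot>\<^bsub>obj ?H n\<^esub> \<phi> \<in> module_hom R (obj F (- n)) M"
      using H.smult_closed[OF r \<phi>] by (simp add: car)
    show "diff ?H n (r \<odot>\<^bsub>obj ?H n\<^esub> \<phi>) = r \<odot>\<^bsub>obj ?H (n + 1)\<^esub> diff ?H n \<phi>"
      using \<phi> linear_map_closed[OF d[of n]]
      unfolding car Hom_complex_diff[OF *]
      by (auto simp: Hom_complex_diff Hom_complex_obj hom_module_def intro!: restrict_ext)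
  qed
  have ext: "diff ?H n \<in> extensional (carrier (obj ?H n))" for n
    unfolding car by (simp add: Hom_complex_def)
  have "diff ?H (n + 1) (diff ?H n \<phi>) = \<zero>\<^bsub>obj ?H (n + 1 + 1)\<^esub>" if \<phi>: "\<phi> \<in> carrier (obj ?H n)" for n \<phi>
  proof -
    have \<phi>': "\<phi> \<in> module_hom R (obj F (- n)) M" using \<phi> by (simp add: car)
    have "diff ?H n \<phi> (diff F (- (n + 1 + 1)) x) = \<zero>\<^bsub>M\<^esub>"
      if x: "x \<in> carrier (obj F (- (n + 1 + 1)))" for x
      using linear_map_closed[OF d x] complexes_diff_diff_neg[OF F x]
        linear_map_zero[OF complexesD(1)[OF F] M module_hom_linear[OF \<phi>']]
      unfolding Hom_complex_diff[OF \<phi>'] by simp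
    then show ?thesis
      unfolding Hom_complex_diff[OF cl[OF \<phi>']] Hom_complex_obj
      by (auto simp: hom_module_def intro!: restrict_ext)
  qed
  then show ?thesis using mod lin ext by (simp add: complexes_def module_hom_iff)
qed

definition Hom_push :: "('a, 'b) cochain \<Rightarrow> ('c \<Rightarrow> 'd) \<Rightarrow> int \<Rightarrow> ('b \<Rightarrow> 'c) \<Rightarrow> 'b \<Rightarrow> 'd" where
  "Hom_push F p n \<phi> = compose (carrier (obj F (- n))) p \<phi>"

lemma Hom_push_in_module_hom:
  assumes "F \<in> complexes R" "linear_map R M N p" "\<phi> \<in> module_hom R (obj F (- n)) M"
  shows "Hom_push F p n \<phi> \<in> module_hom R (obj F (- n)) N"
  unfolding Hom_push_def compose_def
  by (rule restrict_in_module_hom[OF complexesD(1)[OF assms(1)]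
        linear_map_comp[OF module_hom_linear[OF assms(3)] assms(2)]])

lemma Hom_push_chain_linear:
  assumes F: "F \<in> complexes R" and M: "module R M" and N: "module R N" and p: "linear_map R M N p"
  shows "chain_linear R (Hom_complex R F M) (Hom_complex R F N) (Hom_push F p)"
proof -
  have car: "carrier (obj (Hom_complex R F M) n) = module_hom R (obj F (- n)) M" for n
    by (simp add: Hom_complex_obj hom_module_carrier)
  have cl: "\<phi> x \<in> carrier M" if "\<phi> \<in> module_hom R (obj F (- n)) M" "x \<in> carrier (obj F (- n))" for \<phi> n x
    by (rule linear_map_closed[OF module_hom_linear[OF that(1)] that(2)])
  have "linear_map R (obj (Hom_complex R F M) n) (obj (Hom_complex R F N) n) (Hom_push F p n)" for n
  proof (rule linear_mapI)
    fix \<phi> assume "\<phi> \<in> carrier (obj (Hom_complex R F M) n)"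
    then show "Hom_push F p n \<phi> \<in> carrier (obj (Hom_complex R F N) n)"
      using Hom_push_in_module_hom[OF F p] by (simp add: Hom_complex_obj hom_module_carrier)
  qed (auto simp: Hom_complex_obj hom_module_def Hom_push_def compose_def linear_map_add[OF p]
      linear_map_smult[OF p] cl intro!: restrict_ext)
  moreover have "Hom_push F p (n + 1) (diff (Hom_complex R F M) n \<phi>) =
      diff (Hom_complex R F N) n (Hom_push F p n \<phi>)" if \<phi>: "\<phi> \<in> module_hom R (obj F (- n)) M" for n \<phi>
    unfolding Hom_complex_diff[OF \<phi>] Hom_complex_diff[OF Hom_push_in_module_hom[OF F p \<phi>]]
    unfolding Hom_push_def compose_def
    using linear_map_closed[OF complexes_diff_neg[OF F, of n]] by (auto intro!: restrict_ext)
  ultimately show ?thesis by (simp add: chain_linear_def car)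
qed

text \<open>Lifting is required in every degree: coboundaries of the Hom complex in degree 0 come
  from the term of the resolution in degree 1. Above degree 0 the resolution is zero and the zero
  map is a lift.\<close>

lemma free_resolution_lift:
  assumes F: "free_resolution R A F \<epsilon>" and M: "module R M" and N: "module R N"
    and p: "linear_map R M N p" and sur: "carrier N \<subseteq> p ` carrier M"
    and \<psi>: "linear_map R (obj F k) N \<psi>"
  shows "\<exists>\<phi>. linear_map R (obj F k) M \<phi> \<and> (\<forall>x\<in>carrier (obj F k). p (\<phi> x) = \<psi> x)"
proof (cases "k \<le> 0")
  case True
  then show ?thesis using F free_module_lift[OF _ M N p sur \<psi>] by (simp add: free_resolution_def)
next
  case False
  have Fk: "module R (obj F k)" using F complexesD(1) by (auto simp: free_resolution_def)
  interpret M: module R M by fact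
  have "carrier (obj F k) = {\<zero>\<^bsub>obj F k\<^esub>}" using False F by (simp add: free_resolution_def)
  then have "\<forall>x\<in>carrier (obj F k). p \<zero>\<^bsub>M\<^esub> = \<psi> x"
    using linear_map_zero[OF Fk N \<psi>] linear_map_zero[OF M N p] by simp
  moreover have "linear_map R (obj F k) M (\<lambda>x. \<zero>\<^bsub>M\<^esub>)" by (auto intro!: linear_mapI)
  ultimately show ?thesis by blast
qed

text \<open>A cocycle \<phi> whose class dies in Ext of \<open>N\<close> satisfies p \<phi> = \<psi>
  d. Freeness lifts \<psi> to some \<theta> with values in \<open>M\<close>. Then \<phi> - \<theta>
  d has values in the kernel of \<open>p\<close>, hence factors through \<open>i\<close>, and it is
  cohomologous to \<phi>.\<close>

lemma Ext_exact:
  assumes F: "free_resolution R A F \<epsilon>"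
    and L: "module R L" and M: "module R M" and N: "module R N"
    and i: "linear_map R L M i" and inj: "inj_on i (carrier L)"
    and p: "linear_map R M N p" and sur: "carrier N \<subseteq> p ` carrier M"
    and ker: "a_kernel M N p \<subseteq> i ` carrier L"
  shows "a_kernel (cohomology (Hom_complex R F M) n) (cohomology (Hom_complex R F N) n)
      (induced_map (Hom_complex R F M) (Hom_complex R F N) (Hom_push F p) n)
    \<subseteq> induced_map (Hom_complex R F L) (Hom_complex R F M) (Hom_push F i) n `
      carrier (cohomology (Hom_complex R F L) n)"
proof
  interpret L: module R L by fact
  interpret M: module R M by fact
  interpret N: module R N by fact
  let ?L = "Hom_complex R F L" and ?M = "Hom_complex R F M" and ?N = "Hom_complex R F N"
  have Fc: "F \<in> complexes R" using F by (simp add: free_resolution_def)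
  note cx = Hom_complex_in_complexes[OF Fc]
  note pc = Hom_push_chain_linear[OF Fc M N p] and ic = Hom_push_chain_linear[OF Fc L M i]
  have car: "carrier (obj (Hom_complex R F P) n) = module_hom R (obj F (- n)) P"
    for P :: "('a, 'p) module" and n
    by (simp add: Hom_complex_obj hom_module_carrier)
  note d = complexes_diff_neg[OF Fc]
  let ?P = "obj F (- n)" and ?P' = "obj F (- (n - 1))" and ?d = "diff F (- n)"
  have d': "linear_map R ?P ?P' ?d" using d[of "n - 1"] by simp
  have bound: "coboundaries (Hom_complex R F P) n = (\<lambda>\<psi>. \<lambda>x\<in>carrier ?P. \<psi> (?d x)) ` module_hom R ?P' P"
    for P :: "('a, 'p) module"
    unfolding coboundaries_def car using Hom_complex_diff[of _ R F "n - 1" P] by (auto intro!: image_cong)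
  fix \<xi> assume \<xi>: "\<xi> \<in> a_kernel (cohomology ?M n) (cohomology ?N n) (induced_map ?M ?N (Hom_push F p) n)"
  then obtain \<phi> where \<phi>: "\<phi> \<in> cocycles ?M n" "\<xi> = cohomology_class ?M n \<phi>"
    using cohomology_cases[OF cx[OF M]] by (metis a_kernel_iff)
  have \<phi>h: "\<phi> \<in> module_hom R ?P M" using \<phi>(1) by (simp add: cocycles_iff car)
  note \<phi>l = module_hom_linear[OF \<phi>h]
  have "Hom_push F p n \<phi> \<in> coboundaries ?N n"
    using \<xi> \<phi> induced_map_class[OF cx[OF M] cx[OF N] pc \<phi>(1)] chain_cocycles[OF cx[OF M] cx[OF N] pc \<phi>(1)]
      cohomology_class_zero_iff[OF cx[OF N]] by (simp add: a_kernel_iff)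
  then obtain \<psi> where \<psi>: "\<psi> \<in> module_hom R ?P' N" "Hom_push F p n \<phi> = (\<lambda>x\<in>carrier ?P. \<psi> (?d x))"
    unfolding bound by blast
  obtain \<theta> where \<theta>: "linear_map R ?P' M \<theta>" "\<And>x. x \<in> carrier ?P' \<Longrightarrow> p (\<theta> x) = \<psi> x"
    using free_resolution_lift[OF F M N p sur module_hom_linear[OF \<psi>(1)]] by blast
  \<comment> \<open>The representative of the class of \<phi> that takes values in the kernel of
    \<open>p\<close>.\<close>
  define \<chi> where "\<chi> x = \<phi> x \<ominus>\<^bsub>M\<^esub> \<theta> (?d x)" for x
  note \<theta>d = linear_map_comp[OF d' \<theta>(1)]
  have \<phi>cl: "\<phi> x \<in> carrier M" "\<theta> (?d x) \<in> carrier M" if "x \<in> carrier ?P" for x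
    using linear_map_closed[OF \<phi>l that] linear_map_closed[OF \<theta>d that] by auto
  have \<chi>l: "linear_map R ?P M \<chi>"
  proof (rule linear_mapI)
    show "\<chi> x \<in> carrier M" if "x \<in> carrier ?P" for x using \<phi>cl[OF that] by (simp add: \<chi>_def)
    show "\<chi> (x \<oplus>\<^bsub>?P\<^esub> y) = \<chi> x \<oplus>\<^bsub>M\<^esub> \<chi> y" if "x \<in> carrier ?P" "y \<in> carrier ?P" for x y
      using that \<phi>cl unfolding \<chi>_def
      by (simp add: linear_map_add[OF \<phi>l] linear_map_add[OF \<theta>d] a_minus_def M.M.minus_add M.M.a_ac)
    show "\<chi> (r \<odot>\<^bsub>?P\<^esub> x) = r \<odot>\<^bsub>M\<^esub> \<chi> x" if "r \<in> carrier R" "x \<in> carrier ?P" for r x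
      using that \<phi>cl unfolding \<chi>_def
      by (simp add: linear_map_smult[OF \<phi>l] linear_map_smult[OF \<theta>d] a_minus_def M.smult_r_distr
          M.smult_r_minus)
  qed
  have p\<phi>: "p (\<phi> x) = \<psi> (?d x)" if x: "x \<in> carrier ?P" for x
    using fun_cong[OF \<psi>(2), of x] x by (simp add: Hom_push_def compose_def)
  have "p (\<chi> x) = \<zero>\<^bsub>N\<^esub>" if x: "x \<in> carrier ?P" for x
    using \<phi>cl[OF x] p\<phi>[OF x] \<theta>(2)[OF linear_map_closed[OF d' x]]
      linear_map_closed[OF linear_map_comp[OF d' module_hom_linear[OF \<psi>(1)]] x]
    by (simp add: \<chi>_def linear_map_diff[OF M N p])
  then have \<chi>i: "\<chi> x \<in> i ` carrier L" if "x \<in> carrier ?P" for x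
    using that ker linear_map_closed[OF \<chi>l] by (auto simp: subset_iff a_kernel_iff)
  \<comment> \<open>With its target cut down to the image, \<open>i\<close> is an isomorphism, and
    its inverse turns \<chi> into a map to \<open>L\<close>.\<close>
  let ?I = "M\<lparr>carrier := i ` carrier L\<rparr>"
  have I: "module R ?I" by (rule submodule_module[OF M submodule_range[OF L M i]])
  have i': "linear_map R L ?I i" using i by (auto simp: linear_map_def)
  have bij: "bij_betw i (carrier L) (carrier ?I)" using inj by (simp add: bij_betw_def)
  note inv = linear_map_inv_into[OF L i' bij]
  have "linear_map R ?P ?I \<chi>" using \<chi>l \<chi>i by (auto simp: linear_map_def)
  note \<kappa>l = linear_map_comp[OF this inv]
  define \<kappa> where "\<kappa> = (\<lambda>x\<in>carrier ?P. inv_into (carrier L) i (\<chi> x))"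
  have \<kappa>h: "\<kappa> \<in> module_hom R ?P L"
    unfolding \<kappa>_def by (rule restrict_in_module_hom[OF complexesD(1)[OF Fc] \<kappa>l])
  have i\<kappa>: "i (\<kappa> x) = \<chi> x" if "x \<in> carrier ?P" for x
    using that f_inv_into_f[OF \<chi>i[OF that]] by (simp add: \<kappa>_def)
  have \<kappa>c: "\<kappa> \<in> cocycles ?L n"
    unfolding cocycles_iff car
  proof (intro conjI \<kappa>h)
    have "\<kappa> (diff F (- (n + 1)) x) = \<zero>\<^bsub>L\<^esub>" if x: "x \<in> carrier (obj F (- (n + 1)))" for x
    proof -
      note dx = linear_map_closed[OF d x]
      have "diff ?M n \<phi> x = \<zero>\<^bsub>obj ?M (n + 1)\<^esub> x" using \<phi>(1) by (simp add: cocycles_iff)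
      then have "\<phi> (diff F (- (n + 1)) x) = \<zero>\<^bsub>M\<^esub>"
        using x by (simp only: Hom_complex_diff[OF \<phi>h] Hom_complex_obj hom_module_def ring.simps restrict_apply' module.simps)
      moreover have "?d (diff F (- (n + 1)) x) = \<zero>\<^bsub>?P'\<^esub>"
        using complexes_diff_diff_neg[OF Fc, of x "n - 1"] x by simp
      ultimately have "\<chi> (diff F (- (n + 1)) x) = \<zero>\<^bsub>M\<^esub>"
        using linear_map_zero[OF complexesD(1)[OF Fc] M \<theta>(1)] by (simp add: \<chi>_def)
      then have "i (\<kappa> (diff F (- (n + 1)) x)) = \<zero>\<^bsub>M\<^esub>" using i\<kappa>[OF dx] by simp
      \<comment> \<open>The cocycle condition holds after applying \<open>i\<close>; injectivity of
        \<open>i\<close> brings it back to \<open>L\<close>.\<close>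
      then show ?thesis
        using inj linear_map_inj_iff[OF L M i] linear_map_closed[OF module_hom_linear[OF \<kappa>h] dx] by blast
    qed
    then show "diff ?L n \<kappa> = \<zero>\<^bsub>obj ?L (n + 1)\<^esub>"
      unfolding Hom_complex_diff[OF \<kappa>h] Hom_complex_obj by (auto simp: hom_module_def intro!: restrict_ext)
  qed
  have "\<phi> \<ominus>\<^bsub>obj ?M n\<^esub> Hom_push F i n \<kappa> \<in> coboundaries ?M n"
  proof -
    interpret H: module R "obj ?M n" by (rule complexesD(1)[OF cx[OF M]])
    \<comment> \<open>Coboundaries arise from elements of \<open>module_hom\<close>, so \<theta> is
      restricted to the carrier before it is composed with the differential.\<close>
    let ?b = "\<lambda>x\<in>carrier ?P. restrict \<theta> (carrier ?P') (?d x)"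
    have b: "?b \<in> coboundaries ?M n"
      unfolding bound using restrict_in_module_hom[OF complexesD(1)[OF Fc] \<theta>(1)] by blast
    have bH: "?b \<in> carrier (obj ?M n)"
      using b submoduleD(1)[OF complexesD(1)[OF cx[OF M]] submodule_coboundaries[OF cx[OF M]]] by blast
    have iH: "Hom_push F i n \<kappa> \<in> carrier (obj ?M n)"
      unfolding car by (rule Hom_push_in_module_hom[OF Fc i \<kappa>h])
    have "?b x \<oplus>\<^bsub>M\<^esub> Hom_push F i n \<kappa> x = \<phi> x" if x: "x \<in> carrier ?P" for x
    proof -
      have "?b x \<oplus>\<^bsub>M\<^esub> Hom_push F i n \<kappa> x = \<theta> (?d x) \<oplus>\<^bsub>M\<^esub> (\<phi> x \<ominus>\<^bsub>M\<^esub> \<theta> (?d x))"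
        using x i\<kappa>[OF x] linear_map_closed[OF d' x] by (simp add: Hom_push_def compose_def \<chi>_def)
      also have "\<dots> = \<phi> x"
        using \<phi>cl[OF x] by (simp add: a_minus_def M.M.a_lcomm M.M.r_neg)
      finally show ?thesis .
    qed
    then have "(\<lambda>x\<in>carrier ?P. ?b x \<oplus>\<^bsub>M\<^esub> Hom_push F i n \<kappa> x) = restrict \<phi> (carrier ?P)"
      by (intro restrict_ext) auto
    also have "\<dots> = \<phi>" using \<phi>h by (simp add: module_hom_iff extensional_restrict)
    finally have "\<phi> = ?b \<oplus>\<^bsub>obj ?M n\<^esub> Hom_push F i n \<kappa>"
      by (simp add: Hom_complex_obj hom_module_def)
    then have "\<phi> \<ominus>\<^bsub>obj ?M n\<^esub> Hom_push F i n \<kappa> = ?b"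
      using bH iH by (simp add: a_minus_def H.M.a_assoc H.M.r_neg)
    then show ?thesis using b by simp
  qed
  then have "\<xi> = cohomology_class ?M n (Hom_push F i n \<kappa>)"
    unfolding \<phi>(2)
    using cohomology_class_eq_iff[OF cx[OF M] \<phi>(1) chain_cocycles[OF cx[OF L] cx[OF M] ic \<kappa>c]] by blast
  also have "\<dots> = induced_map ?L ?M (Hom_push F i) n (cohomology_class ?L n \<kappa>)"
    using induced_map_class[OF cx[OF L] cx[OF M] ic \<kappa>c] by simp
  finally show "\<xi> \<in> induced_map ?L ?M (Hom_push F i) n ` carrier (cohomology ?L n)"
    using cohomology_class_closed[OF cx[OF L] \<kappa>c] by blast
qed

section \<open>Closure properties of cofinite modules\<close>

locale noetherian_ideal =
  fixes R :: "('a, 'r) ring_scheme" and \<aa> :: "'a set"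
  assumes cring: "cring R" and noetherian: "noetherian_ring R" and ideal: "ideal \<aa> R"
begin

abbreviation cofinite :: "('a, 'b) module set" where "cofinite \<equiv> M_cof R \<aa>"

abbreviation RI :: "('a, 'a set) module" where "RI \<equiv> quotient_module (ring_as_module R) \<aa>"

text \<open>\<open>resolution\<close> is defined by choice on a prescribed type; it has the
  properties of a free resolution only because one exists there.\<close>

lemma resolution_free: "\<exists>\<epsilon>. free_resolution R RI (resolution R RI) \<epsilon>"
proof -
  have "module R RI"
    by (rule quotient_is_module[OF module_ring_as_module[OF cring]
          quotient_ring_finitely_generated(1)[OF cring ideal]])
  then have "\<exists>F :: ('a, ('a, 'a set) univ) cochain. \<exists>\<epsilon>. free_resolution R RI F \<epsilon>"
    using free_resolution_exists[OF noetherian _ quotient_ring_finitely_generated(2)[OF cring ideal]] by blast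
  then show ?thesis unfolding resolution_def by (rule someI_ex)
qed

lemma cofinite_module: "M \<in> cofinite \<Longrightarrow> module R M"
  by (simp add: M_cof_def)

lemma cofinite_extension:
  assumes L: "L \<in> cofinite" and N: "N \<in> cofinite" and M: "module R M"
    and i: "linear_map R L M i" and inj: "inj_on i (carrier L)"
    and p: "linear_map R M N p" and sur: "carrier N \<subseteq> p ` carrier M"
    and ker: "a_kernel M N p \<subseteq> i ` carrier L"
  shows "M \<in> cofinite"
proof -
  note LM = cofinite_module[OF L] and NM = cofinite_module[OF N]
  obtain \<epsilon> where F: "free_resolution R RI (resolution R RI) \<epsilon>" using resolution_free by blast
  let ?F = "resolution R RI"
  have Fc: "?F \<in> complexes R" using F by (simp add: free_resolution_def)
  note cx = Hom_complex_in_complexes[OF Fc]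
  have "finitely_generated R (Ext R k RI M)" for k
    unfolding Ext_def
  proof (rule finitely_generated_middle)
    show "module R (cohomology (Hom_complex R ?F L) (int k))" by (rule module_cohomology[OF cx[OF LM]])
    show "module R (cohomology (Hom_complex R ?F M) (int k))" by (rule module_cohomology[OF cx[OF M]])
    show Nm: "module R (cohomology (Hom_complex R ?F N) (int k))" by (rule module_cohomology[OF cx[OF NM]])
    show "linear_map R (cohomology (Hom_complex R ?F L) (int k)) (cohomology (Hom_complex R ?F M) (int k))
      (induced_map (Hom_complex R ?F L) (Hom_complex R ?F M) (Hom_push ?F i) (int k))"
      by (rule induced_map_linear[OF cx[OF LM] cx[OF M] Hom_push_chain_linear[OF Fc LM M i]])
    show p': "linear_map R (cohomology (Hom_complex R ?F M) (int k)) (cohomology (Hom_complex R ?F N) (int k))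
      (induced_map (Hom_complex R ?F M) (Hom_complex R ?F N) (Hom_push ?F p) (int k))"
      by (rule induced_map_linear[OF cx[OF M] cx[OF NM] Hom_push_chain_linear[OF Fc M NM p]])
    show "finitely_generated R (cohomology (Hom_complex R ?F L) (int k))"
      using L unfolding M_cof_def Ext_def by blast
    have "finitely_generated R (cohomology (Hom_complex R ?F N) (int k))"
      using N unfolding M_cof_def Ext_def by blast
    then show "finitely_generated R ((cohomology (Hom_complex R ?F N) (int k))\<lparr>carrier :=
      induced_map (Hom_complex R ?F M) (Hom_complex R ?F N) (Hom_push ?F p) (int k) `
        carrier (cohomology (Hom_complex R ?F M) (int k))\<rparr>)"
      by (rule noetherian_submodule[OF noetherian Nm _
            submodule_range[OF module_cohomology[OF cx[OF M]] Nm p']])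
  qed (rule Ext_exact[OF F LM M NM i inj p sur ker])
  moreover have "Supp R M \<subseteq> V R \<aa>"
    using L N by (intro Supp_middle[OF LM M NM i p ker]) (simp_all add: M_cof_def)
  ultimately show ?thesis using M by (simp add: M_cof_def)
qed

text \<open>Every Hom module into zero is zero. The lemma supplies the zero kernel in
  \<open>cofinite_iso\<close> and the terms outside degree zero of
  \<open>degree_zero\<close>.\<close>

lemma cofinite_zero:
  assumes L: "module R L" and z: "carrier L = {\<zero>\<^bsub>L\<^esub>}"
  shows "L \<in> cofinite"
proof -
  obtain \<epsilon> where F: "free_resolution R RI (resolution R RI) \<epsilon>" using resolution_free by blast
  let ?H = "Hom_complex R (resolution R RI) L"
  have Fc: "resolution R RI \<in> complexes R" using F by (simp add: free_resolution_def)
  note cx = Hom_complex_in_complexes[OF Fc L]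
  have zero: "\<phi> = \<zero>\<^bsub>obj ?H n\<^esub>" if "\<phi> \<in> carrier (obj ?H n)" for \<phi> n
  proof -
    have \<phi>: "\<phi> \<in> module_hom R (obj (resolution R RI) (- n)) L"
      using that by (simp add: Hom_complex_obj hom_module_carrier)
    have "\<phi> = restrict \<phi> (carrier (obj (resolution R RI) (- n)))"
      using \<phi> by (simp add: module_hom_iff extensional_restrict)
    also have "\<dots> = (\<lambda>x\<in>carrier (obj (resolution R RI) (- n)). \<zero>\<^bsub>L\<^esub>)"
      using linear_map_closed[OF module_hom_linear[OF \<phi>]] z by (intro restrict_ext) auto
    finally show ?thesis by (simp add: Hom_complex_obj hom_module_def)
  qed
  have "finitely_generated R (cohomology ?H n)" for n
    unfolding finitely_generated_iff[OF module_cohomology[OF cx]]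
  proof (intro exI[of _ "{}"] conjI allI impI subsetI)
    fix H \<xi> assume H: "submodule H R (cohomology ?H n)" and "\<xi> \<in> carrier (cohomology ?H n)"
    then obtain \<phi> where \<phi>: "\<phi> \<in> cocycles ?H n" "\<xi> = cohomology_class ?H n \<phi>"
      by (metis cohomology_cases[OF cx])
    have "\<phi> \<in> coboundaries ?H n"
      using zero[of \<phi> n] \<phi>(1) submoduleD(2)[OF complexesD(1)[OF cx] submodule_coboundaries[OF cx]]
      by (simp add: cocycles_iff)
    then have "\<xi> = \<zero>\<^bsub>cohomology ?H n\<^esub>" using cohomology_class_zero_iff[OF cx \<phi>(1)] \<phi>(2) by simp
    then show "\<xi> \<in> H" using submoduleD(2)[OF module_cohomology[OF cx] H] by simp
  qed auto
  moreover have "Supp R L \<subseteq> V R \<aa>"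
    unfolding Supp_subset_V_iff[OF L]
  proof (intro allI impI ballI)
    interpret L: module R L by fact
    fix \<pp> m assume \<pp>: "primeideal \<pp> R" and m: "m \<in> carrier L"
    interpret p: primeideal \<pp> R by fact
    have "\<one>\<^bsub>R\<^esub> \<in> carrier R - \<pp>" using p.I_notcarr p.one_imp_carrier by blast
    moreover have "\<one>\<^bsub>R\<^esub> \<odot>\<^bsub>L\<^esub> m = \<zero>\<^bsub>L\<^esub>" using m z by simp
    ultimately show "\<exists>u\<in>carrier R - \<pp>. u \<odot>\<^bsub>L\<^esub> m = \<zero>\<^bsub>L\<^esub>" by blast
  qed
  ultimately show ?thesis using L by (simp add: M_cof_def Ext_def)
qed

text \<open>An isomorphism exhibits its source as an extension of its target by zero, so invariance
  of both the support and the Ext condition comes from closure under extensions, across element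
  types as well.\<close>

lemma cofinite_iso:
  assumes N: "N \<in> cofinite" and M: "module R M" and f: "linear_map R M N f"
    and bij: "bij_betw f (carrier M) (carrier N)"
  shows "M \<in> cofinite"
proof -
  interpret M: module R M by fact
  let ?L = "M\<lparr>carrier := {\<zero>\<^bsub>M\<^esub>}\<rparr>"
  have "?L \<in> cofinite"
    by (rule cofinite_zero[OF submodule_module[OF M submodule_zero[OF M]]]) simp
  then show ?thesis
  proof (rule cofinite_extension[OF _ N M _ _ f])
    show "linear_map R ?L M (\<lambda>x. x)" by (auto intro!: linear_mapI)
    show "a_kernel M N f \<subseteq> (\<lambda>x. x) ` carrier ?L"
      using bij linear_map_inj_iff[OF M cofinite_module[OF N] f] by (auto simp: a_kernel_iff bij_betw_def)
  qed (use bij in \<open>auto simp: bij_betw_def\<close>)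
qed

lemma cofinite_iso':
  assumes M: "M \<in> cofinite" and N: "module R N" and f: "linear_map R M N f"
    and bij: "bij_betw f (carrier M) (carrier N)"
  shows "N \<in> cofinite"
  by (rule cofinite_iso[OF M N linear_map_inv_into[OF cofinite_module[OF M] f bij] bij_betw_inv_into[OF bij]])

end

section \<open>The abelian hypothesis carried over to other element types\<close>

locale cofinite_abelian = noetherian_ideal R \<aa> for R :: "('a, 'r) ring_scheme" and \<aa> +
  fixes u :: "'u itself"
  assumes abelian: "abelian_subcategory R (M_cof R \<aa> :: ('a, 'u) module set)"
begin

text \<open>The hypothesis on \<open>'u\<close>-modules extends to every module whose elements inject into \<open>'u\<close>; this
  is how it reaches the cohomology modules, whose elements are cosets.\<close>

definition small :: "('a, 'b) module \<Rightarrow> bool" where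
  "small M \<longleftrightarrow> (\<exists>g :: 'b \<Rightarrow> 'u. inj_on g (carrier M))"

lemma small_transport:
  assumes M: "M \<in> cofinite" and "small M"
  obtains M' :: "('a, 'u) module" and g where "M' \<in> cofinite" "linear_map R M M' g"
    "bij_betw g (carrier M) (carrier M')"
proof -
  obtain g :: "'b \<Rightarrow> 'u" where g: "inj_on g (carrier M)" using assms(2) by (auto simp: small_def)
  note T = transport_module[OF cofinite_module[OF M] g]
  show ?thesis using that[OF cofinite_iso'[OF M T] T(2,3)] .
qed

text \<open>The map is conjugated by transports of source and target to modules on
  \<open>'u\<close>, the hypothesis is applied there, and \<open>g\<close> identifies the kernel
  with the one on \<open>'u\<close>.\<close>

lemma cofinite_kernel:
  assumes M: "M \<in> cofinite" "small M" and N: "N \<in> cofinite" "small N" and f: "linear_map R M N f"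
  shows "M\<lparr>carrier := a_kernel M N f\<rparr> \<in> cofinite"
proof -
  obtain M' :: "('a, 'u) module" and g where M': "M' \<in> cofinite" "linear_map R M M' g"
    "bij_betw g (carrier M) (carrier M')" using small_transport[OF M] .
  obtain N' :: "('a, 'u) module" and h where N': "N' \<in> cofinite" "linear_map R N N' h"
    "bij_betw h (carrier N) (carrier N')" using small_transport[OF N] .
  note mods = cofinite_module[OF M(1)] cofinite_module[OF N(1)] cofinite_module[OF M'(1)] cofinite_module[OF N'(1)]
  let ?g' = "inv_into (carrier M) g"
  note f' = linear_map_comp[OF linear_map_comp[OF linear_map_inv_into[OF mods(1) M'(2,3)] f] N'(2)]
  let ?f = "\<lambda>x\<in>carrier M'. h (f (?g' x))"
  have f'h: "?f \<in> module_hom R M' N'" by (rule restrict_in_module_hom[OF mods(3) f'])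
  let ?K = "M'\<lparr>carrier := a_kernel M' N' ?f\<rparr>"
  note Ksub = submodule_kernel[OF mods(3,4) module_hom_linear[OF f'h]]
  have K: "module R ?K" by (rule submodule_module[OF mods(3) Ksub])
  have "is_kernel R M' N' ?f ?K (\<lambda>x\<in>carrier ?K. x)"
    unfolding is_kernel_def
  proof (intro conjI K)
    show "(\<lambda>x\<in>carrier ?K. x) \<in> module_hom R ?K M'"
      using submoduleD(1)[OF mods(3) Ksub] by (intro restrict_in_module_hom[OF K] linear_mapI) auto
  qed (auto simp: inj_on_def)
  then have K': "?K \<in> cofinite" using abelian M'(1) N'(1) f'h unfolding abelian_subcategory_def by blast
  have gg: "?g' (g x) = x" if "x \<in> carrier M" for x
    using that M'(3) by (simp add: bij_betw_def)
  have hz: "h y = \<zero>\<^bsub>N'\<^esub> \<longleftrightarrow> y = \<zero>\<^bsub>N\<^esub>" if "y \<in> carrier N" for y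
    using N'(3) linear_map_inj_iff[OF mods(2,4) N'(2)] linear_map_zero[OF mods(2,4) N'(2)] that
    by (auto simp: bij_betw_def)
  have iff: "g x \<in> a_kernel M' N' ?f \<longleftrightarrow> x \<in> a_kernel M N f" if "x \<in> carrier M" for x
    using that hz linear_map_closed[OF f that] linear_map_closed[OF M'(2) that]
    by (simp add: a_kernel_iff gg)
  have sub: "submodule (a_kernel M N f) R M" by (rule submodule_kernel[OF mods(1,2) f])
  show ?thesis
  proof (rule cofinite_iso[OF K' submodule_module[OF mods(1) sub]])
    show "linear_map R (M\<lparr>carrier := a_kernel M N f\<rparr>) ?K g"
      using M'(2) iff submoduleD(1)[OF mods(1) sub] by (auto simp: linear_map_def)
    have "g ` a_kernel M N f = a_kernel M' N' ?f"
    proof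
      show "g ` a_kernel M N f \<subseteq> a_kernel M' N' ?f" using iff by (auto simp: a_kernel_iff)
      show "a_kernel M' N' ?f \<subseteq> g ` a_kernel M N f"
      proof
        fix y assume y: "y \<in> a_kernel M' N' ?f"
        then have "y \<in> g ` carrier M" using M'(3) by (auto simp: a_kernel_iff bij_betw_def)
        then show "y \<in> g ` a_kernel M N f" using y iff by auto
      qed
    qed
    moreover have "inj_on g (a_kernel M N f)"
      using M'(3) submoduleD(1)[OF mods(1) sub] by (auto simp: bij_betw_def intro: inj_on_subset)
    ultimately show "bij_betw g (carrier (M\<lparr>carrier := a_kernel M N f\<rparr>)) (carrier ?K)"
      by (simp add: bij_betw_def)
  qed
qed

text \<open>Exactness at \<open>Q\<close> makes the image of \<open>b\<close> a cokernel of
  \<open>a\<close>. The hypothesis speaks of cokernel objects on \<open>'u\<close>, so a copy of the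
  image on that type has to be produced first.\<close>

lemma cofinite_image:
  assumes P: "P \<in> cofinite" "small P" and Q: "Q \<in> cofinite" "small Q" and M: "module R M"
    and a: "linear_map R P Q a" and b: "linear_map R Q M b" and ex: "a_kernel Q M b = a ` carrier P"
  shows "M\<lparr>carrier := b ` carrier Q\<rparr> \<in> cofinite"
proof -
  obtain P' :: "('a, 'u) module" and g where P': "P' \<in> cofinite" "linear_map R P P' g"
    "bij_betw g (carrier P) (carrier P')" using small_transport[OF P] .
  obtain Q' :: "('a, 'u) module" and h where Q': "Q' \<in> cofinite" "linear_map R Q Q' h"
    "bij_betw h (carrier Q) (carrier Q')" using small_transport[OF Q] .
  note mods = cofinite_module[OF P(1)] cofinite_module[OF Q(1)] cofinite_module[OF P'(1)] cofinite_module[OF Q'(1)]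
  let ?I = "M\<lparr>carrier := b ` carrier Q\<rparr>"
  have I: "module R ?I" by (rule submodule_module[OF M submodule_range[OF mods(2) M b]])
  have b': "linear_map R Q ?I b" using b by (auto simp: linear_map_def)
  \<comment> \<open>The image of \<open>b\<close> inherits an injection into \<open>'u\<close> from
    \<open>Q\<close>: choose a preimage under \<open>b\<close>, then apply \<open>h\<close>.\<close>
  let ?j = "\<lambda>y. h (inv_into (carrier Q) b y)"
  have j: "inj_on ?j (carrier ?I)"
    using comp_inj_on[OF inj_on_inv_into[of "b ` carrier Q" b "carrier Q"], of h] Q'(3)
    by (auto simp: bij_betw_def comp_def inj_on_def inv_into_into)
  let ?C = "transport_module ?j ?I"
  note C = transport_module[OF I j]
  let ?g' = "inv_into (carrier P) g" and ?h' = "inv_into (carrier Q) h"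
  note a' = linear_map_comp[OF linear_map_comp[OF linear_map_inv_into[OF mods(1) P'(2,3)] a] Q'(2)]
  note c = linear_map_comp[OF linear_map_comp[OF linear_map_inv_into[OF mods(2) Q'(2,3)] b'] C(2)]
  let ?a = "\<lambda>x\<in>carrier P'. h (a (?g' x))" and ?c = "\<lambda>y\<in>carrier Q'. ?j (b (?h' y))"
  have ah: "?a \<in> module_hom R P' Q'" by (rule restrict_in_module_hom[OF mods(3) a'])
  have ch: "?c \<in> module_hom R Q' ?C" by (rule restrict_in_module_hom[OF mods(4) c])
  have gim: "?g' ` carrier P' = carrier P" and him: "?h' ` carrier Q' = carrier Q"
    using P'(3) Q'(3) bij_betw_imp_surj_on[OF bij_betw_inv_into] by blast+
  have hh: "?h' (h x) = x" if "x \<in> carrier Q" for x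
    using that Q'(3) by (simp add: bij_betw_def)
  have hh': "h (?h' y) = y" if "y \<in> carrier Q'" for y
    using that Q'(3) by (simp add: bij_betw_def f_inv_into_f)
  have "is_cokernel R P' Q' ?a ?C ?c"
    unfolding is_cokernel_def
  proof (intro conjI C(1) ch)
    have "?c ` carrier Q' = ?j ` b ` ?h' ` carrier Q'" by (simp add: image_image)
    then show "?c ` carrier Q' = carrier ?C" unfolding him by (simp add: transport_module_def)
    have "y \<in> a_kernel Q' ?C ?c \<longleftrightarrow> y \<in> ?a ` carrier P'" if y: "y \<in> carrier Q'" for y
    proof -
      have h'y: "?h' y \<in> carrier Q" using him y by blast
      have "y \<in> a_kernel Q' ?C ?c \<longleftrightarrow> ?j (b (?h' y)) = \<zero>\<^bsub>?C\<^esub>" using y by (simp add: a_kernel_iff)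
      also have "\<dots> \<longleftrightarrow> b (?h' y) = \<zero>\<^bsub>M\<^esub>"
        using linear_map_inj_iff[OF I C(1,2)] j h'y linear_map_zero[OF I C(1,2)] by auto
      also have "\<dots> \<longleftrightarrow> ?h' y \<in> a ` carrier P" using h'y unfolding ex[symmetric] by (simp add: a_kernel_iff)
      also have "\<dots> \<longleftrightarrow> y \<in> h ` a ` carrier P"
        using hh' y hh linear_map_closed[OF a] by (auto simp: image_iff) metis
      also have "h ` a ` carrier P = h ` a ` ?g' ` carrier P'" by (simp only: gim)
      also have "\<dots> = ?a ` carrier P'" by (simp add: image_image)
      finally show ?thesis .
    qed
    moreover have "?a ` carrier P' \<subseteq> carrier Q'" using linear_map_closed[OF module_hom_linear[OF ah]] by blast
    ultimately show "a_kernel Q' ?C ?c = ?a ` carrier P'" by (auto simp: a_kernel_iff)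
  qed
  then have "?C \<in> cofinite" using abelian P'(1) Q'(1) ah unfolding abelian_subcategory_def by blast
  then show ?thesis by (rule cofinite_iso[OF _ I C(2,3)])
qed

lemma cofinite_five:
  assumes P: "P \<in> cofinite" "small P" and Q: "Q \<in> cofinite" "small Q" and M: "module R M"
    and S: "S \<in> cofinite" "small S" and T: "T \<in> cofinite" "small T"
    and a: "linear_map R P Q a" and b: "linear_map R Q M b" and c: "linear_map R M S c"
    and d: "linear_map R S T d"
    and exQ: "a_kernel Q M b = a ` carrier P" and exM: "a_kernel M S c = b ` carrier Q"
    and exS: "a_kernel S T d = c ` carrier M"
  shows "M \<in> cofinite"
proof (rule cofinite_extension[OF cofinite_image[OF P Q M a b exQ] cofinite_kernel[OF S T d] M])
  have "b ` carrier Q \<subseteq> carrier M" using linear_map_closed[OF b] by blast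
  then show "linear_map R (M\<lparr>carrier := b ` carrier Q\<rparr>) M (\<lambda>x. x)" by (auto intro!: linear_mapI)
  show "linear_map R M (S\<lparr>carrier := a_kernel S T d\<rparr>) c"
    using c unfolding exS by (auto simp: linear_map_def)
  show "a_kernel M (S\<lparr>carrier := a_kernel S T d\<rparr>) c \<subseteq> (\<lambda>x. x) ` carrier (M\<lparr>carrier := b ` carrier Q\<rparr>)"
    using exM by (simp add: a_kernel_def kernel_def)
qed (use exS in auto)

end

lemma cohomology_carrier:
  assumes "X \<in> complexes R"
  shows "carrier (cohomology X n) = cohomology_class X n ` cocycles X n"
  using cohomology_class_closed[OF assms] by (auto elim!: cohomology_cases[OF assms])

section \<open>Cones, sums and shifts\<close>

lemma (in abelian_group) neg_zero: "\<ominus> \<zero> = \<zero>"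
  by simp

lemma (in abelian_group) neg_eq_zero_iff: "x \<in> carrier G \<Longrightarrow> \<ominus> x = \<zero> \<longleftrightarrow> x = \<zero>"
  by simp

lemma sum_module_simps [simp]:
  "UPair x y \<in> carrier (sum_module M N) \<longleftrightarrow> x \<in> carrier M \<and> y \<in> carrier N"
  "\<zero>\<^bsub>sum_module M N\<^esub> = UPair \<zero>\<^bsub>M\<^esub> \<zero>\<^bsub>N\<^esub>"
  "UPair x y \<oplus>\<^bsub>sum_module M N\<^esub> UPair x' y' = UPair (x \<oplus>\<^bsub>M\<^esub> x') (y \<oplus>\<^bsub>N\<^esub> y')"
  "r \<odot>\<^bsub>sum_module M N\<^esub> UPair x y = UPair (r \<odot>\<^bsub>M\<^esub> x) (r \<odot>\<^bsub>N\<^esub> y)"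
  by (simp_all add: sum_module_def)

lemma sum_module_cases:
  assumes "p \<in> carrier (sum_module M N)"
  obtains x y where "p = UPair x y" "x \<in> carrier M" "y \<in> carrier N"
  using assms by (auto simp: sum_module_def)

lemma module_sum_module:
  assumes "module R M" "module R N"
  shows "module R (sum_module M N)"
proof -
  interpret M: module R M by fact
  interpret N: module R N by fact
  show ?thesis
  proof (rule moduleI)
    show "abelian_group (sum_module M N)"
    proof (rule abelian_groupI)
      fix p assume "p \<in> carrier (sum_module M N)"
      then obtain x y where p: "p = UPair x y" "x \<in> carrier M" "y \<in> carrier N" by (rule sum_module_cases)
      then show "\<exists>q\<in>carrier (sum_module M N). q \<oplus>\<^bsub>sum_module M N\<^esub> p = \<zero>\<^bsub>sum_module M N\<^esub>"
        by (intro bexI[of _ "UPair (\<ominus>\<^bsub>M\<^esub> x) (\<ominus>\<^bsub>N\<^esub> y)"]) (auto simp: M.M.l_neg N.M.l_neg)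
    qed (auto elim!: sum_module_cases simp: M.M.a_ac N.M.a_ac)
  qed (auto elim!: sum_module_cases simp: M.smult_l_distr M.smult_r_distr M.smult_assoc1
      N.smult_l_distr N.smult_r_distr N.smult_assoc1 intro: M.R.is_cring cring.axioms)
qed

lemma sum_module_minus:
  assumes "module R M" "module R N" "x \<in> carrier M" "x' \<in> carrier M" "y \<in> carrier N" "y' \<in> carrier N"
  shows "UPair x y \<ominus>\<^bsub>sum_module M N\<^esub> UPair x' y' = UPair (x \<ominus>\<^bsub>M\<^esub> x') (y \<ominus>\<^bsub>N\<^esub> y')"
proof -
  interpret M: module R M by fact
  interpret N: module R N by fact
  interpret S: module R "sum_module M N" by (rule module_sum_module) fact+
  have "UPair x' y' \<in> carrier (sum_module M N)" using assms by simp
  then show ?thesis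
    using assms by (simp add: a_minus_def S.neg_eq_smult M.neg_eq_smult N.neg_eq_smult)
qed

lemma shift_simps:
  "obj (shift X) n = obj X (n + 1)"
  "x \<in> carrier (obj X (n + 1)) \<Longrightarrow> diff (shift X) n x = \<ominus>\<^bsub>obj X (n + 1 + 1)\<^esub> diff X (n + 1) x"
  by (simp_all add: shift_def)

lemma linear_map_uminus:
  assumes "module R M" "module R N" "linear_map R M N f"
  shows "linear_map R M N (\<lambda>x. \<ominus>\<^bsub>N\<^esub> f x)"
proof -
  interpret M: module R M by fact
  interpret N: module R N by fact
  show ?thesis
    by (rule linear_mapI)
      (simp_all add: linear_map_simps[OF assms(3)] N.M.minus_add N.smult_r_minus)
qed

lemma shift_in_complexes:
  assumes X: "X \<in> complexes R"
  shows "shift X \<in> complexes R"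
proof -
  note M = complexesD(1)[OF X] and d = complexesD(2)[OF X]
  have "diff (shift X) n \<in> module_hom R (obj (shift X) n) (obj (shift X) (n + 1))" for n
    unfolding shift_def cochain.simps
    by (rule restrict_in_module_hom[OF M linear_map_uminus[OF M M d]])
  moreover have "diff (shift X) (n + 1) (diff (shift X) n x) = \<zero>\<^bsub>obj (shift X) (n + 1 + 1)\<^esub>"
    if x: "x \<in> carrier (obj (shift X) n)" for n x
  proof -
    interpret M2: module R "obj X (n + 1 + 1)" by (rule M)
    interpret M3: module R "obj X (n + 1 + 1 + 1)" by (rule M)
    have x': "x \<in> carrier (obj X (n + 1))" using x by (simp only: shift_simps)
    note dx = linear_map_closed[OF d x']
    have "diff (shift X) (n + 1) (diff (shift X) n x) =
      \<ominus>\<^bsub>obj X (n + 1 + 1 + 1)\<^esub> diff X (n + 1 + 1) (\<ominus>\<^bsub>obj X (n + 1 + 1)\<^esub> diff X (n + 1) x)"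
      unfolding shift_simps(2)[OF x'] by (rule shift_simps(2)[OF M2.M.a_inv_closed[OF dx]])
    also have "\<dots> = \<zero>\<^bsub>obj X (n + 1 + 1 + 1)\<^esub>"
      unfolding linear_map_neg[OF M M d dx] complexesD(4)[OF X x'] by (simp only: M3.M.neg_zero)
    finally show ?thesis by (simp only: shift_simps)
  qed
  moreover have "module R (obj (shift X) n)" for n unfolding shift_simps by (rule M)
  ultimately show ?thesis unfolding complexes_def by blast
qed

lemma cocycles_shift:
  assumes X: "X \<in> complexes R"
  shows "cocycles (shift X) n = cocycles X (n + 1)"
proof -
  interpret M: module R "obj X (n + 1 + 1)" by (rule complexesD(1)[OF X])
  have "x \<in> cocycles (shift X) n \<longleftrightarrow> x \<in> cocycles X (n + 1)" for x
  proof (cases "x \<in> carrier (obj X (n + 1))")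
    case True
    have "diff X (n + 1) x \<in> carrier (obj X (n + 1 + 1))"
      by (rule linear_map_closed[OF complexesD(2)[OF X] True])
    then show ?thesis
      unfolding cocycles_iff shift_simps(1) shift_simps(2)[OF True]
      by (simp only: M.M.neg_eq_zero_iff)
  qed (simp add: cocycles_iff shift_simps)
  then show ?thesis by blast
qed

lemma coboundaries_shift_Suc:
  "coboundaries (shift X) (n + 1) =
    (\<lambda>x. \<ominus>\<^bsub>obj X (n + 1 + 1)\<^esub> diff X (n + 1) x) ` carrier (obj X (n + 1))"
  unfolding coboundaries_Suc shift_simps(1) by (auto simp: shift_simps(2) simp del: add.assoc)

text \<open>The sign in the differential of the shift is absorbed by negating the argument, so the
  set of coboundaries is the same.\<close>

lemma coboundaries_shift:
  assumes X: "X \<in> complexes R"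
  shows "coboundaries (shift X) n = coboundaries X (n + 1)"
proof -
  have *: "coboundaries (shift X) (m + 1) = coboundaries X (m + 1 + 1)" for m
  proof -
    note M = complexesD(1)[OF X] and d = complexesD(2)[OF X]
    interpret M: module R "obj X (m + 1)" by (rule M)
    interpret M1: module R "obj X (m + 1 + 1)" by (rule M)
    have neg: "\<ominus>\<^bsub>obj X (m + 1 + 1)\<^esub> diff X (m + 1) x = diff X (m + 1) (\<ominus>\<^bsub>obj X (m + 1)\<^esub> x)"
      "diff X (m + 1) x = \<ominus>\<^bsub>obj X (m + 1 + 1)\<^esub> diff X (m + 1) (\<ominus>\<^bsub>obj X (m + 1)\<^esub> x)"
      if "x \<in> carrier (obj X (m + 1))" for x
      using that linear_map_closed[OF d that]
      by (simp_all only: linear_map_neg[OF M M d] M1.M.minus_minus)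
    show ?thesis unfolding coboundaries_shift_Suc unfolding coboundaries_Suc
    proof (intro equalityI image_subsetI)
      fix x assume x: "x \<in> carrier (obj X (m + 1))"
      show "\<ominus>\<^bsub>obj X (m + 1 + 1)\<^esub> diff X (m + 1) x \<in> diff X (m + 1) ` carrier (obj X (m + 1))"
        unfolding neg(1)[OF x] by (rule imageI[OF M.M.a_inv_closed[OF x]])
      show "diff X (m + 1) x \<in> (\<lambda>x. \<ominus>\<^bsub>obj X (m + 1 + 1)\<^esub> diff X (m + 1) x) ` carrier (obj X (m + 1))"
        by (rule image_eqI) (rule neg(2)[OF x], rule M.M.a_inv_closed[OF x])
    qed
  qed
  show ?thesis using *[of "n - 1"] by simp
qed

text \<open>The sign changes neither cocycles nor coboundaries, hence the modules are equal and not
  merely isomorphic. The long exact sequence can then be rewritten in terms of \<open>X\<close>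
  alone.\<close>

lemma cohomology_shift:
  assumes "X \<in> complexes R"
  shows "cohomology (shift X) n = cohomology X (n + 1)"
  by (simp add: cohomology_def cocycles_shift[OF assms] coboundaries_shift[OF assms] shift_simps)

section \<open>The mapping cone and its long exact cohomology sequence\<close>

lemma cone_simps:
  "obj (cone X Y f) n = sum_module (obj X (n + 1)) (obj Y n)"
  "x \<in> carrier (obj X (n + 1)) \<Longrightarrow> y \<in> carrier (obj Y n) \<Longrightarrow> diff (cone X Y f) n (UPair x y) =
    UPair (\<ominus>\<^bsub>obj X (n + 1 + 1)\<^esub> diff X (n + 1) x) (f (n + 1) x \<oplus>\<^bsub>obj Y (n + 1)\<^esub> diff Y n y)"
  by (simp_all add: cone_def)

context
  fixes R :: "('a, 'r) ring_scheme" and X Y :: "('a, ('a, 'i) univ) cochain"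
    and f :: "int \<Rightarrow> ('a, 'i) univ \<Rightarrow> ('a, 'i) univ"
  assumes X: "X \<in> complexes R" and Y: "Y \<in> complexes R" and f: "f \<in> chain_maps R X Y"
begin

lemma chain_map_linear: "linear_map R (obj X n) (obj Y n) (f n)"
  by (rule chain_linearD(1)[OF chain_maps_linear[OF f]])

lemma chain_map_diff: "x \<in> carrier (obj X n) \<Longrightarrow> f (n + 1) (diff X n x) = diff Y n (f n x)"
  by (rule chain_linearD(2)[OF chain_maps_linear[OF f]])

lemma module_cone: "module R (obj (cone X Y f) n)"
  unfolding cone_simps by (rule module_sum_module[OF complexesD(1)[OF X] complexesD(1)[OF Y]])

lemma cone_closed:
  assumes "x \<in> carrier (obj X (n + 1))" "y \<in> carrier (obj Y n)"
  shows "f (n + 1) x \<in> carrier (obj Y (n + 1))" "diff Y n y \<in> carrier (obj Y (n + 1))"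
    "diff X (n + 1) x \<in> carrier (obj X (n + 1 + 1))"
  using linear_map_closed[OF chain_map_linear assms(1)] linear_map_closed[OF complexesD(2)[OF Y] assms(2)]
    linear_map_closed[OF complexesD(2)[OF X] assms(1)] .

lemma cone_in_complexes: "cone X Y f \<in> complexes R"
proof -
  let ?C = "cone X Y f"
  note MX = complexesD(1)[OF X] and MY = complexesD(1)[OF Y]
  note dX = complexesD(2)[OF X] and dY = complexesD(2)[OF Y]
  have lin: "linear_map R (obj ?C n) (obj ?C (n + 1)) (diff ?C n)" for n
  proof (rule linear_mapI)
    interpret X1: module R "obj X (n + 1)" by (rule MX)
    interpret X2: module R "obj X (n + 1 + 1)" by (rule MX)
    interpret Y0: module R "obj Y n" by (rule MY)
    interpret Y1: module R "obj Y (n + 1)" by (rule MY)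
    note cl = cone_closed
    fix p assume "p \<in> carrier (obj ?C n)"
    then obtain x y where p: "p = UPair x y" "x \<in> carrier (obj X (n + 1))" "y \<in> carrier (obj Y n)"
      unfolding cone_simps by (rule sum_module_cases)
    note clp = cl[OF p(2,3)]
    show "diff ?C n p \<in> carrier (obj ?C (n + 1))"
      unfolding p(1) cone_simps(1) cone_simps(2)[OF p(2,3)] sum_module_simps
      using clp by (intro conjI X2.M.a_inv_closed Y1.M.a_closed)
    {
      fix q assume "q \<in> carrier (obj ?C n)"
      then obtain z w where q: "q = UPair z w" "z \<in> carrier (obj X (n + 1))" "w \<in> carrier (obj Y n)"
        unfolding cone_simps by (rule sum_module_cases)
      note clq = cl[OF q(2,3)]
      show "diff ?C n (p \<oplus>\<^bsub>obj ?C n\<^esub> q) = diff ?C n p \<oplus>\<^bsub>obj ?C (n + 1)\<^esub> diff ?C n q"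
        unfolding p(1) q(1) cone_simps(1) sum_module_simps cone_simps(2)[OF p(2,3)] cone_simps(2)[OF q(2,3)]
          cone_simps(2)[OF X1.M.a_closed[OF p(2) q(2)] Y0.M.a_closed[OF p(3) q(3)]]
          linear_map_add[OF dX p(2) q(2)] linear_map_add[OF dY p(3) q(3)] linear_map_add[OF chain_map_linear p(2) q(2)]
        using clp clq by (simp only: X2.M.minus_add Y1.M.a_ac Y1.M.a_closed)
    }
    fix r assume r: "r \<in> carrier R"
    show "diff ?C n (r \<odot>\<^bsub>obj ?C n\<^esub> p) = r \<odot>\<^bsub>obj ?C (n + 1)\<^esub> diff ?C n p"
      unfolding p(1) cone_simps(1) sum_module_simps cone_simps(2)[OF p(2,3)]
          cone_simps(2)[OF X1.smult_closed[OF r p(2)] Y0.smult_closed[OF r p(3)]]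
          linear_map_smult[OF dX r p(2)] linear_map_smult[OF dY r p(3)] linear_map_smult[OF chain_map_linear r p(2)]
      using clp r by (simp only: X2.smult_r_minus Y1.smult_r_distr)
  qed
  have dd: "diff ?C (n + 1) (diff ?C n p) = \<zero>\<^bsub>obj ?C (n + 1 + 1)\<^esub>" if "p \<in> carrier (obj ?C n)" for n p
  proof -
    interpret X2: module R "obj X (n + 1 + 1)" by (rule MX)
    interpret X3: module R "obj X (n + 1 + 1 + 1)" by (rule MX)
    interpret Y1: module R "obj Y (n + 1)" by (rule MY)
    interpret Y2: module R "obj Y (n + 1 + 1)" by (rule MY)
    obtain x y where p: "p = UPair x y" "x \<in> carrier (obj X (n + 1))" "y \<in> carrier (obj Y n)"
      using \<open>p \<in> carrier (obj ?C n)\<close> unfolding cone_simps by (rule sum_module_cases)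
    note clp = cone_closed[OF p(2,3)]
    note fl = linear_map_closed[OF chain_map_linear p(2)]
    \<comment> \<open>The second component of the squared differential is f(-dx) + d(f x), which
      vanishes because of the sign in the first component.\<close>
    have dfx: "diff Y (n + 1) (f (n + 1) x) \<in> carrier (obj Y (n + 1 + 1))"
      by (rule linear_map_closed[OF dY fl])
    show ?thesis
      unfolding p(1) cone_simps(2)[OF p(2,3)] cone_simps(1) sum_module_simps
        cone_simps(2)[OF X2.M.a_inv_closed[OF clp(3)] Y1.M.a_closed[OF clp(1,2)]]
        linear_map_neg[OF MX MX dX clp(3)] linear_map_neg[OF MX MY chain_map_linear clp(3)]
        linear_map_add[OF dY clp(1,2)] chain_map_diff[OF p(2)] complexesD(4)[OF X p(2)] complexesD(4)[OF Y p(3)]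
      using dfx by (simp only: X3.M.minus_minus X3.M.neg_zero Y2.M.r_zero Y2.M.l_neg X3.M.zero_closed)
  qed
  have "diff ?C n \<in> extensional (carrier (obj ?C n))" for n by (simp add: cone_def)
  then show ?thesis
    unfolding complexes_def module_hom_iff mem_Collect_eq using module_cone lin dd by blast
qed

lemma cone_incl_chain: "cone_incl X Y \<in> chain_maps R Y (cone X Y f)"
proof -
  note MX = complexesD(1)[OF X] and MY = complexesD(1)[OF Y]
  let ?C = "cone X Y f"
  have "cone_incl X Y n \<in> module_hom R (obj Y n) (obj ?C n)" for n
  proof -
    interpret X1: module R "obj X (n + 1)" by (rule MX)
    interpret Y0: module R "obj Y n" by (rule MY)
    show ?thesis unfolding cone_incl_def cone_simps
      by (rule restrict_in_module_hom[OF MY linear_mapI]) auto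
  qed
  moreover have "cone_incl X Y (n + 1) (diff Y n y) = diff ?C n (cone_incl X Y n y)"
    if y: "y \<in> carrier (obj Y n)" for n y
  proof -
    interpret X1: module R "obj X (n + 1)" by (rule MX)
    interpret X2: module R "obj X (n + 1 + 1)" by (rule MX)
    interpret Y1: module R "obj Y (n + 1)" by (rule MY)
    note dy = linear_map_closed[OF complexesD(2)[OF Y] y]
    show ?thesis
      unfolding cone_incl_def restrict_apply'[OF y] restrict_apply'[OF dy]
        cone_simps(2)[OF X1.M.zero_closed y] linear_map_zero[OF MX MX complexesD(2)[OF X]]
        linear_map_zero[OF MX MY chain_map_linear]
      by (simp only: X2.M.neg_zero Y1.M.l_zero[OF dy])
  qed
  ultimately show ?thesis by (simp add: chain_maps_def)
qed

lemma cone_proj_chain: "cone_proj X Y \<in> chain_maps R (cone X Y f) (shift X)"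
proof -
  note MX = complexesD(1)[OF X] and MY = complexesD(1)[OF Y]
  let ?C = "cone X Y f"
  have "cone_proj X Y n \<in> module_hom R (obj ?C n) (obj (shift X) n)" for n
    unfolding cone_proj_def cone_simps shift_simps
    by (rule restrict_in_module_hom[OF module_sum_module[OF MX MY] linear_mapI])
      (auto elim!: sum_module_cases)
  moreover have "cone_proj X Y (n + 1) (diff ?C n p) = diff (shift X) n (cone_proj X Y n p)"
    if pC: "p \<in> carrier (obj ?C n)" for n p
  proof -
    obtain x y where p: "p = UPair x y" "x \<in> carrier (obj X (n + 1))" "y \<in> carrier (obj Y n)"
      using \<open>p \<in> carrier (obj ?C n)\<close> unfolding cone_simps by (rule sum_module_cases)
    have dp: "diff ?C n p \<in> carrier (sum_module (obj X (n + 1 + 1)) (obj Y (n + 1)))"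
      using linear_map_closed[OF complexesD(2)[OF cone_in_complexes] pC] unfolding cone_simps .
    have p': "p \<in> carrier (sum_module (obj X (n + 1)) (obj Y n))" using pC unfolding cone_simps .
    show ?thesis
      unfolding cone_proj_def restrict_apply'[OF dp] restrict_apply'[OF p']
      unfolding p(1) cone_simps(2)[OF p(2,3)] univ.sel shift_simps(2)[OF p(2)] ..
  qed
  ultimately show ?thesis by (simp add: chain_maps_def)
qed

lemmas cone_chain = chain_maps_linear[OF f] chain_maps_linear[OF cone_incl_chain]
  chain_maps_linear[OF cone_proj_chain]

lemma cone_cocycles_iff:
  assumes "x \<in> carrier (obj X (n + 1))" "y \<in> carrier (obj Y n)"
  shows "UPair x y \<in> cocycles (cone X Y f) n \<longleftrightarrow>
    diff X (n + 1) x = \<zero>\<^bsub>obj X (n + 1 + 1)\<^esub> \<and> f (n + 1) x \<oplus>\<^bsub>obj Y (n + 1)\<^esub> diff Y n y = \<zero>\<^bsub>obj Y (n + 1)\<^esub>"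
proof -
  interpret X2: module R "obj X (n + 1 + 1)" by (rule complexesD(1)[OF X])
  have "\<ominus>\<^bsub>obj X (n + 1 + 1)\<^esub> diff X (n + 1) x = \<zero>\<^bsub>obj X (n + 1 + 1)\<^esub> \<longleftrightarrow>
      diff X (n + 1) x = \<zero>\<^bsub>obj X (n + 1 + 1)\<^esub>"
    by (rule X2.M.neg_eq_zero_iff[OF cone_closed(3)[OF assms]])
  then show ?thesis
    unfolding cocycles_iff cone_simps(1) cone_simps(2)[OF assms] sum_module_simps univ.inject
    using assms by blast
qed

lemma cone_coboundaries_Suc:
  "coboundaries (cone X Y f) (n + 1) =
    {UPair (\<ominus>\<^bsub>obj X (n + 1 + 1)\<^esub> diff X (n + 1) x) (f (n + 1) x \<oplus>\<^bsub>obj Y (n + 1)\<^esub> diff Y n y) | x y.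
      x \<in> carrier (obj X (n + 1)) \<and> y \<in> carrier (obj Y n)}" (is "_ = ?R")
proof
  show "coboundaries (cone X Y f) (n + 1) \<subseteq> ?R"
    unfolding coboundaries_Suc
  proof
    fix b assume "b \<in> diff (cone X Y f) n ` carrier (obj (cone X Y f) n)"
    then obtain p where "p \<in> carrier (obj (cone X Y f) n)" "b = diff (cone X Y f) n p" by blast
    then show "b \<in> ?R"
      unfolding cone_simps(1) by (elim sum_module_cases) (use cone_simps(2) in blast)
  qed
  show "?R \<subseteq> coboundaries (cone X Y f) (n + 1)"
    unfolding coboundaries_Suc
  proof
    fix b assume "b \<in> ?R"
    then obtain x y where xy: "x \<in> carrier (obj X (n + 1))" "y \<in> carrier (obj Y n)"
      "b = UPair (\<ominus>\<^bsub>obj X (n + 1 + 1)\<^esub> diff X (n + 1) x) (f (n + 1) x \<oplus>\<^bsub>obj Y (n + 1)\<^esub> diff Y n y)"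
      by blast
    have "UPair x y \<in> carrier (obj (cone X Y f) n)" using xy unfolding cone_simps by simp
    then show "b \<in> diff (cone X Y f) n ` carrier (obj (cone X Y f) n)"
      unfolding xy(3) cone_simps(2)[OF xy(1,2), symmetric] by blast
  qed
qed

text \<open>The pair (0, y) is a coboundary of the cone exactly when 0 = -dx and y = f x + dz for
  some x and z, that is, when y differs from the image of a cocycle x by a coboundary.\<close>

lemma cone_exact_Y:
  "a_kernel (cohomology Y (n + 1)) (cohomology (cone X Y f) (n + 1))
      (induced_map Y (cone X Y f) (cone_incl X Y) (n + 1)) =
    induced_map X Y f (n + 1) ` carrier (cohomology X (n + 1))"
proof -
  let ?C = "cone X Y f"
  note MX = complexesD(1)[OF X] and MY = complexesD(1)[OF Y] and C = cone_in_complexes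
  note dX = complexesD(2)[OF X] and dY = complexesD(2)[OF Y]
  interpret X1: module R "obj X (n + 1)" by (rule MX)
  interpret X2: module R "obj X (n + 1 + 1)" by (rule MX)
  interpret Y0: module R "obj Y n" by (rule MY)
  interpret Y1: module R "obj Y (n + 1)" by (rule MY)
  have incl: "cone_incl X Y (n + 1) y = UPair \<zero>\<^bsub>obj X (n + 1 + 1)\<^esub> y" if "y \<in> cocycles Y (n + 1)" for y
    using that by (simp add: cone_incl_def cocycles_iff)
  have key: "UPair \<zero>\<^bsub>obj X (n + 1 + 1)\<^esub> y \<in> coboundaries ?C (n + 1) \<longleftrightarrow>
    (\<exists>x\<in>cocycles X (n + 1). y \<ominus>\<^bsub>obj Y (n + 1)\<^esub> f (n + 1) x \<in> coboundaries Y (n + 1))"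
    if y: "y \<in> carrier (obj Y (n + 1))" for y
  proof
    assume "UPair \<zero>\<^bsub>obj X (n + 1 + 1)\<^esub> y \<in> coboundaries ?C (n + 1)"
    then obtain x z where xz: "x \<in> carrier (obj X (n + 1))" "z \<in> carrier (obj Y n)"
      "\<zero>\<^bsub>obj X (n + 1 + 1)\<^esub> = \<ominus>\<^bsub>obj X (n + 1 + 1)\<^esub> diff X (n + 1) x"
      "y = f (n + 1) x \<oplus>\<^bsub>obj Y (n + 1)\<^esub> diff Y n z"
      unfolding cone_coboundaries_Suc mem_Collect_eq univ.inject by blast
    note cl = cone_closed[OF xz(1,2)]
    have "diff X (n + 1) x = \<zero>\<^bsub>obj X (n + 1 + 1)\<^esub>"
      using xz(3)[symmetric] unfolding X2.M.neg_eq_zero_iff[OF cl(3)] .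
    then have "x \<in> cocycles X (n + 1)" using xz(1) by (simp only: cocycles_iff)
    moreover have "y \<ominus>\<^bsub>obj Y (n + 1)\<^esub> f (n + 1) x = diff Y n z"
      using cl(1,2) unfolding xz(4)
      by (simp add: a_minus_def Y1.M.a_assoc Y1.M.a_comm[of "f (n + 1) x"] Y1.M.r_neg)
    ultimately show "\<exists>x\<in>cocycles X (n + 1). y \<ominus>\<^bsub>obj Y (n + 1)\<^esub> f (n + 1) x \<in> coboundaries Y (n + 1)"
      unfolding coboundaries_Suc using xz(2) by auto
  next
    assume "\<exists>x\<in>cocycles X (n + 1). y \<ominus>\<^bsub>obj Y (n + 1)\<^esub> f (n + 1) x \<in> coboundaries Y (n + 1)"
    then obtain x where x: "x \<in> cocycles X (n + 1)"
      and b: "y \<ominus>\<^bsub>obj Y (n + 1)\<^esub> f (n + 1) x \<in> coboundaries Y (n + 1)" by (rule bexE)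
    obtain z where z: "y \<ominus>\<^bsub>obj Y (n + 1)\<^esub> f (n + 1) x = diff Y n z" "z \<in> carrier (obj Y n)"
      using b unfolding coboundaries_Suc by (rule imageE)
    have xz: "x \<in> carrier (obj X (n + 1))" "diff X (n + 1) x = \<zero>\<^bsub>obj X (n + 1 + 1)\<^esub>"
      "z \<in> carrier (obj Y n)" "y \<ominus>\<^bsub>obj Y (n + 1)\<^esub> f (n + 1) x = diff Y n z"
      using x z unfolding cocycles_iff by (simp_all only:)
    note cl = cone_closed[OF xz(1,3)]
    have "f (n + 1) x \<oplus>\<^bsub>obj Y (n + 1)\<^esub> diff Y n z = y"
      using cl(1) y unfolding xz(4)[symmetric]
      by (simp add: a_minus_def Y1.M.a_lcomm Y1.M.r_neg)
    moreover have "\<ominus>\<^bsub>obj X (n + 1 + 1)\<^esub> diff X (n + 1) x = \<zero>\<^bsub>obj X (n + 1 + 1)\<^esub>"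
      unfolding xz(2) by (rule X2.M.neg_zero)
    ultimately show "UPair \<zero>\<^bsub>obj X (n + 1 + 1)\<^esub> y \<in> coboundaries ?C (n + 1)"
      unfolding cone_coboundaries_Suc using xz(1,3) by force
  qed
  have iff: "cohomology_class Y (n + 1) y \<in> a_kernel (cohomology Y (n + 1)) (cohomology ?C (n + 1))
      (induced_map Y ?C (cone_incl X Y) (n + 1)) \<longleftrightarrow>
    cohomology_class Y (n + 1) y \<in> induced_map X Y f (n + 1) ` carrier (cohomology X (n + 1))"
    if y: "y \<in> cocycles Y (n + 1)" for y
  proof -
    have "cohomology_class Y (n + 1) y \<in> a_kernel (cohomology Y (n + 1)) (cohomology ?C (n + 1))
      (induced_map Y ?C (cone_incl X Y) (n + 1)) \<longleftrightarrow> cone_incl X Y (n + 1) y \<in> coboundaries ?C (n + 1)"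
      using cohomology_class_closed[OF Y y] induced_map_class[OF Y C cone_chain(2) y]
        cohomology_class_zero_iff[OF C chain_cocycles[OF Y C cone_chain(2) y]]
      by (simp only: a_kernel_iff simp_thms)
    also have "\<dots> \<longleftrightarrow> (\<exists>x\<in>cocycles X (n + 1). y \<ominus>\<^bsub>obj Y (n + 1)\<^esub> f (n + 1) x \<in> coboundaries Y (n + 1))"
      unfolding incl[OF y] by (rule key) (use y in \<open>simp only: cocycles_iff\<close>)
    also have "\<dots> \<longleftrightarrow> (\<exists>x\<in>cocycles X (n + 1). cohomology_class Y (n + 1) y =
        induced_map X Y f (n + 1) (cohomology_class X (n + 1) x))"
      using cohomology_class_eq_iff[OF Y y chain_cocycles[OF X Y cone_chain(1)]]
        induced_map_class[OF X Y cone_chain(1)] by (metis (no_types, lifting))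
    also have "\<dots> \<longleftrightarrow> cohomology_class Y (n + 1) y \<in> induced_map X Y f (n + 1) ` carrier (cohomology X (n + 1))"
      unfolding cohomology_carrier[OF X] by blast
    finally show ?thesis .
  qed
  have sub: "induced_map X Y f (n + 1) ` carrier (cohomology X (n + 1)) \<subseteq> carrier (cohomology Y (n + 1))"
    using linear_map_closed[OF induced_map_linear[OF X Y cone_chain(1)]] by blast
  show ?thesis
  proof (rule Set.set_eqI)
    fix \<xi>
    show "\<xi> \<in> a_kernel (cohomology Y (n + 1)) (cohomology (cone X Y f) (n + 1))
        (induced_map Y (cone X Y f) (cone_incl X Y) (n + 1)) \<longleftrightarrow>
      \<xi> \<in> induced_map X Y f (n + 1) ` carrier (cohomology X (n + 1))"
    proof (cases "\<xi> \<in> carrier (cohomology Y (n + 1))")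
      case True
      then obtain y where "y \<in> cocycles Y (n + 1)" "\<xi> = cohomology_class Y (n + 1) y"
        unfolding cohomology_carrier[OF Y] by blast
      then show ?thesis using iff by (simp only:)
    next
      case False
      then show ?thesis using sub unfolding a_kernel_iff by blast
    qed
  qed
qed

text \<open>If the first component of a cocycle (x, y) bounds in the shift, say x = -dz, then
  subtracting the differential of (z, 0) leaves (0, y - f z), which comes from
  \<open>Y\<close>.\<close>

lemma cone_exact_cone:
  "a_kernel (cohomology (cone X Y f) (n + 1)) (cohomology (shift X) (n + 1))
      (induced_map (cone X Y f) (shift X) (cone_proj X Y) (n + 1)) =
    induced_map Y (cone X Y f) (cone_incl X Y) (n + 1) ` carrier (cohomology Y (n + 1))"
    (is "?K = ?I")
proof
  let ?C = "cone X Y f"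
  note MX = complexesD(1)[OF X] and MY = complexesD(1)[OF Y] and C = cone_in_complexes
    and SX = shift_in_complexes[OF X]
  note dX = complexesD(2)[OF X] and dY = complexesD(2)[OF Y]
  interpret X1: module R "obj X (n + 1)" by (rule MX)
  interpret X2: module R "obj X (n + 1 + 1)" by (rule MX)
  interpret Y0: module R "obj Y n" by (rule MY)
  interpret Y1: module R "obj Y (n + 1)" by (rule MY)
  have proj: "cone_proj X Y (n + 1) (UPair x y) = x"
    if "x \<in> carrier (obj X (n + 1 + 1))" "y \<in> carrier (obj Y (n + 1))" for x y
    using that by (simp add: cone_proj_def)
  show "?K \<subseteq> ?I"
  proof
    fix \<xi> assume \<xi>: "\<xi> \<in> ?K"
    then obtain p where p: "p \<in> cocycles ?C (n + 1)" "\<xi> = cohomology_class ?C (n + 1) p"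
      using cohomology_cases[OF C] by (metis a_kernel_iff)
    then have "p \<in> carrier (sum_module (obj X (n + 1 + 1)) (obj Y (n + 1)))"
      unfolding cocycles_iff cone_simps by blast
    then obtain x y where xy: "p = UPair x y" "x \<in> carrier (obj X (n + 1 + 1))" "y \<in> carrier (obj Y (n + 1))"
      by (rule sum_module_cases)
    have "cone_proj X Y (n + 1) p \<in> coboundaries (shift X) (n + 1)"
      using \<xi> unfolding p(2) a_kernel_iff induced_map_class[OF C SX cone_chain(3) p(1)]
        cohomology_class_zero_iff[OF SX chain_cocycles[OF C SX cone_chain(3) p(1)]] by blast
    then obtain z where z: "z \<in> carrier (obj X (n + 1))" "x = \<ominus>\<^bsub>obj X (n + 1 + 1)\<^esub> diff X (n + 1) z"
      unfolding xy(1) proj[OF xy(2,3)] coboundaries_shift_Suc by blast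
    note cl = cone_closed[OF z(1) Y0.M.zero_closed]
    define y' where "y' = y \<ominus>\<^bsub>obj Y (n + 1)\<^esub> f (n + 1) z"
    have y': "y' \<in> carrier (obj Y (n + 1))" unfolding y'_def by (rule Y1.M.minus_closed[OF xy(3) cl(1)])
    note X2M = MX[of "n + 1 + 1"]
    \<comment> \<open>This pair is the differential of (z, 0) in the cone.\<close>
    have dz: "UPair x (f (n + 1) z) \<in> coboundaries ?C (n + 1)"
      unfolding cone_coboundaries_Suc z(2)
      using z(1) cl(1) linear_map_zero[OF MY MY dY, of n] Y1.M.r_zero[OF cl(1)] Y0.M.zero_closed by force
    have sub: "p \<ominus>\<^bsub>obj ?C (n + 1)\<^esub> UPair x (f (n + 1) z) = UPair \<zero>\<^bsub>obj X (n + 1 + 1)\<^esub> y'"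
      unfolding xy(1) cone_simps(1) sum_module_minus[OF X2M MY xy(2,2,3) cl(1)] y'_def
      using xy(2) X2.M.minus_eq_zero_iff[OF xy(2,2)] by (simp only: simp_thms)
    have c: "UPair \<zero>\<^bsub>obj X (n + 1 + 1)\<^esub> y' \<in> cocycles ?C (n + 1)"
      unfolding sub[symmetric]
      by (rule submoduleD(6)[OF complexesD(1)[OF C] submodule_cocycles[OF C] p(1)])
        (use dz coboundaries_subset[OF C] in blast)
    interpret Y2: module R "obj Y (n + 1 + 1)" by (rule MY)
    have dy': "diff Y (n + 1) y' \<in> carrier (obj Y (n + 1 + 1))" by (rule linear_map_closed[OF dY y'])
    have "diff Y (n + 1) y' = \<zero>\<^bsub>obj Y (n + 1 + 1)\<^esub>"
      using c unfolding cone_cocycles_iff[OF X2.M.zero_closed y'] linear_map_zero[OF MX MY chain_map_linear]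
        Y2.M.l_zero[OF dy'] by blast
    then have yc: "y' \<in> cocycles Y (n + 1)" using y' by (simp only: cocycles_iff)
    have incl: "cone_incl X Y (n + 1) y' = UPair \<zero>\<^bsub>obj X (n + 1 + 1)\<^esub> y'"
      using y' by (simp add: cone_incl_def)
    interpret C1: module R "obj ?C (n + 1)" by (rule module_cone)
    have pC: "p \<in> carrier (obj ?C (n + 1))" using p(1) by (simp only: cocycles_iff)
    have bC: "UPair x (f (n + 1) z) \<in> carrier (obj ?C (n + 1))"
      by (rule submoduleD(1)[OF module_cone submodule_coboundaries[OF C] dz])
    have "p \<ominus>\<^bsub>obj ?C (n + 1)\<^esub> UPair \<zero>\<^bsub>obj X (n + 1 + 1)\<^esub> y' = UPair x (f (n + 1) z)"
      unfolding sub[symmetric] using pC bC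
      by (simp add: a_minus_def C1.M.minus_add C1.M.a_assoc[symmetric] C1.M.r_neg del: sum_module_simps)
    then have "\<xi> = cohomology_class ?C (n + 1) (UPair \<zero>\<^bsub>obj X (n + 1 + 1)\<^esub> y')"
      unfolding p(2) cohomology_class_eq_iff[OF C p(1) c] using dz by (simp only:)
    also have "\<dots> = induced_map Y ?C (cone_incl X Y) (n + 1) (cohomology_class Y (n + 1) y')"
      unfolding induced_map_class[OF Y C cone_chain(2) yc] incl ..
    finally show "\<xi> \<in> ?I" using cohomology_class_closed[OF Y yc] by blast
  qed
  show "?I \<subseteq> ?K"
  proof
    fix \<xi> assume "\<xi> \<in> ?I"
    then obtain y where y: "y \<in> cocycles Y (n + 1)"
      and \<xi>: "\<xi> = induced_map Y ?C (cone_incl X Y) (n + 1) (cohomology_class Y (n + 1) y)"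
      unfolding cohomology_carrier[OF Y] by blast
    note ic = chain_cocycles[OF Y C cone_chain(2) y]
    have yY: "y \<in> carrier (obj Y (n + 1))" using y by (simp only: cocycles_iff)
    have "cone_proj X Y (n + 1) (cone_incl X Y (n + 1) y) = \<zero>\<^bsub>obj X (n + 1 + 1)\<^esub>"
      using proj[OF X2.M.zero_closed yY] yY by (simp add: cone_incl_def)
    moreover have "\<zero>\<^bsub>obj X (n + 1 + 1)\<^esub> \<in> coboundaries (shift X) (n + 1)"
      using submoduleD(2)[OF complexesD(1)[OF SX] submodule_coboundaries[OF SX]] unfolding shift_simps .
    ultimately show "\<xi> \<in> ?K"
      unfolding \<xi> a_kernel_iff induced_map_class[OF Y C cone_chain(2) y] induced_map_class[OF C SX cone_chain(3) ic]
        cohomology_class_zero_iff[OF SX chain_cocycles[OF C SX cone_chain(3) ic]]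
      using cohomology_class_closed[OF C ic] by (simp only: simp_thms)
  qed
qed

text \<open>For a cocycle x, the pair (x, y) is a cocycle of the cone exactly when f x is the
  differential of -y. Thus the connecting homomorphism of the sequence is the map induced by
  \<open>f\<close> itself.\<close>

lemma cone_exact_shift:
  "a_kernel (cohomology X (n + 1)) (cohomology Y (n + 1)) (induced_map X Y f (n + 1)) =
    induced_map (cone X Y f) (shift X) (cone_proj X Y) n ` carrier (cohomology (cone X Y f) n)"
    (is "?K = ?I")
proof
  let ?C = "cone X Y f"
  note MX = complexesD(1)[OF X] and MY = complexesD(1)[OF Y] and C = cone_in_complexes
    and SX = shift_in_complexes[OF X]
  note dX = complexesD(2)[OF X] and dY = complexesD(2)[OF Y]
  interpret Y0: module R "obj Y n" by (rule MY)
  interpret Y1: module R "obj Y (n + 1)" by (rule MY)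
  have proj: "cone_proj X Y n (UPair x y) = x"
    if "x \<in> carrier (obj X (n + 1))" "y \<in> carrier (obj Y n)" for x y
    using that by (simp add: cone_proj_def)
  have class_shift: "cohomology_class (shift X) n x = cohomology_class X (n + 1) x" for x
    by (simp add: cohomology_class_def coboundaries_shift[OF X] shift_simps)
  have key: "f (n + 1) x \<in> coboundaries Y (n + 1) \<longleftrightarrow> (\<exists>y\<in>carrier (obj Y n). UPair x y \<in> cocycles ?C n)"
    if x: "x \<in> cocycles X (n + 1)" for x
  proof -
    have xX: "x \<in> carrier (obj X (n + 1))" and dx: "diff X (n + 1) x = \<zero>\<^bsub>obj X (n + 1 + 1)\<^esub>"
      using x by (simp_all only: cocycles_iff)
    have iff: "UPair x y \<in> cocycles ?C n \<longleftrightarrow> f (n + 1) x = diff Y n (\<ominus>\<^bsub>obj Y n\<^esub> y)"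
      if y: "y \<in> carrier (obj Y n)" for y
    proof -
      note cl = cone_closed[OF xX y]
      have "UPair x y \<in> cocycles ?C n \<longleftrightarrow> f (n + 1) x \<oplus>\<^bsub>obj Y (n + 1)\<^esub> diff Y n y = \<zero>\<^bsub>obj Y (n + 1)\<^esub>"
        unfolding cone_cocycles_iff[OF xX y] using dx by blast
      also have "\<dots> \<longleftrightarrow> f (n + 1) x = \<ominus>\<^bsub>obj Y (n + 1)\<^esub> diff Y n y"
        using cl by (metis Y1.M.minus_equality Y1.M.l_neg)
      finally show ?thesis unfolding linear_map_neg[OF MY MY dY y] .
    qed
    show ?thesis
    proof
      assume "f (n + 1) x \<in> coboundaries Y (n + 1)"
      then obtain z where z: "z \<in> carrier (obj Y n)" "f (n + 1) x = diff Y n z"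
        unfolding coboundaries_Suc by blast
      then have "UPair x (\<ominus>\<^bsub>obj Y n\<^esub> z) \<in> cocycles ?C n" using iff[of "\<ominus>\<^bsub>obj Y n\<^esub> z"] by simp
      then show "\<exists>y\<in>carrier (obj Y n). UPair x y \<in> cocycles ?C n" using z(1) Y0.M.a_inv_closed by blast
    next
      assume "\<exists>y\<in>carrier (obj Y n). UPair x y \<in> cocycles ?C n"
      then show "f (n + 1) x \<in> coboundaries Y (n + 1)"
        unfolding coboundaries_Suc using iff Y0.M.a_inv_closed by blast
    qed
  qed
  have proj_class: "induced_map ?C (shift X) (cone_proj X Y) n (cohomology_class ?C n (UPair x y)) =
      cohomology_class X (n + 1) x"
    if "x \<in> carrier (obj X (n + 1))" "y \<in> carrier (obj Y n)" "UPair x y \<in> cocycles ?C n" for x y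
    unfolding induced_map_class[OF C SX cone_chain(3) that(3)] proj[OF that(1,2)] class_shift ..
  show "?K \<subseteq> ?I"
  proof
    fix \<xi> assume \<xi>: "\<xi> \<in> ?K"
    then obtain x where x: "x \<in> cocycles X (n + 1)" "\<xi> = cohomology_class X (n + 1) x"
      using cohomology_cases[OF X] by (metis a_kernel_iff)
    have "f (n + 1) x \<in> coboundaries Y (n + 1)"
      using \<xi> unfolding x(2) a_kernel_iff induced_map_class[OF X Y cone_chain(1) x(1)]
        cohomology_class_zero_iff[OF Y chain_cocycles[OF X Y cone_chain(1) x(1)]] by blast
    then obtain y where y: "y \<in> carrier (obj Y n)" "UPair x y \<in> cocycles ?C n" using key[OF x(1)] by blast
    have "x \<in> carrier (obj X (n + 1))" using x(1) by (simp only: cocycles_iff)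
    then show "\<xi> \<in> ?I"
      using proj_class[OF _ y] cohomology_class_closed[OF C y(2)] x(2) by blast
  qed
  show "?I \<subseteq> ?K"
  proof
    fix \<xi> assume "\<xi> \<in> ?I"
    then obtain p where p: "p \<in> cocycles ?C n"
      and \<xi>: "\<xi> = induced_map ?C (shift X) (cone_proj X Y) n (cohomology_class ?C n p)"
      unfolding cohomology_carrier[OF C] by blast
    then have "p \<in> carrier (sum_module (obj X (n + 1)) (obj Y n))"
      unfolding cocycles_iff cone_simps by blast
    then obtain x y where xy: "p = UPair x y" "x \<in> carrier (obj X (n + 1))" "y \<in> carrier (obj Y n)"
      by (rule sum_module_cases)
    have x: "x \<in> cocycles X (n + 1)"
      using p unfolding xy(1) cone_cocycles_iff[OF xy(2,3)] using xy(2) by (simp only: cocycles_iff)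
    have "f (n + 1) x \<in> coboundaries Y (n + 1)" using key[OF x] p xy by blast
    moreover have "\<xi> = cohomology_class X (n + 1) x"
      using \<xi> proj_class[OF xy(2,3)] p unfolding xy(1) by simp
    ultimately show "\<xi> \<in> ?K"
      unfolding a_kernel_iff using cohomology_class_closed[OF X x] induced_map_class[OF X Y cone_chain(1) x]
        cohomology_class_zero_iff[OF Y chain_cocycles[OF X Y cone_chain(1) x]] by (simp only: simp_thms)
  qed
qed

end

section \<open>Isomorphisms in the derived category\<close>

text \<open>The effect of a letter on cohomology. A backward letter acts by the inverse of a
  bijection, since its chain map is a quasi-isomorphism.\<close>

fun letter_map :: "int \<Rightarrow> ('a, 'b) letter \<Rightarrow> 'b set \<Rightarrow> 'b set" where
  "letter_map n (Fwd X Y f) = cohomology_map X Y f n"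
| "letter_map n (Bwd X Y s) = inv_into (carrier (cohomology X n)) (cohomology_map X Y s n)"

primrec zigzag_map :: "int \<Rightarrow> ('a, 'b) letter list \<Rightarrow> 'b set \<Rightarrow> 'b set" where
  "zigzag_map n [] \<xi> = \<xi>"
| "zigzag_map n (l # w) \<xi> = zigzag_map n w (letter_map n l \<xi>)"

lemma zigzag_map_append: "zigzag_map n (u @ v) \<xi> = zigzag_map n v (zigzag_map n u \<xi>)"
  by (induction u arbitrary: \<xi>) auto

lemma zigzag_complexes: "zigzag R X Y w \<Longrightarrow> X \<in> complexes R \<and> Y \<in> complexes R"
  by (induction rule: zigzag.induct) auto

lemma zigzag_append: "zigzag R X Y u \<Longrightarrow> zigzag R Y Z v \<Longrightarrow> zigzag R X Z (u @ v)"
  by (induction rule: zigzag.induct) (auto intro: zigzag.intros)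

lemma cohomology_map_linear:
  assumes "X \<in> complexes R" "Y \<in> complexes R" "f \<in> chain_maps R X Y"
  shows "linear_map R (cohomology X n) (cohomology Y n) (cohomology_map X Y f n)"
  unfolding cohomology_map_eq by (rule induced_map_linear[OF assms(1,2) chain_maps_linear[OF assms(3)]])

lemma cohomology_map_class:
  assumes "X \<in> complexes R" "Y \<in> complexes R" "f \<in> chain_maps R X Y" "x \<in> cocycles X n"
  shows "cohomology_map X Y f n (cohomology_class X n x) = cohomology_class Y n (f n x)"
  unfolding cohomology_map_eq by (rule induced_map_class[OF assms(1,2) chain_maps_linear[OF assms(3)] assms(4)])

lemma quasi_isosD:
  assumes "s \<in> quasi_isos R X Y"
  shows "s \<in> chain_maps R X Y"
    "bij_betw (cohomology_map X Y s n) (carrier (cohomology X n)) (carrier (cohomology Y n))"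
  using assms by (auto simp: quasi_isos_def)

lemma zigzag_map_linear:
  "zigzag R X Y w \<Longrightarrow> linear_map R (cohomology X n) (cohomology Y n) (zigzag_map n w)"
proof (induction rule: zigzag.induct)
  case (empty X)
  then show ?case by (auto intro!: linear_mapI)
next
  case (fwd X f Y Z w)
  have "Y \<in> complexes R" using zigzag_complexes[OF fwd(3)] by blast
  then show ?case
    using linear_map_comp[OF cohomology_map_linear[OF fwd(1) _ fwd(2)] fwd.IH] by simp
next
  case (bwd Y s X Z w)
  have X: "X \<in> complexes R" using zigzag_complexes[OF bwd(3)] by blast
  show ?case
    using linear_map_comp[OF linear_map_inv_into[OF module_cohomology[OF X]
        cohomology_map_linear[OF X bwd(1) quasi_isosD(1)[OF bwd(2)]] quasi_isosD(2)[OF bwd(2)]] bwd.IH]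
    by simp
qed

lemma chain_id_chain:
  assumes X: "X \<in> complexes R"
  shows "chain_id X \<in> chain_maps R X X"
proof -
  have "chain_id X n \<in> module_hom R (obj X n) (obj X n)" for n
    unfolding chain_id_def by (rule restrict_in_module_hom[OF complexesD(1)[OF X] linear_mapI]) simp_all
  then show ?thesis
    using linear_map_closed[OF complexesD(2)[OF X]] by (simp add: chain_maps_def chain_id_def)
qed

lemma chain_comp_chain:
  assumes X: "X \<in> complexes R" and f: "f \<in> chain_maps R X Y" and g: "g \<in> chain_maps R Y Z"
  shows "chain_comp X g f \<in> chain_maps R X Z"
proof -
  note f' = chain_linearD[OF chain_maps_linear[OF f]] and g' = chain_linearD[OF chain_maps_linear[OF g]]
  have "chain_comp X g f n \<in> module_hom R (obj X n) (obj Z n)" for n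
    unfolding chain_comp_def compose_def
    by (rule restrict_in_module_hom[OF complexesD(1)[OF X] linear_map_comp[OF f'(1) g'(1)]])
  moreover have "chain_comp X g f (n + 1) (diff X n x) = diff Z n (chain_comp X g f n x)"
    if x: "x \<in> carrier (obj X n)" for n x
    using x linear_map_closed[OF complexesD(2)[OF X] x] f'(2)[OF x] g'(2)[OF linear_map_closed[OF f'(1) x]]
    by (simp add: chain_comp_def compose_def)
  ultimately show ?thesis by (simp add: chain_maps_def)
qed

lemma zigzag_eq_zigzag: "zigzag_eq R X Y v w \<Longrightarrow> zigzag R X Y v \<and> zigzag R X Y w"
proof (induction rule: zigzag_eq.induct)
  case (comp X Y Z f g)
  then show ?case by (auto intro!: zigzag.intros chain_comp_chain)
next
  case (whisker W X u Y v v' Z w)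
  then show ?case by (auto intro: zigzag_append)
qed (auto intro: zigzag.intros chain_id_chain quasi_isosD)

text \<open>Cohomology respects each generating relation: identities and composites by
  functoriality, the inverse relations because quasi-isomorphisms become bijections. Agreement is
  claimed on the carrier, as \<open>inv_into\<close> is arbitrary elsewhere.\<close>

lemma zigzag_eq_map:
  "zigzag_eq R X Y v w \<Longrightarrow> \<xi> \<in> carrier (cohomology X n) \<Longrightarrow> zigzag_map n v \<xi> = zigzag_map n w \<xi>"
proof (induction arbitrary: \<xi> rule: zigzag_eq.induct)
  case (whisker W X u Y v v' Z w)
  then have "zigzag_map n u \<xi> \<in> carrier (cohomology X n)"
    using linear_map_closed[OF zigzag_map_linear] by blast
  then show ?case using whisker.IH by (simp add: zigzag_map_append)
next
  case (ident X)
  then obtain x where x: "x \<in> cocycles X n" "\<xi> = cohomology_class X n x"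
    unfolding cohomology_carrier[OF ident(1)] by blast
  then show ?case
    using cohomology_map_class[OF ident(1,1) chain_id_chain[OF ident(1)] x(1)]
    by (simp add: chain_id_def cocycles_iff)
next
  case (comp X Y Z f g)
  then obtain x where x: "x \<in> cocycles X n" "\<xi> = cohomology_class X n x"
    unfolding cohomology_carrier[OF comp(1)] by blast
  have "f n x \<in> cocycles Y n" by (rule chain_cocycles[OF comp(1,2) chain_maps_linear[OF comp(4)] x(1)])
  then show ?case
    using x cohomology_map_class[OF comp(1,2,4) x(1)] cohomology_map_class[OF comp(2,3,5)]
      cohomology_map_class[OF comp(1,3) chain_comp_chain[OF comp(1,4,5)] x(1)]
    by (simp add: chain_comp_def compose_def cocycles_iff)
next
  case (inv_right X Y s)
  then show ?case using quasi_isosD(2)[OF inv_right(3), of n] by (simp add: bij_betw_def)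
next
  case (inv_left X Y s)
  then show ?case using quasi_isosD(2)[OF inv_left(3), of n] by (simp add: bij_betw_def f_inv_into_f)
qed auto

text \<open>Zigzags that represent an isomorphism and its inverse compose to the empty zigzag up to
  the congruence, so their maps on cohomology are inverse to each other.\<close>

lemma D_isos_cohomology:
  assumes "\<alpha> \<in> D_isos R X Y"
  shows "X \<in> complexes R" "Y \<in> complexes R"
    "\<exists>g. linear_map R (cohomology X n) (cohomology Y n) g \<and>
      bij_betw g (carrier (cohomology X n)) (carrier (cohomology Y n))"
proof -
  obtain w v \<beta> where w: "zigzag R X Y w" "\<alpha> = zigzag_class R X Y w"
    and v: "zigzag R Y X v" "\<beta> = zigzag_class R Y X v"
    and inv: "D_comp R X X \<beta> \<alpha> = D_id R X" "D_comp R Y Y \<alpha> \<beta> = D_id R Y"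
    using assms by (auto simp: D_isos_def D_hom_def)
  show "X \<in> complexes R" "Y \<in> complexes R" using zigzag_complexes[OF w(1)] by auto
  have "w \<in> \<alpha>" "v \<in> \<beta>" using w v by (auto simp: zigzag_class_def intro: zigzag_eq.refl)
  moreover have "w @ v \<in> zigzag_class R X X (w @ v)" "v @ w \<in> zigzag_class R Y Y (v @ w)"
    using w(1) v(1) by (auto simp: zigzag_class_def intro: zigzag_eq.refl zigzag_append)
  ultimately have "w @ v \<in> D_comp R X X \<beta> \<alpha>" "v @ w \<in> D_comp R Y Y \<alpha> \<beta>"
    unfolding D_comp_def by blast+
  \<comment> \<open>The identity of D(A) is the class of the empty zigzag, so lying in it is the
    same as being congruent to that zigzag.\<close>
  then have "zigzag_eq R X X [] (w @ v)" "zigzag_eq R Y Y [] (v @ w)"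
    unfolding inv by (simp_all add: D_id_def zigzag_class_def)
  note eq = zigzag_eq_map[OF this(1)] zigzag_eq_map[OF this(2)]
  have gf: "zigzag_map n v (zigzag_map n w \<xi>) = \<xi>" if "\<xi> \<in> carrier (cohomology X n)" for \<xi>
    using eq(1)[OF that] by (simp add: zigzag_map_append)
  have fg: "zigzag_map n w (zigzag_map n v \<eta>) = \<eta>" if "\<eta> \<in> carrier (cohomology Y n)" for \<eta>
    using eq(2)[OF that] by (simp add: zigzag_map_append)
  have "bij_betw (zigzag_map n w) (carrier (cohomology X n)) (carrier (cohomology Y n))"
    using gf fg linear_map_closed[OF zigzag_map_linear[OF w(1)]] linear_map_closed[OF zigzag_map_linear[OF v(1)]]
    by (intro bij_betwI[of _ _ _ "zigzag_map n v"]) auto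
  then show "\<exists>g. linear_map R (cohomology X n) (cohomology Y n) g \<and>
      bij_betw g (carrier (cohomology X n)) (carrier (cohomology Y n))"
    using zigzag_map_linear[OF w(1)] by blast
qed

section \<open>Thickness\<close>

lemma sum_complex_simps:
  "obj (sum_complex X Y) n = sum_module (obj X n) (obj Y n)"
  "x \<in> carrier (obj X n) \<Longrightarrow> y \<in> carrier (obj Y n) \<Longrightarrow>
    diff (sum_complex X Y) n (UPair x y) = UPair (diff X n x) (diff Y n y)"
  by (simp_all add: sum_complex_def)

lemma D_cofD:
  assumes "X \<in> D_cof R \<aa>"
  shows "X \<in> complexes R" "cohomology X n \<in> M_cof R \<aa>"
  using assms by (auto simp: D_cof_def)

context noetherian_ideal
begin

lemma D_cof_iso:
  assumes "\<alpha> \<in> D_isos R X Y"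
  shows "X \<in> D_cof R \<aa> \<longleftrightarrow> Y \<in> D_cof R \<aa>"
proof -
  note iso = D_isos_cohomology[OF assms]
  have "cohomology X n \<in> cofinite \<longleftrightarrow> cohomology Y n \<in> cofinite" for n
    using iso(3)[of n] cofinite_iso[OF _ module_cohomology[OF iso(1)]]
      cofinite_iso'[OF _ module_cohomology[OF iso(2)]] by metis
  then show ?thesis using iso(1,2) by (simp add: D_cof_def)
qed

end

context cofinite_abelian
begin

text \<open>A cohomology class is determined by any of its elements, so picking one element from
  each class embeds cohomology into the element type of the complex.\<close>

lemma small_cohomology:
  fixes X :: "('a, 'u) cochain"
  assumes X: "X \<in> complexes R"
  shows "small (cohomology X n)"
proof -
  let ?g = "\<lambda>\<xi>. SOME x. x \<in> \<xi>"
  note H = module_cocycles[OF X, of n] coboundaries_in_cocycles[OF X, of n]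
  have g: "cohomology_class X n (?g (cohomology_class X n x)) = cohomology_class X n x"
    if x: "x \<in> cocycles X n" for x
  proof -
    have "x \<in> cohomology_class X n x"
      using coset_self[OF H, of x] x by (simp add: cohomology_class_def)
    then have "?g (cohomology_class X n x) \<in> cohomology_class X n x" by (rule someI)
    then show ?thesis using coset_memD(2)[OF H, of x] x by (simp add: cohomology_class_def)
  qed
  have "inj_on ?g (carrier (cohomology X n))"
    unfolding cohomology_carrier[OF X] by (rule inj_on_inverseI[of _ "cohomology_class X n"]) (auto simp: g)
  then show ?thesis unfolding small_def by blast
qed

text \<open>The five degrees are independent of each other, so that a single statement covers all
  three positions in the long exact sequence.\<close>

lemma D_cof_five:
  fixes X Y Z W V :: "('a, 'u) cochain"
  assumes "X \<in> D_cof R \<aa>" "Y \<in> D_cof R \<aa>" "Z \<in> complexes R" "W \<in> D_cof R \<aa>" "V \<in> D_cof R \<aa>"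
    and "linear_map R (cohomology X k) (cohomology Y l) a" "linear_map R (cohomology Y l) (cohomology Z m) b"
    and "linear_map R (cohomology Z m) (cohomology W p) c" "linear_map R (cohomology W p) (cohomology V q) d"
    and "a_kernel (cohomology Y l) (cohomology Z m) b = a ` carrier (cohomology X k)"
    and "a_kernel (cohomology Z m) (cohomology W p) c = b ` carrier (cohomology Y l)"
    and "a_kernel (cohomology W p) (cohomology V q) d = c ` carrier (cohomology Z m)"
  shows "cohomology Z m \<in> cofinite"
  by (rule cofinite_five[OF D_cofD(2)[OF assms(1)] small_cohomology[OF D_cofD(1)[OF assms(1)]]
        D_cofD(2)[OF assms(2)] small_cohomology[OF D_cofD(1)[OF assms(2)]] module_cohomology[OF assms(3)]
        D_cofD(2)[OF assms(4)] small_cohomology[OF D_cofD(1)[OF assms(4)]]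
        D_cofD(2)[OF assms(5)] small_cohomology[OF D_cofD(1)[OF assms(5)]] assms(6-12)])

end

text \<open>Cones and direct sums are built from \<open>UPair\<close>, so the element type is now
  specialized to \<open>univ\<close>.\<close>

locale cofinite_abelian_univ = cofinite_abelian R \<aa> "TYPE(('a, 'i) univ)"
  for R :: "('a, 'r) ring_scheme" and \<aa> and t :: "'i itself"
begin

text \<open>The long exact sequence runs cyclically through \<open>X\<close>, \<open>Y\<close> and
  the cone; each claim is the five-term argument centred at another of the three.\<close>

lemma D_cof_cone:
  fixes X Y :: "('a, ('a, 'i) univ) cochain"
  assumes X: "X \<in> complexes R" and Y: "Y \<in> complexes R" and f: "f \<in> chain_maps R X Y"
  shows "X \<in> D_cof R \<aa> \<Longrightarrow> Y \<in> D_cof R \<aa> \<Longrightarrow> cone X Y f \<in> D_cof R \<aa>"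
    and "Y \<in> D_cof R \<aa> \<Longrightarrow> cone X Y f \<in> D_cof R \<aa> \<Longrightarrow> X \<in> D_cof R \<aa>"
    and "X \<in> D_cof R \<aa> \<Longrightarrow> cone X Y f \<in> D_cof R \<aa> \<Longrightarrow> Y \<in> D_cof R \<aa>"
proof -
  let ?C = "cone X Y f"
  note C = cone_in_complexes[OF X Y f] and SX = shift_in_complexes[OF X]
  note chain = cone_chain[OF X Y f]
  note fm = induced_map_linear[OF X Y chain(1)] and im = induced_map_linear[OF Y C chain(2)]
  note pm = induced_map_linear[OF C SX chain(3), unfolded cohomology_shift[OF X]]
  note exY = cone_exact_Y[OF X Y f] and exC = cone_exact_cone[OF X Y f, unfolded cohomology_shift[OF X]]
    and exS = cone_exact_shift[OF X Y f]
  \<comment> \<open>The exact sequences are available in degree n + 1, and every integer has this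
    form.\<close>
  have all: "Z \<in> D_cof R \<aa>" if "Z \<in> complexes R" "\<And>n. cohomology Z (n + 1) \<in> cofinite"
    for Z :: "('a, ('a, 'i) univ) cochain"
  proof -
    have "cohomology Z n \<in> cofinite" for n using that(2)[of "n - 1"] by simp
    then show ?thesis using that(1) by (simp add: D_cof_def)
  qed
  show "?C \<in> D_cof R \<aa>" if "X \<in> D_cof R \<aa>" "Y \<in> D_cof R \<aa>"
    by (rule all[OF C]) (rule D_cof_five[OF that C that fm im pm fm exY exC exS])
  show "X \<in> D_cof R \<aa>" if "Y \<in> D_cof R \<aa>" "?C \<in> D_cof R \<aa>"
  proof (rule all[OF X])
    fix n
    \<comment> \<open>Between the cone and \<open>Y\<close> the cohomology of \<open>X\<close>
      appears as that of its shift, one degree lower, so exactness at the cone is taken with n -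
      1.\<close>
    have "cohomology X (n - 1 + 1 + 1) \<in> cofinite"
      by (rule D_cof_five[OF that X that im pm fm im exC exS exY])
    then show "cohomology X (n + 1) \<in> cofinite" by simp
  qed
  show "Y \<in> D_cof R \<aa>" if "X \<in> D_cof R \<aa>" "?C \<in> D_cof R \<aa>"
    by (rule all[OF Y]) (rule D_cof_five[OF that(2,1) Y that(2,1) pm fm im pm exS exY exC])
qed

text \<open>The projection maps H(X + Y) onto H(X), and its kernel is the image of an endomorphism
  of H(X + Y). Hence H(X) is the cokernel of a map from a cofinite module to itself.\<close>

lemma D_cof_summand:
  fixes X Y :: "('a, ('a, 'i) univ) cochain"
  assumes X: "X \<in> complexes R" and Y: "Y \<in> complexes R" and S: "sum_complex X Y \<in> D_cof R \<aa>"
  shows "X \<in> D_cof R \<aa>"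
proof -
  let ?S = "sum_complex X Y"
  have Sc: "?S \<in> complexes R" using D_cofD(1)[OF S] .
  note MX = complexesD(1)[OF X] and MY = complexesD(1)[OF Y]
  \<comment> \<open>The idempotent that sends (x, y) to (0, y).\<close>
  define e where "e n p = UPair \<zero>\<^bsub>obj X n\<^esub> (usnd p)" for n and p :: "('a, 'i) univ"
  have p: "chain_linear R ?S X (\<lambda>n. ufst)"
    unfolding chain_linear_def
    by (auto simp: sum_complex_simps elim!: sum_module_cases intro!: linear_mapI)
  have "linear_map R (obj ?S n) (obj ?S n) (e n)" for n
  proof -
    interpret X0: module R "obj X n" by (rule MX)
    show ?thesis unfolding sum_complex_simps
      by (rule linear_mapI) (auto simp: e_def elim!: sum_module_cases)
  qed
  moreover have "e (n + 1) (diff ?S n q) = diff ?S n (e n q)" if "q \<in> carrier (obj ?S n)" for n q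
  proof -
    interpret X0: module R "obj X n" by (rule MX)
    obtain x y where q: "q = UPair x y" "x \<in> carrier (obj X n)" "y \<in> carrier (obj Y n)"
      using \<open>q \<in> carrier (obj ?S n)\<close> unfolding sum_complex_simps by (rule sum_module_cases)
    show ?thesis
      unfolding q(1) e_def univ.sel sum_complex_simps(2)[OF q(2,3)] sum_complex_simps(2)[OF X0.M.zero_closed q(3)]
        linear_map_zero[OF MX MX complexesD(2)[OF X]] ..
  qed
  ultimately have e: "chain_linear R ?S ?S e" by (simp add: chain_linear_def)
  have "cohomology X (n + 1) \<in> cofinite" for n
  proof -
    interpret X0: module R "obj X n" by (rule MX)
    interpret X1: module R "obj X (n + 1)" by (rule MX)
    interpret Y0: module R "obj Y n" by (rule MY)
    interpret Y1: module R "obj Y (n + 1)" by (rule MY)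
    let ?m = "n + 1"
    have cocycle: "UPair x y \<in> cocycles ?S ?m \<longleftrightarrow> x \<in> cocycles X ?m \<and> y \<in> cocycles Y ?m" for x y
      unfolding cocycles_iff sum_complex_simps(1) sum_module_simps
      using sum_complex_simps(2)[of x X ?m y Y] by (metis univ.inject(3))
    have cocycleE: "\<exists>x y. q = UPair x y \<and> x \<in> cocycles X ?m \<and> y \<in> cocycles Y ?m" if "q \<in> cocycles ?S ?m" for q
    proof -
      have "q \<in> carrier (sum_module (obj X ?m) (obj Y ?m))"
        using that unfolding cocycles_iff sum_complex_simps by blast
      then show ?thesis using cocycle that by (metis sum_module_cases)
    qed
    have p_class: "induced_map ?S X (\<lambda>n. ufst) ?m (cohomology_class ?S ?m (UPair x y)) = cohomology_class X ?m x"
      if "x \<in> cocycles X ?m" "y \<in> cocycles Y ?m" for x y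
      using induced_map_class[OF Sc X p, of "UPair x y" ?m] that cocycle by simp
    have e_class: "induced_map ?S ?S e ?m (cohomology_class ?S ?m (UPair x y)) =
        cohomology_class ?S ?m (UPair \<zero>\<^bsub>obj X ?m\<^esub> y)"
      if "x \<in> cocycles X ?m" "y \<in> cocycles Y ?m" for x y
      using induced_map_class[OF Sc Sc e, of "UPair x y" ?m] that cocycle by (simp add: e_def)
    have zX: "\<zero>\<^bsub>obj X ?m\<^esub> \<in> cocycles X ?m"
      by (rule submoduleD(2)[OF MX submodule_cocycles[OF X]])
    have zY: "\<zero>\<^bsub>obj Y ?m\<^esub> \<in> cocycles Y ?m"
      by (rule submoduleD(2)[OF MY submodule_cocycles[OF Y]])
    have ex: "a_kernel (cohomology ?S ?m) (cohomology X ?m) (induced_map ?S X (\<lambda>n. ufst) ?m) =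
      induced_map ?S ?S e ?m ` carrier (cohomology ?S ?m)" (is "?K = ?I")
    proof
      show "?K \<subseteq> ?I"
      proof
        fix \<xi> assume \<xi>: "\<xi> \<in> ?K"
        then obtain q where "q \<in> cocycles ?S ?m" "\<xi> = cohomology_class ?S ?m q"
          unfolding a_kernel_iff cohomology_carrier[OF Sc] by blast
        then obtain x y where q: "\<xi> = cohomology_class ?S ?m (UPair x y)" "UPair x y \<in> cocycles ?S ?m"
          and xy: "x \<in> cocycles X ?m" "y \<in> cocycles Y ?m" using cocycleE by metis
        have "x \<in> coboundaries X ?m"
          using \<xi> p_class[OF xy] cohomology_class_zero_iff[OF X xy(1)] by (simp add: q(1) a_kernel_iff)
        then obtain z where z: "z \<in> carrier (obj X n)" "x = diff X n z"
          unfolding coboundaries_Suc by blast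
        have xX: "x \<in> carrier (obj X ?m)" "y \<in> carrier (obj Y ?m)" using xy by (simp_all only: cocycles_iff)
        \<comment> \<open>The pair (x, 0) is the differential of (z, 0), so (x, y) and (0, y) have
          the same class.\<close>
        have b: "UPair x \<zero>\<^bsub>obj Y ?m\<^esub> = diff ?S n (UPair z \<zero>\<^bsub>obj Y n\<^esub>)"
          unfolding sum_complex_simps(2)[OF z(1) Y0.M.zero_closed] z(2)
            linear_map_zero[OF MY MY complexesD(2)[OF Y]] ..
        have "UPair z \<zero>\<^bsub>obj Y n\<^esub> \<in> carrier (obj ?S n)" using z(1) by (simp add: sum_complex_simps)
        then have b': "UPair x \<zero>\<^bsub>obj Y ?m\<^esub> \<in> coboundaries ?S ?m" unfolding coboundaries_Suc b by blast
        have z': "UPair \<zero>\<^bsub>obj X ?m\<^esub> y \<in> cocycles ?S ?m" using zX xy(2) cocycle by blast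
        have "UPair x y \<ominus>\<^bsub>obj ?S ?m\<^esub> UPair \<zero>\<^bsub>obj X ?m\<^esub> y = UPair x \<zero>\<^bsub>obj Y ?m\<^esub>"
          unfolding sum_complex_simps(1) sum_module_minus[OF MX MY xX(1) X1.M.zero_closed xX(2,2)]
            X1.M.minus_zero_right[OF xX(1)] using Y1.M.minus_eq_zero_iff[OF xX(2,2)] by blast
        then have "\<xi> = cohomology_class ?S ?m (UPair \<zero>\<^bsub>obj X ?m\<^esub> y)"
          unfolding q(1) cohomology_class_eq_iff[OF Sc q(2) z'] using b' by (simp only:)
        then show "\<xi> \<in> ?I"
          using e_class[OF xy] cohomology_class_closed[OF Sc q(2)] by (metis image_eqI)
      qed
      show "?I \<subseteq> ?K"
      proof
        fix \<xi> assume "\<xi> \<in> ?I"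
        then obtain q where "q \<in> cocycles ?S ?m" "\<xi> = induced_map ?S ?S e ?m (cohomology_class ?S ?m q)"
          unfolding cohomology_carrier[OF Sc] by blast
        then obtain x y where xy: "x \<in> cocycles X ?m" "y \<in> cocycles Y ?m"
          and "\<xi> = induced_map ?S ?S e ?m (cohomology_class ?S ?m (UPair x y))" using cocycleE by metis
        then have \<xi>: "\<xi> = cohomology_class ?S ?m (UPair \<zero>\<^bsub>obj X ?m\<^esub> y)" using e_class by simp
        have "\<zero>\<^bsub>obj X ?m\<^esub> \<in> coboundaries X ?m"
          by (rule submoduleD(2)[OF MX submodule_coboundaries[OF X]])
        then show "\<xi> \<in> ?K"
          unfolding a_kernel_iff \<xi> p_class[OF zX xy(2)] cohomology_class_zero_iff[OF X zX]
          using cohomology_class_closed[OF Sc] cocycle zX xy(2) by blast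
      qed
    qed
    have sur: "induced_map ?S X (\<lambda>n. ufst) ?m ` carrier (cohomology ?S ?m) = carrier (cohomology X ?m)"
    proof
      show "induced_map ?S X (\<lambda>n. ufst) ?m ` carrier (cohomology ?S ?m) \<subseteq> carrier (cohomology X ?m)"
        using linear_map_closed[OF induced_map_linear[OF Sc X p]] by blast
      show "carrier (cohomology X ?m) \<subseteq> induced_map ?S X (\<lambda>n. ufst) ?m ` carrier (cohomology ?S ?m)"
        unfolding cohomology_carrier[OF X] cohomology_carrier[OF Sc] image_image
        using p_class[OF _ zY] cocycle zY by (force intro: image_eqI)
    qed
    note HS = D_cofD(2)[OF S, of ?m] small_cohomology[OF Sc, of ?m]
    show ?thesis
      using cofinite_image[OF HS HS module_cohomology[OF X] induced_map_linear[OF Sc Sc e]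
        induced_map_linear[OF Sc X p] ex]
      unfolding sur by simp
  qed
  then have "cohomology X n \<in> cofinite" for n by (metis diff_add_cancel)
  then show ?thesis using X by (simp add: D_cof_def)
qed

text \<open>\<open>D_cof\<close> is invariant under isomorphism in D(A), so only the vertices of a
  triangle count, and they may be taken to be those of the cone that presents it.\<close>

lemma thick_D_cof: "thick_subcategory R (D_cof R \<aa> :: ('a, ('a, 'i) univ) cochain set)"
  unfolding thick_subcategory_def
proof (intro conjI allI impI ballI)
  show "D_cof R \<aa> \<subseteq> (complexes R :: ('a, ('a, 'i) univ) cochain set)" by (auto simp: D_cof_def)
  show "X \<in> D_cof R \<aa>" if Y: "Y \<in> D_cof R \<aa>" and summand: "direct_summand R X Y" for X Y :: "('a, ('a, 'i) univ) cochain"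
  proof -
    obtain X' \<alpha> where X: "X \<in> complexes R" "X' \<in> complexes R" "\<alpha> \<in> D_isos R Y (sum_complex X X')"
      using summand by (auto simp: direct_summand_def)
    then show ?thesis using D_cof_summand[OF X(1,2)] D_cof_iso[OF X(3)] Y by blast
  qed
  fix X Y Z :: "('a, ('a, 'i) univ) cochain" and u v w
  assume "exact_triangle R X Y Z u v w"
  then obtain X' Y' f \<alpha> \<beta> \<gamma> where *: "X' \<in> complexes R" "Y' \<in> complexes R" "f \<in> chain_maps R X' Y'"
    "\<alpha> \<in> D_isos R X X'" "\<beta> \<in> D_isos R Y Y'" "\<gamma> \<in> D_isos R Z (cone X' Y' f)"
    unfolding exact_triangle_def by blast
  note iso = D_cof_iso[OF *(4)] D_cof_iso[OF *(5)] D_cof_iso[OF *(6)]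
  note two = D_cof_cone[OF *(1-3)]
  show "Z \<in> D_cof R \<aa>" if "X \<in> D_cof R \<aa> \<and> Y \<in> D_cof R \<aa>" using two(1) iso that by blast
  show "X \<in> D_cof R \<aa>" if "Y \<in> D_cof R \<aa> \<and> Z \<in> D_cof R \<aa>" using two(2) iso that by blast
  show "Y \<in> D_cof R \<aa>" if "X \<in> D_cof R \<aa> \<and> Z \<in> D_cof R \<aa>" using two(3) iso that by blast
qed

end

section \<open>The exact triangle of a cone\<close>

lemma zigzag_class_eq:
  assumes "zigzag_eq R X Y v w"
  shows "zigzag_class R X Y v = zigzag_class R X Y w"
  using assms by (auto simp: zigzag_class_def intro: zigzag_eq.sym zigzag_eq.trans)

text \<open>The rule \<open>whisker\<close> changes one block at a time; the two halves are replaced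
  in succession.\<close>

lemma zigzag_eq_append:
  assumes u: "zigzag_eq R X Y u u'" and v: "zigzag_eq R Y Z v v'"
  shows "zigzag_eq R X Z (u @ v) (u' @ v')"
proof -
  note zu = zigzag_eq_zigzag[OF u] and zv = zigzag_eq_zigzag[OF v]
  have X: "X \<in> complexes R" and Z: "Z \<in> complexes R"
    using zu zv zigzag_complexes by blast+
  have "zigzag_eq R X Z ([] @ u @ v) ([] @ u' @ v)"
    using zigzag_eq.whisker[OF zigzag.empty[OF X] u] zv by blast
  moreover have "zigzag_eq R X Z (u' @ v @ []) (u' @ v' @ [])"
    using zigzag_eq.whisker[OF _ v zigzag.empty[OF Z]] zu by blast
  ultimately show ?thesis using zigzag_eq.trans by simp
qed

text \<open>The congruence makes all members of the union in \<open>D_comp\<close> equal, so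
  composition can be computed on representatives.\<close>

lemma D_comp_class:
  assumes u: "zigzag R X Y u" and v: "zigzag R Y Z v"
  shows "D_comp R X Z (zigzag_class R Y Z v) (zigzag_class R X Y u) = zigzag_class R X Z (u @ v)"
proof -
  have "zigzag_class R X Z (u' @ v') = zigzag_class R X Z (u @ v)"
    if "u' \<in> zigzag_class R X Y u" "v' \<in> zigzag_class R Y Z v" for u' v'
    using zigzag_class_eq[OF zigzag_eq_append[of R X Y u u' Z v v']] that by (simp add: zigzag_class_def)
  moreover have "u \<in> zigzag_class R X Y u" "v \<in> zigzag_class R Y Z v"
    using u v by (simp_all add: zigzag_class_def zigzag_eq.refl)
  ultimately show ?thesis unfolding D_comp_def by blast
qed

section \<open>The shift on morphisms of D(A)\<close>

lemma shift_chain_maps: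
  assumes X: "X \<in> complexes R" and Y: "Y \<in> complexes R" and f: "f \<in> chain_maps R X Y"
  shows "(\<lambda>n. f (n + 1)) \<in> chain_maps R (shift X) (shift Y)"
proof -
  note f' = chain_linearD[OF chain_maps_linear[OF f]]
  have "f (n + 1 + 1) (diff (shift X) n x) = diff (shift Y) n (f (n + 1) x)"
    if "x \<in> carrier (obj (shift X) n)" for n x
  proof -
    have x: "x \<in> carrier (obj X (n + 1))" using that unfolding shift_simps .
    show ?thesis
      unfolding shift_simps(2)[OF x] shift_simps(2)[OF linear_map_closed[OF f'(1) x]]
        linear_map_neg[OF complexesD(1)[OF X] complexesD(1)[OF Y] f'(1) linear_map_closed[OF complexesD(2)[OF X] x]]
        f'(2)[OF x] ..
  qed
  moreover have "f (n + 1) \<in> module_hom R (obj (shift X) n) (obj (shift Y) n)" for n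
    using f unfolding chain_maps_def shift_simps by blast
  ultimately show ?thesis unfolding chain_maps_def by blast
qed

lemma shift_quasi_isos:
  assumes X: "X \<in> complexes R" and Y: "Y \<in> complexes R" and s: "s \<in> quasi_isos R X Y"
  shows "(\<lambda>n. s (n + 1)) \<in> quasi_isos R (shift X) (shift Y)"
proof -
  have "cohomology_map (shift X) (shift Y) (\<lambda>n. s (n + 1)) n = cohomology_map X Y s (n + 1)" for n
    unfolding cohomology_map_def cohomology_shift[OF X] coboundaries_shift[OF Y] shift_simps ..
  then show ?thesis
    using quasi_isosD[OF s] shift_chain_maps[OF X Y]
    by (simp add: quasi_isos_def cohomology_shift[OF X] cohomology_shift[OF Y])
qed

lemma shift_zigzag: "zigzag R X Y w \<Longrightarrow> zigzag R (shift X) (shift Y) (map shift_letter w)"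
proof (induction rule: zigzag.induct)
  case (empty X)
  then show ?case by (simp add: zigzag.empty shift_in_complexes)
next
  case (fwd X f Y Z w)
  then show ?case using zigzag_complexes[OF fwd(3)]
    by (simp add: zigzag.fwd shift_in_complexes shift_chain_maps)
next
  case (bwd Y s X Z w)
  then show ?case using zigzag_complexes[OF bwd(3)]
    by (simp add: zigzag.bwd shift_in_complexes shift_quasi_isos)
qed

text \<open>Each generating relation is shifted to a relation of the same kind. This makes
  \<open>D_shift\<close> computable on identities, as the third square of a triangle
  demands.\<close>

lemma shift_zigzag_eq:
  "zigzag_eq R X Y v w \<Longrightarrow> zigzag_eq R (shift X) (shift Y) (map shift_letter v) (map shift_letter w)"
proof (induction rule: zigzag_eq.induct)
  case (refl X Y w)
  then show ?case by (intro zigzag_eq.refl shift_zigzag)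
next
  case (sym X Y v w)
  then show ?case by (blast intro: zigzag_eq.sym)
next
  case (trans X Y u v w)
  then show ?case by (blast intro: zigzag_eq.trans)
next
  case (whisker W X u Y v v' Z w)
  then show ?case using zigzag_eq.whisker[OF shift_zigzag _ shift_zigzag] by fastforce
next
  case (ident X)
  have "(\<lambda>n. chain_id X (n + 1)) = chain_id (shift X)"
    by (simp add: chain_id_def shift_simps fun_eq_iff)
  then show ?case using zigzag_eq.ident[OF shift_in_complexes[OF ident]] by simp
next
  case (comp X Y Z f g)
  have "(\<lambda>n. chain_comp X g f (n + 1)) = chain_comp (shift X) (\<lambda>n. g (n + 1)) (\<lambda>n. f (n + 1))"
    by (simp add: chain_comp_def shift_simps fun_eq_iff)
  then show ?case
    using zigzag_eq.comp[OF shift_in_complexes[OF comp(1)] shift_in_complexes[OF comp(2)]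
        shift_in_complexes[OF comp(3)] shift_chain_maps[OF comp(1,2,4)] shift_chain_maps[OF comp(2,3,5)]]
    by simp
next
  case (inv_right X Y s)
  then show ?case by (simp add: zigzag_eq.inv_right shift_in_complexes shift_quasi_isos)
next
  case (inv_left X Y s)
  then show ?case by (simp add: zigzag_eq.inv_left shift_in_complexes shift_quasi_isos)
qed

lemma D_shift_id:
  assumes X: "X \<in> complexes R"
  shows "D_shift R X X (D_id R X) = D_id R (shift X)"
proof -
  have "zigzag_class R (shift X) (shift X) (map shift_letter w) = D_id R (shift X)" if "w \<in> D_id R X" for w
    using zigzag_class_eq[OF shift_zigzag_eq] that by (fastforce simp: D_id_def zigzag_class_def[of _ X])
  moreover have "[] \<in> D_id R X" by (simp add: D_id_def zigzag_class_def zigzag_eq.refl zigzag.empty X)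
  ultimately show ?thesis unfolding D_shift_def by blast
qed

lemma D_id_iso:
  assumes X: "X \<in> complexes R"
  shows "D_id R X \<in> D_isos R X X"
proof -
  note z = zigzag.empty[OF X]
  have "D_id R X \<in> D_hom R X X" using z by (auto simp: D_hom_def D_id_def)
  moreover have "D_comp R X X (D_id R X) (D_id R X) = D_id R X"
    using D_comp_class[OF z z] by (simp add: D_id_def)
  ultimately show ?thesis by (auto simp: D_isos_def)
qed

text \<open>With identities as the three comparison isomorphisms, the squares in
  \<open>exact_triangle\<close> become unit laws of composition.\<close>

lemma cone_exact_triangle:
  assumes X: "X \<in> complexes R" and Y: "Y \<in> complexes R" and f: "f \<in> chain_maps R X Y"
  shows "exact_triangle R X Y (cone X Y f) (D_of R X Y f) (D_of R Y (cone X Y f) (cone_incl X Y))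
    (D_of R (cone X Y f) (shift X) (cone_proj X Y))"
proof -
  let ?C = "cone X Y f"
  note C = cone_in_complexes[OF X Y f] and SX = shift_in_complexes[OF X]
  have zf: "zigzag R X Y [Fwd X Y f]" by (intro zigzag.intros X Y f)
  have zi: "zigzag R Y ?C [Fwd Y ?C (cone_incl X Y)]"
    by (intro zigzag.intros Y C cone_incl_chain[OF X Y f])
  have zp: "zigzag R ?C (shift X) [Fwd ?C (shift X) (cone_proj X Y)]"
    by (intro zigzag.intros C SX cone_proj_chain[OF X Y f])
  have hom: "D_of R X Y f \<in> D_hom R X Y" "D_of R Y ?C (cone_incl X Y) \<in> D_hom R Y ?C"
    "D_of R ?C (shift X) (cone_proj X Y) \<in> D_hom R ?C (shift X)"
    using zf zi zp unfolding D_hom_def D_of_def by blast+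
  have unit: "D_comp R V W (D_id R W) (D_of R V W g) = D_comp R V W (D_of R V W g) (D_id R V)"
    if z: "zigzag R V W [Fwd V W g]" for V W g
  proof -
    have VW: "zigzag R V V []" "zigzag R W W []" using zigzag_complexes[OF z] by (auto intro: zigzag.empty)
    show ?thesis
      unfolding D_id_def D_of_def D_comp_class[OF z VW(2)] D_comp_class[OF VW(1) z] by simp
  qed
  show ?thesis
    unfolding exact_triangle_def
    by (intro conjI hom bexI[OF _ X] bexI[OF _ Y] bexI[OF _ f] bexI[OF _ D_id_iso[OF X]]
        bexI[OF _ D_id_iso[OF Y]] bexI[OF _ D_id_iso[OF C]])
      (simp_all add: unit[OF zf] unit[OF zi] unit[OF zp] D_shift_id[OF X])
qed

section \<open>Modules as complexes in degree zero\<close>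

text \<open>The other degrees hold the zero submodule of \<open>M\<close>, a zero module on the same
  element type and with the same zero element, so that one formula describes all
  differentials.\<close>

definition degree_zero :: "('a, 'b) module \<Rightarrow> ('a, 'b) cochain" where
  "degree_zero M = \<lparr>obj = (\<lambda>n. if n = 0 then M else M\<lparr>carrier := {\<zero>\<^bsub>M\<^esub>}\<rparr>),
     diff = (\<lambda>n. \<lambda>x\<in>carrier (if n = 0 then M else M\<lparr>carrier := {\<zero>\<^bsub>M\<^esub>}\<rparr>). \<zero>\<^bsub>M\<^esub>)\<rparr>"

lemma degree_zero_simps:
  "obj (degree_zero M) 0 = M"
  "n \<noteq> 0 \<Longrightarrow> obj (degree_zero M) n = M\<lparr>carrier := {\<zero>\<^bsub>M\<^esub>}\<rparr>"
  "\<zero>\<^bsub>obj (degree_zero M) n\<^esub> = \<zero>\<^bsub>M\<^esub>"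
  "x \<in> carrier (obj (degree_zero M) n) \<Longrightarrow> diff (degree_zero M) n x = \<zero>\<^bsub>M\<^esub>"
  by (simp_all add: degree_zero_def)

lemma degree_zero_in_complexes:
  assumes M: "module R M"
  shows "degree_zero M \<in> complexes R"
proof -
  interpret M: module R M by fact
  have mod: "module R (obj (degree_zero M) n)" for n
    using M submodule_module[OF M submodule_zero[OF M]] by (simp add: degree_zero_def)
  have "diff (degree_zero M) n \<in> module_hom R (obj (degree_zero M) n) (obj (degree_zero M) (n + 1))" for n
  proof -
    have "diff (degree_zero M) n = (\<lambda>x\<in>carrier (obj (degree_zero M) n). \<zero>\<^bsub>M\<^esub>)"
      by (simp add: degree_zero_def)
    moreover have "linear_map R (obj (degree_zero M) n) (obj (degree_zero M) (n + 1)) (\<lambda>x. \<zero>\<^bsub>M\<^esub>)"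
      by (auto intro!: linear_mapI simp: degree_zero_def)
    ultimately show ?thesis using restrict_in_module_hom[OF mod] by metis
  qed
  moreover have "diff (degree_zero M) (n + 1) (diff (degree_zero M) n x) = \<zero>\<^bsub>obj (degree_zero M) (n + 1 + 1)\<^esub>"
    if "x \<in> carrier (obj (degree_zero M) n)" for n x
    using that by (auto simp: degree_zero_def)
  ultimately show ?thesis using mod by (simp add: complexes_def)
qed

lemma degree_zero_boundaries:
  assumes "module R M"
  shows "cocycles (degree_zero M) n = carrier (obj (degree_zero M) n)"
    "coboundaries (degree_zero M) n = {\<zero>\<^bsub>M\<^esub>}"
proof -
  show "cocycles (degree_zero M) n = carrier (obj (degree_zero M) n)"
    by (auto simp: cocycles_iff degree_zero_simps)
  have "\<zero>\<^bsub>M\<^esub> \<in> coboundaries (degree_zero M) n"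
    using submoduleD(2)[OF complexesD(1) submodule_coboundaries] degree_zero_in_complexes[OF assms]
    by (metis degree_zero_simps(3))
  then show "coboundaries (degree_zero M) n = {\<zero>\<^bsub>M\<^esub>}"
    unfolding coboundaries_def by (auto simp: degree_zero_simps)
qed

definition degree_zero_map ::
    "('a, 'b) module \<Rightarrow> ('a, 'c) module \<Rightarrow> ('b \<Rightarrow> 'c) \<Rightarrow> int \<Rightarrow> 'b \<Rightarrow> 'c" where
  "degree_zero_map M N f n = restrict f (carrier (obj (degree_zero M) n))"

lemma degree_zero_map_chain:
  assumes M: "module R M" and N: "module R N" and f: "linear_map R M N f"
  shows "degree_zero_map M N f \<in> chain_maps R (degree_zero M) (degree_zero N)"
proof -
  note f0 = linear_map_zero[OF M N f]
  interpret M: module R M by fact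
  interpret N: module R N by fact
  have "linear_map R (obj (degree_zero M) n) (obj (degree_zero N) n) f" for n
    using f f0 by (cases "n = 0") (auto simp: degree_zero_simps linear_map_def)
  then have "degree_zero_map M N f n \<in> module_hom R (obj (degree_zero M) n) (obj (degree_zero N) n)" for n
    unfolding degree_zero_map_def
    using restrict_in_module_hom complexesD(1)[OF degree_zero_in_complexes[OF M]] by blast
  moreover have "degree_zero_map M N f (n + 1) (diff (degree_zero M) n x) =
      diff (degree_zero N) n (degree_zero_map M N f n x)" if x: "x \<in> carrier (obj (degree_zero M) n)" for n x
  proof -
    have "\<zero>\<^bsub>M\<^esub> \<in> carrier (obj (degree_zero M) (n + 1))" by (simp add: degree_zero_def)
    moreover have "f x \<in> carrier (obj (degree_zero N) n)"
      using x f0 linear_map_closed[OF f] by (auto simp: degree_zero_def split: if_splits)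
    ultimately show ?thesis using x f0 by (simp add: degree_zero_map_def degree_zero_simps)
  qed
  ultimately show ?thesis by (simp add: chain_maps_def)
qed

context noetherian_ideal
begin

text \<open>All differentials vanish, so cohomology is the quotient of each term by zero. Its
  elements are cosets, hence it is only isomorphic to the term, through the identity map.\<close>

lemma degree_zero_cofinite:
  assumes M: "M \<in> cofinite"
  shows "degree_zero M \<in> D_cof R \<aa>"
proof -
  note MM = cofinite_module[OF M]
  note X = degree_zero_in_complexes[OF MM]
  have "cohomology (degree_zero M) n \<in> cofinite" for n
  proof -
    let ?O = "obj (degree_zero M) n"
    have O: "?O \<in> cofinite"
      using M cofinite_zero[OF complexesD(1)[OF X, of n]] by (cases "n = 0") (simp_all add: degree_zero_simps)
    have Oupd: "?O\<lparr>carrier := carrier ?O\<rparr> = ?O" by simp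
    have ker: "a_kernel ?O ?O (\<lambda>x. x) = {\<zero>\<^bsub>M\<^esub>}"
      using submoduleD(2)[OF complexesD(1)[OF X] submodule_cocycles[OF X], of n]
      by (auto simp: a_kernel_iff degree_zero_simps cocycles_iff)
    have "linear_map R ?O ?O (\<lambda>x. x)" by (auto intro!: linear_mapI)
    from first_iso[OF cofinite_module[OF O] cofinite_module[OF O] this _ ker]
    obtain g where "linear_map R (quotient_module ?O {\<zero>\<^bsub>M\<^esub>}) ?O g"
      "bij_betw g (carrier (quotient_module ?O {\<zero>\<^bsub>M\<^esub>})) (carrier ?O)" by auto
    moreover have "cohomology (degree_zero M) n = quotient_module ?O {\<zero>\<^bsub>M\<^esub>}"
      by (simp only: cohomology_def degree_zero_boundaries[OF MM] Oupd)
    ultimately show ?thesis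
      using cofinite_iso[OF O] module_cohomology[OF X, of n] by metis
  qed
  then show ?thesis using X by (simp add: D_cof_def)
qed

text \<open>Cofinite cohomology of the cone yields one cofinite model of the kernel, in degree -1,
  and one of the cokernel, in degree 0. Every other kernel or cokernel is isomorphic to
  these.\<close>

lemma abelian_of_thick:
  assumes thick: "thick_subcategory R (D_cof R \<aa> :: ('a, ('a, 'i) univ) cochain set)"
  shows "abelian_subcategory R (M_cof R \<aa> :: ('a, ('a, 'i) univ) module set)"
  unfolding abelian_subcategory_def
proof (intro conjI ballI allI impI)
  show "M_cof R \<aa> \<subseteq> {M :: ('a, ('a, 'i) univ) module. module R M}" by (auto simp: M_cof_def)
  fix M N :: "('a, ('a, 'i) univ) module" and f
  assume M: "M \<in> cofinite" and N: "N \<in> cofinite" and "f \<in> module_hom R M N"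
  then have f: "linear_map R M N f" by (simp add: module_hom_linear)
  note MM = cofinite_module[OF M] and NM = cofinite_module[OF N]
  interpret M: module R M by (rule MM)
  interpret N: module R N by (rule NM)
  let ?X = "degree_zero M" and ?Y = "degree_zero N" and ?F = "degree_zero_map M N f"
  note X = degree_zero_in_complexes[OF MM] and Y = degree_zero_in_complexes[OF NM]
    and F = degree_zero_map_chain[OF MM NM f]
  let ?C = "cone ?X ?Y ?F"
  note C = cone_in_complexes[OF X Y F]
  note f0 = linear_map_zero[OF MM NM f]
  have "?C \<in> D_cof R \<aa>"
    using thick cone_exact_triangle[OF X Y F] degree_zero_cofinite[OF M] degree_zero_cofinite[OF N]
    unfolding thick_subcategory_def by blast
  then have HC: "cohomology ?C n \<in> cofinite" for n by (rule D_cofD(2))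
  have inv: "a_inv (obj (degree_zero M) n) \<zero>\<^bsub>M\<^esub> = \<zero>\<^bsub>M\<^esub>" for n
  proof -
    interpret O: module R "obj (degree_zero M) n" by (rule complexesD(1)[OF X])
    show ?thesis using O.M.neg_zero by (simp add: degree_zero_simps)
  qed
  have addN: "a \<oplus>\<^bsub>obj ?Y n\<^esub> b = a \<oplus>\<^bsub>N\<^esub> b" for a b n by (simp add: degree_zero_def)
  \<comment> \<open>Both complexes have zero differentials, so only \<open>f\<close> survives in the
    differential of the cone. Outside degree zero the formula still holds because \<open>f\<close>
    preserves zero.\<close>
  have diffs: "diff ?C n (UPair x y) = UPair \<zero>\<^bsub>M\<^esub> (f x)"
    if "x \<in> carrier (obj ?X (n + 1))" "y \<in> carrier (obj ?Y n)" for n x y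
  proof -
    have "f x \<in> carrier N"
      using that(1) linear_map_closed[OF f] f0 by (auto simp: degree_zero_def split: if_splits)
    then show ?thesis
      using that by (simp only: cone_simps(2) degree_zero_simps(4) inv addN degree_zero_map_def
          restrict_apply' N.M.r_zero)
  qed
  \<comment> \<open>The shift of the source places \<open>M\<close> in degree -1 and
    \<open>N\<close> in degree 0. Degree -2 is zero and is listed for the coboundaries in degree
    -1.\<close>
  have Cobj: "obj ?C (-1) = sum_module M (N\<lparr>carrier := {\<zero>\<^bsub>N\<^esub>}\<rparr>)"
    "obj ?C 0 = sum_module (M\<lparr>carrier := {\<zero>\<^bsub>M\<^esub>}\<rparr>) N"
    "obj ?C (-2) = sum_module (M\<lparr>carrier := {\<zero>\<^bsub>M\<^esub>}\<rparr>) (N\<lparr>carrier := {\<zero>\<^bsub>N\<^esub>}\<rparr>)"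
    "\<zero>\<^bsub>obj ?C n\<^esub> = UPair \<zero>\<^bsub>M\<^esub> \<zero>\<^bsub>N\<^esub>" for n
    by (simp_all add: cone_simps degree_zero_simps)
  have zero1: "cocycles ?C (-1) = {UPair x \<zero>\<^bsub>N\<^esub> | x. x \<in> a_kernel M N f}"
    unfolding cocycles_iff[abs_def] set_eq_iff cocycles_iff
    using diffs[of _ "-1"] f0 by (auto elim!: sum_module_cases simp: Cobj degree_zero_simps a_kernel_iff)
  have bound1: "coboundaries ?C (-1) = {UPair \<zero>\<^bsub>M\<^esub> \<zero>\<^bsub>N\<^esub>}"
  proof -
    have "carrier (obj ?C (-2)) = {UPair \<zero>\<^bsub>M\<^esub> \<zero>\<^bsub>N\<^esub>}"
      unfolding Cobj by (auto elim!: sum_module_cases)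
    then show ?thesis
      using diffs[of "\<zero>\<^bsub>M\<^esub>" "-2" "\<zero>\<^bsub>N\<^esub>"] f0 by (simp add: coboundaries_def degree_zero_simps)
  qed
  have zero0: "cocycles ?C 0 = {UPair \<zero>\<^bsub>M\<^esub> y | y. y \<in> carrier N}"
    unfolding set_eq_iff cocycles_iff
    using diffs[of _ 0] f0 by (auto elim!: sum_module_cases simp: Cobj degree_zero_simps)
  have bound0: "coboundaries ?C 0 = {UPair \<zero>\<^bsub>M\<^esub> (f x) | x. x \<in> carrier M}"
  proof -
    have "carrier (obj ?C (-1)) = (\<lambda>x. UPair x \<zero>\<^bsub>N\<^esub>) ` carrier M"
      unfolding Cobj by (auto elim!: sum_module_cases)
    moreover have "diff ?C (-1) (UPair x \<zero>\<^bsub>N\<^esub>) = UPair \<zero>\<^bsub>M\<^esub> (f x)" if "x \<in> carrier M" for x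
      using diffs[of x "-1" "\<zero>\<^bsub>N\<^esub>"] that by (simp add: degree_zero_simps)
    ultimately show ?thesis by (auto simp: coboundaries_def image_image)
  qed
  show "K \<in> cofinite" if "is_kernel R M N f K k" for K k
  proof -
    have K: "module R K" "linear_map R K M k" "inj_on k (carrier K)" "k ` carrier K = a_kernel M N f"
      using that by (auto simp: is_kernel_def module_hom_linear)
    \<comment> \<open>The submodule through which an arbitrary kernel object \<open>K\<close> is
      compared with the cohomology in degree -1.\<close>
    let ?I = "M\<lparr>carrier := a_kernel M N f\<rparr>"
    have I: "module R ?I" by (rule submodule_module[OF MM submodule_kernel[OF MM NM f]])
    have k: "linear_map R K ?I k" "bij_betw k (carrier K) (carrier ?I)"
      using K by (auto simp: linear_map_def bij_betw_def)
    let ?P = "(obj ?C (-1))\<lparr>carrier := cocycles ?C (-1)\<rparr>"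
    have P: "module R ?P" by (rule module_cocycles[OF C])
    have u: "linear_map R ?P ?I ufst"
      by (rule linear_mapI) (auto simp: zero1 Cobj)
    have "ufst ` carrier ?P = carrier ?I" by (force simp: zero1)
    moreover have "a_kernel ?P ?I ufst = coboundaries ?C (-1)"
      using f0 by (auto simp: a_kernel_iff zero1 bound1)
    ultimately obtain g where "linear_map R (cohomology ?C (-1)) ?I g"
      "bij_betw g (carrier (cohomology ?C (-1))) (carrier ?I)"
      using first_iso[OF P I u] unfolding cohomology_def by blast
    then have "?I \<in> cofinite" by (rule cofinite_iso'[OF HC I])
    then show ?thesis by (rule cofinite_iso[OF _ K(1) k])
  qed
  show "Q \<in> cofinite" if "is_cokernel R M N f Q c" for Q c
  proof -
    have Q: "module R Q" "linear_map R N Q c" "c ` carrier N = carrier Q" "a_kernel N Q c = f ` carrier M"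
      using that by (auto simp: is_cokernel_def module_hom_linear)
    let ?P = "(obj ?C 0)\<lparr>carrier := cocycles ?C 0\<rparr>"
    have P: "module R ?P" by (rule module_cocycles[OF C])
    \<comment> \<open>The second projection followed by \<open>c\<close> vanishes exactly on the
      pairs (0, f x), which are the coboundaries in degree 0.\<close>
    have u: "linear_map R ?P Q (\<lambda>p. c (usnd p))"
      by (rule linear_mapI) (auto simp: zero0 Cobj linear_map_simps[OF Q(2)])
    have "(\<lambda>p. c (usnd p)) ` carrier ?P = carrier Q"
      unfolding Q(3)[symmetric] by (force simp: zero0)
    moreover have "a_kernel ?P Q (\<lambda>p. c (usnd p)) = coboundaries ?C 0"
    proof -
      have "y \<in> carrier N \<and> c y = \<zero>\<^bsub>Q\<^esub> \<longleftrightarrow> y \<in> f ` carrier M" for y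
        unfolding Q(4)[symmetric] a_kernel_iff ..
      then show ?thesis by (auto simp: a_kernel_iff zero0 bound0 set_eq_iff) blast+
    qed
    ultimately obtain g where "linear_map R (cohomology ?C 0) Q g"
      "bij_betw g (carrier (cohomology ?C 0)) (carrier Q)"
      using first_iso[OF P Q(1) u] unfolding cohomology_def by blast
    then show ?thesis by (rule cofinite_iso'[OF HC Q(1)])
  qed
qed

end

theorem proposition3p2:
  fixes A :: "('a, 'r) ring_scheme" and \<aa> :: "'a set"
  assumes "cring A" and "noetherian_ring A" and "ideal \<aa> A"
  shows "thick_subcategory A (D_cof A \<aa> :: ('a, ('a, 'i) univ) cochain set) \<longleftrightarrow>
    abelian_subcategory A (M_cof A \<aa> :: ('a, ('a, 'i) univ) module set)"
proof -
  interpret noetherian_ideal A \<aa> using assms by (rule noetherian_ideal.intro)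
  show ?thesis
  proof
    assume "abelian_subcategory A (M_cof A \<aa> :: ('a, ('a, 'i) univ) module set)"
    then interpret cofinite_abelian_univ A \<aa> "TYPE('i)" by unfold_locales
    show "thick_subcategory A (D_cof A \<aa> :: ('a, ('a, 'i) univ) cochain set)" by (rule thick_D_cof)
  qed (rule abelian_of_thick)
qed

end
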